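(* Let $\mathcal{L}$ be a special ample line bundle on $V$. Then the ring $\bigoplus_{m\ge 0} H^0(V,\mathcal{L}^m)$ is quadratic.
   Context: Let $\Phi$ be an irreducible, reduced (finite, crystallographic) root system of rank $n$, with set of roots $\Delta$, root lattice $Y$, weight lattice $X \supseteq Y$, coroot lattice $X^\vee$ and coweight lattice $Y^\vee\supseteq X^\vee$, and pairing $\langle\,,\rangle : X \times X^\vee \to \mathbb{Z}$ extended to $(X\otimes_{\mathbb Z}\mathbb{R})\times X^\vee$. Let $F$ be the Weyl fan in $Y^\vee \otimes_{\mathbb Z} \mathbb{R}$ (cut out by the root hyperplanes) and $F_n$ the set of its maximal cones (Weyl chambers). For $\sigma\in F_n$ let $\{\alpha_{i,\sigma} : 1\le i\le n\}$ be the corresponding simple roots; $x \in X\otimes_{\mathbb Z}\mathbb{R}$ is $\sigma$-dominant if $\langle x, \alpha_{i,\sigma}^\vee\rangle \ge 0$ for all $i$. For adjacent chambers $\sigma,\sigma'$, $\alpha_{\sigma,\sigma'}\in\Delta$ is the unique root positive on $\sigma$ and negative on $\sigma'$. $V$ is the complex toric variety with fan $F$ and lattice $Y^\vee$; it is smooth and projective, with torus $T_1 = \operatorname{Spec}\mathbb{C}[Y]$. The torus $T = \operatorname{Spec}\mathbb{C}[X]$ acts on $V$ via the projection $T \twoheadrightarrow T_1$. Isomorphism classes of $T$-equivariant ample line bundles on $V$ correspond bijectively, in the usual way, to ample polytopes: convex polytopes $P \subset X\otimes_{\mathbb Z}\mathbb{R}$ with vertices given by a set $\{\mu_\sigma :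 \sigma\in F_n\} \subset X$ such that for adjacent $\sigma,\sigma'$, $\mu_\sigma - \mu_{\sigma'} = r_{\sigma,\sigma'}\alpha_{\sigma,\sigma'}$ with $r_{\sigma,\sigma'} \in \mathbb{Z}_{>0}$. Put $\Lambda(P) := P \cap (\mu_\sigma + Y)$ (independent of $\sigma$). The sign conventions are such that, if $\mathcal{L}$ corresponds to $P$, a character $x\in X$ occurs in $H^0(V,\mathcal{L})$ iff $x\in\Lambda(P)$, and then with multiplicity one. The line bundle is called special ample if its polytope is special, i.e. $\mu_\sigma$ is $\sigma$-dominant for every $\sigma\in F_n$. A commutative graded ring $A=\bigoplus_{m\ge0}A_m$ with $A_0=\mathbb{C}$ is quadratic if it is generated over $\mathbb{C}$ by $A_1$ and the kernel of $\operatorname{Sym}(A_1)\to A$ is generated as an ideal by its degree-two part. *)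

theory Defs
  imports
    "HOL-Analysis.Analysis"
    "HOL-Computational_Algebra.Polynomial"
    "HOL-Library.Multiset"
    "HOL-Library.Poly_Mapping"
    "HOL-Library.Function_Algebras"
begin

section \<open>Root systems and the Weyl fan\<close>

text \<open>
  The type \<open>'a\<close> is $X \otimes \mathbb{R}$ with a Weyl-invariant inner product, which also
  identifies it with the dual space $Y^\vee \otimes \mathbb{R}$; the pairing is the inner product
  and the rank is \<open>DIM('a)\<close>.
\<close>

definition coroot :: "'a::euclidean_space \<Rightarrow> 'a" where
  "coroot \<alpha> = (2 / (\<alpha> \<bullet> \<alpha>)) *\<^sub>R \<alpha>"

definition root_system :: "'a::euclidean_space set \<Rightarrow> bool" where
  "root_system \<Phi> \<longleftrightarrow>
     finite \<Phi> \<and> 0 \<notin> \<Phi> \<and> span \<Phi> = UNIV \<and>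
     (\<forall>\<alpha>\<in>\<Phi>. \<forall>\<beta>\<in>\<Phi>. \<beta> - (\<beta> \<bullet> coroot \<alpha>) *\<^sub>R \<alpha> \<in> \<Phi>) \<and>
     (\<forall>\<alpha>\<in>\<Phi>. \<forall>\<beta>\<in>\<Phi>. \<beta> \<bullet> coroot \<alpha> \<in> \<int>)"

definition reduced_roots :: "'a::euclidean_space set \<Rightarrow> bool" where
  "reduced_roots \<Phi> \<longleftrightarrow> (\<forall>\<alpha>\<in>\<Phi>. \<forall>c. c *\<^sub>R \<alpha> \<in> \<Phi> \<longrightarrow> c = 1 \<or> c = -1)"

definition irreducible_roots :: "'a::euclidean_space set \<Rightarrow> bool" where
  "irreducible_roots \<Phi> \<longleftrightarrow>
     \<Phi> \<noteq> {} \<and>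
     \<not> (\<exists>A B. A \<noteq> {} \<and> B \<noteq> {} \<and> A \<union> B = \<Phi> \<and> A \<inter> B = {} \<and> (\<forall>a\<in>A. \<forall>b\<in>B. a \<bullet> b = 0))"

definition root_lattice :: "'a::euclidean_space set \<Rightarrow> 'a set" where
  "root_lattice \<Phi> = {\<Sum>\<alpha>\<in>\<Phi>. of_int (k \<alpha>) *\<^sub>R \<alpha> | k :: 'a \<Rightarrow> int. True}"

definition weight_lattice :: "'a::euclidean_space set \<Rightarrow> 'a set" where
  "weight_lattice \<Phi> = {x. \<forall>\<alpha>\<in>\<Phi>. x \<bullet> coroot \<alpha> \<in> \<int>}"

definition weyl_chambers :: "'a::euclidean_space set \<Rightarrow> 'a set set" where
  "weyl_chambers \<Phi> = closure ` components {v. \<forall>\<alpha>\<in>\<Phi>. \<alpha> \<bullet> v \<noteq> 0}"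

definition weyl_fan :: "'a::euclidean_space set \<Rightarrow> 'a set set" where
  "weyl_fan \<Phi> = {\<tau>. \<tau> \<noteq> {} \<and> (\<exists>\<sigma>\<in>weyl_chambers \<Phi>. \<tau> face_of \<sigma>)}"

definition positive_roots :: "'a::euclidean_space set \<Rightarrow> 'a set \<Rightarrow> 'a set" where
  "positive_roots \<Phi> \<sigma> = {\<alpha>\<in>\<Phi>. \<forall>v\<in>interior \<sigma>. \<alpha> \<bullet> v > 0}"

definition simple_roots :: "'a::euclidean_space set \<Rightarrow> 'a set \<Rightarrow> 'a set" where
  "simple_roots \<Phi> \<sigma> =
     {\<alpha>\<in>positive_roots \<Phi> \<sigma>.
        \<not> (\<exists>\<beta>\<in>positive_roots \<Phi> \<sigma>. \<exists>\<gamma>\<in>positive_roots \<Phi> \<sigma>. \<alpha> = \<beta> + \<gamma>)}"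

definition chamber_dominant :: "'a::euclidean_space set \<Rightarrow> 'a set \<Rightarrow> 'a \<Rightarrow> bool" where
  "chamber_dominant \<Phi> \<sigma> x \<longleftrightarrow> (\<forall>\<alpha>\<in>simple_roots \<Phi> \<sigma>. x \<bullet> coroot \<alpha> \<ge> 0)"

definition adjacent_chambers :: "'a::euclidean_space set \<Rightarrow> 'a set \<Rightarrow> 'a set \<Rightarrow> bool" where
  "adjacent_chambers \<Phi> \<sigma> \<sigma>' \<longleftrightarrow>
     \<sigma> \<in> weyl_chambers \<Phi> \<and> \<sigma>' \<in> weyl_chambers \<Phi> \<and> \<sigma> \<noteq> \<sigma>' \<and>
     aff_dim (\<sigma> \<inter> \<sigma>') = int DIM('a) - 1"

definition wall_root :: "'a::euclidean_space set \<Rightarrow> 'a set \<Rightarrow> 'a set \<Rightarrow> 'a" where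
  "wall_root \<Phi> \<sigma> \<sigma>' =
     (THE \<alpha>. \<alpha> \<in> \<Phi> \<and> (\<forall>v\<in>interior \<sigma>. \<alpha> \<bullet> v > 0) \<and> (\<forall>v\<in>interior \<sigma>'. \<alpha> \<bullet> v < 0))"


section \<open>Ample and special polytopes\<close>

definition ample_polytope ::
    "'a::euclidean_space set \<Rightarrow> 'a set \<Rightarrow> ('a set \<Rightarrow> 'a) \<Rightarrow> bool" where
  "ample_polytope \<Phi> P \<mu> \<longleftrightarrow>
     polytope P \<and> {x. x extreme_point_of P} = \<mu> ` weyl_chambers \<Phi> \<and>
     \<mu> ` weyl_chambers \<Phi> \<subseteq> weight_lattice \<Phi> \<and>
     (\<forall>\<sigma> \<sigma>'. adjacent_chambers \<Phi> \<sigma> \<sigma>' \<longrightarrow>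
        (\<exists>r::int. r > 0 \<and> \<mu> \<sigma> - \<mu> \<sigma>' = of_int r *\<^sub>R wall_root \<Phi> \<sigma> \<sigma>'))"

definition special_polytope :: "'a::euclidean_space set \<Rightarrow> ('a set \<Rightarrow> 'a) \<Rightarrow> bool" where
  "special_polytope \<Phi> \<mu> \<longleftrightarrow> (\<forall>\<sigma>\<in>weyl_chambers \<Phi>. chamber_dominant \<Phi> \<sigma> (\<mu> \<sigma>))"


section \<open>Complex toric varieties\<close>

text \<open>
  \<open>M\<close> is the character lattice of the torus, \<open>F\<close> a fan in the dual space.
\<close>

definition dual_cone :: "'a::real_inner set \<Rightarrow> 'a set" where
  "dual_cone \<tau> = {u. \<forall>v\<in>\<tau>. u \<bullet> v \<ge> 0}"

definition perp :: "'a::real_inner set \<Rightarrow> 'a set" where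
  "perp \<tau> = {u. \<forall>v\<in>\<tau>. u \<bullet> v = 0}"

type_synonym 'a toric_point = "'a set \<times> ('a \<Rightarrow> complex)"

text \<open>
  The closed points of $U_\sigma = \operatorname{Spec} \mathbb{C}[\sigma^\vee \cap M]$ are the monoid
  homomorphisms $\sigma^\vee \cap M \to (\mathbb{C}, \cdot)$, and for $\tau \subseteq \sigma$ in
  the fan $U_\tau$ is glued into $U_\sigma$ by restriction of homomorphisms. Every point of the
  glued variety lies in a smallest chart $U_\tau$, namely the one in which the homomorphism
  $\gamma$ is nonzero exactly on $\tau^\perp \cap M$. We take \<open>(\<tau>, \<gamma>)\<close>, with \<open>\<gamma>\<close> extended by \<open>0\<close>,
  as the representative of that point. It lies in \<open>U\<^sub>\<sigma>\<close> iff \<open>\<tau> \<subseteq> \<sigma>\<close>, and then the corresponding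
  homomorphism on $\sigma^\vee \cap M$ is the restriction of \<open>\<gamma>\<close>.
\<close>

definition toric_variety :: "'a::real_inner set \<Rightarrow> 'a set set \<Rightarrow> 'a toric_point set" where
  "toric_variety M F =
     {(\<tau>, \<gamma>). \<tau> \<in> F \<and> \<gamma> 0 = 1 \<and>
        (\<forall>u\<in>dual_cone \<tau> \<inter> M. \<forall>v\<in>dual_cone \<tau> \<inter> M. \<gamma> (u + v) = \<gamma> u * \<gamma> v) \<and>
        (\<forall>u. \<gamma> u \<noteq> 0 \<longleftrightarrow> u \<in> perp \<tau> \<inter> M)}"

definition toric_chart ::
    "'a::real_inner set \<Rightarrow> 'a set set \<Rightarrow> 'a set \<Rightarrow> 'a toric_point set" where
  "toric_chart M F \<sigma> = {p \<in> toric_variety M F. fst p \<subseteq> \<sigma>}"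

definition character_value :: "'a \<Rightarrow> 'a toric_point \<Rightarrow> complex" where
  "character_value u p = snd p u"

definition regular_on_chart ::
    "'a::real_inner set \<Rightarrow> 'a set set \<Rightarrow> 'a set \<Rightarrow> ('a toric_point \<Rightarrow> complex) \<Rightarrow> bool" where
  "regular_on_chart M F \<sigma> f \<longleftrightarrow>
     (\<exists>S c. finite S \<and> S \<subseteq> dual_cone \<sigma> \<inter> M \<and>
        (\<forall>p\<in>toric_chart M F \<sigma>. f p = (\<Sum>u\<in>S. c u * character_value u p)))"

text \<open>
  A line bundle that is trivial on the charts \<open>U\<^sub>\<sigma>\<close>, for \<open>\<sigma>\<close> in a set \<open>C\<close> of cones whose charts cover
  the variety, is given by its transition functions \<open>g \<sigma> \<sigma>'\<close> on \<open>U\<^sub>\<sigma> \<inter> U\<^sub>\<sigma>\<^sub>'\<close>. Its fibre over \<open>p\<close> consists of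
  the families \<open>z\<close> of local coordinates \<open>z \<sigma>\<close>, one for each chart containing \<open>p\<close> (and \<open>0\<close> for
  the other indices).
\<close>

type_synonym 'a transition = "'a set \<Rightarrow> 'a set \<Rightarrow> 'a toric_point \<Rightarrow> complex"

definition bundle_fibre ::
    "'a::real_inner set \<Rightarrow> 'a set set \<Rightarrow> 'a set set \<Rightarrow> 'a transition \<Rightarrow> 'a toric_point
       \<Rightarrow> ('a set \<Rightarrow> complex) set" where
  "bundle_fibre M F C g p =
     {z. (\<forall>\<sigma>. \<not> (\<sigma> \<in> C \<and> p \<in> toric_chart M F \<sigma>) \<longrightarrow> z \<sigma> = 0) \<and>
         (\<forall>\<sigma>\<in>C. \<forall>\<sigma>'\<in>C. p \<in> toric_chart M F \<sigma> \<inter> toric_chart M F \<sigma>' \<longrightarrow> z \<sigma> = g \<sigma> \<sigma>' p * z \<sigma>')}"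

definition global_sections ::
    "'a::real_inner set \<Rightarrow> 'a set set \<Rightarrow> 'a set set \<Rightarrow> 'a transition
       \<Rightarrow> ('a toric_point \<Rightarrow> 'a set \<Rightarrow> complex) set" where
  "global_sections M F C g =
     {s. (\<forall>p\<in>toric_variety M F. s p \<in> bundle_fibre M F C g p) \<and>
         (\<forall>p. p \<notin> toric_variety M F \<longrightarrow> s p = 0) \<and>
         (\<forall>\<sigma>\<in>C. regular_on_chart M F \<sigma> (\<lambda>p. s p \<sigma>))}"

definition bundle_power :: "'a transition \<Rightarrow> nat \<Rightarrow> 'a transition" where
  "bundle_power g m = (\<lambda>\<sigma> \<sigma>' p. g \<sigma> \<sigma>' p ^ m)"

text \<open>
  The ring $\bigoplus_m H^0(V, \mathcal{L}^m)$ is realised inside the polynomial ring over the ring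
  of all families of local coordinates, a section \<open>s\<close> of $\mathcal{L}^m$ being placed in degree
  \<open>m\<close> as \<open>monom s m\<close>. The multiplication of sections is pointwise in local coordinates. Since
  sections are \<open>0\<close> where they are not defined, the constant section \<open>1\<close> is the unit of this ring but not
  of the ambient one.
\<close>

definition section_ring ::
    "'a::real_inner set \<Rightarrow> 'a set set \<Rightarrow> 'a set set \<Rightarrow> 'a transition
       \<Rightarrow> nat \<Rightarrow> ('a toric_point \<Rightarrow> 'a set \<Rightarrow> complex) poly set" where
  "section_ring M F C g m = (\<lambda>s. monom s m) ` global_sections M F C (bundle_power g m)"

definition section_scalar ::
    "'a::real_inner set \<Rightarrow> 'a set set \<Rightarrow> 'a set set
       \<Rightarrow> complex \<Rightarrow> ('a toric_point \<Rightarrow> 'a set \<Rightarrow> complex) poly" where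
  "section_scalar M F C c =
     monom (\<lambda>p \<sigma>. if \<sigma> \<in> C \<and> p \<in> toric_chart M F \<sigma> then c else 0) 0"

text \<open>
  The line bundle with polytope vertices \<open>\<mu> \<sigma>\<close>: on \<open>U\<^sub>\<sigma>\<close> it is generated by a section $e_\sigma$ of
  weight \<open>\<mu> \<sigma>\<close>. The torus acts on functions by $(t f)(p) = f(t^{-1} p)$, so the character function
  \<open>u\<close> has weight \<open>- u\<close> and $e_{\sigma'} = \chi^{\mu_\sigma - \mu_{\sigma'}} e_\sigma$. A section of weight
  \<open>x\<close> has local coordinates proportional to $\chi^{\mu_\sigma - x}$, which is regular on all charts
  iff \<open>x\<close> is in the polytope and congruent to the \<open>\<mu> \<sigma>\<close> modulo the root lattice.
\<close>

definition polytope_bundle :: "('a::real_inner set \<Rightarrow> 'a) \<Rightarrow> 'a transition" where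
  "polytope_bundle \<mu> = (\<lambda>\<sigma> \<sigma>' p. character_value (\<mu> \<sigma> - \<mu> \<sigma>') p)"


section \<open>Quadratic graded algebras\<close>

text \<open>
  A graded algebra is a family \<open>A\<close> of subsets of a commutative ring, with structure map
  \<open>\<iota>\<close>; its unit is \<open>\<iota> 1\<close>, which need not be the unit of the ambient ring.
\<close>

definition connected_graded_algebra ::
    "(complex \<Rightarrow> 'r::comm_ring_1) \<Rightarrow> (nat \<Rightarrow> 'r set) \<Rightarrow> bool" where
  "connected_graded_algebra \<iota> A \<longleftrightarrow>
     inj \<iota> \<and> (\<forall>a b. \<iota> (a + b) = \<iota> a + \<iota> b) \<and> (\<forall>a b. \<iota> (a * b) = \<iota> a * \<iota> b) \<and>
     A 0 = range \<iota> \<and>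
     (\<forall>m. \<forall>x\<in>A m. \<iota> 1 * x = x) \<and>
     (\<forall>m. 0 \<in> A m) \<and>
     (\<forall>m. \<forall>x\<in>A m. \<forall>y\<in>A m. x + y \<in> A m) \<and>
     (\<forall>m k. \<forall>x\<in>A m. \<forall>y\<in>A k. x * y \<in> A (m + k)) \<and>
     (\<forall>N a. (\<forall>m. a m \<in> A m) \<and> (\<Sum>m\<le>N. a m) = 0 \<longrightarrow> (\<forall>m\<le>N. a m = 0))"

text \<open>
  Polynomials with one variable for each element of \<open>V\<close>; monomials are multisets of variables.
  The symmetric algebra of a vector space \<open>V\<close> is the quotient of this ring by the ideal generated by
  the relations expressing that \<open>v \<mapsto> poly_var v\<close> is linear.
\<close>

type_synonym 'r mvpoly = "'r multiset \<Rightarrow>\<^sub>0 complex"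

definition mvpolys :: "'r set \<Rightarrow> 'r mvpoly set" where
  "mvpolys V = {f. \<forall>M\<in>Poly_Mapping.keys f. set_mset M \<subseteq> V}"

definition poly_var :: "'r \<Rightarrow> 'r mvpoly" where
  "poly_var v = Poly_Mapping.single {#v#} 1"

definition poly_const :: "complex \<Rightarrow> 'r mvpoly" where
  "poly_const c = Poly_Mapping.single {#} c"

definition linearity_relations ::
    "(complex \<Rightarrow> 'r::comm_ring_1) \<Rightarrow> 'r set \<Rightarrow> 'r mvpoly set" where
  "linearity_relations \<iota> V =
     {poly_var (v + w) - poly_var v - poly_var w | v w. v \<in> V \<and> w \<in> V} \<union>
     {poly_var (\<iota> c * v) - poly_const c * poly_var v | c v. v \<in> V}"

definition ideal_generated :: "'s::comm_ring_1 set \<Rightarrow> 's set \<Rightarrow> 's set" where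
  "ideal_generated S G = {\<Sum>g\<in>B. h g * g | B h. finite B \<and> B \<subseteq> G \<and> h ` B \<subseteq> S}"

definition mvpoly_eval :: "(complex \<Rightarrow> 'r::comm_ring_1) \<Rightarrow> 'r mvpoly \<Rightarrow> 'r" where
  "mvpoly_eval \<iota> f =
     (\<Sum>M\<in>Poly_Mapping.keys f. \<iota> (Poly_Mapping.lookup f M) * prod_mset M)"

definition eval_kernel :: "(complex \<Rightarrow> 'r::comm_ring_1) \<Rightarrow> 'r set \<Rightarrow> 'r mvpoly set" where
  "eval_kernel \<iota> V = {f \<in> mvpolys V. mvpoly_eval \<iota> f = 0}"

text \<open>
  The kernel of $\operatorname{Sym}(A_1) \to A$ is generated by its degree-two part iff the kernel
  upstairs, in the polynomial ring on \<open>A 1\<close>, is generated by its homogeneous quadratic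
  elements together with the linearity relations.
\<close>

definition quadratic_algebra ::
    "(complex \<Rightarrow> 'r::comm_ring_1) \<Rightarrow> (nat \<Rightarrow> 'r set) \<Rightarrow> bool" where
  "quadratic_algebra \<iota> A \<longleftrightarrow>
     connected_graded_algebra \<iota> A \<and>
     (\<forall>m. A m \<subseteq> mvpoly_eval \<iota> ` mvpolys (A 1)) \<and>
     eval_kernel \<iota> (A 1) =
       ideal_generated (mvpolys (A 1))
         (linearity_relations \<iota> (A 1) \<union>
          {f \<in> eval_kernel \<iota> (A 1). \<forall>M\<in>Poly_Mapping.keys f. size M = 2})"

end

(*
  Let Lambda be the set of weights of the sections of L. The section ring of L is the semigroup
  algebra of the pairs (m, x) with x a weight of L^m. Everything rests on one property of Lambda:
  if x is in Lambda and beta is a root with <x, beta> > 0, then x - beta is in Lambda; moreover, for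
  every chamber s, mu_s is the largest element of Lambda in the order given by s.

  Generation in degree one: a weight x of L^m is dominant for some chamber s, and m mu_s descends to
  x by subtracting simple roots that pair positively with the current weight, hence with one of its
  m summands, from which they may be subtracted.

  Quadratic relations: by induction on m it suffices that the fibre over x of the addition map
  Lambda x (m-1)Lambda -> m Lambda is connected by steps (p, q) -> (p + gamma, q - gamma) with gamma
  a root, since such a step lifts to an exchange between two of the m summands. Subtracting a root
  pairing positively with x maps connected components of the fibre over x to components of the fibre
  over x - beta. For dominant x every component is reached in this way from the one-point fibre over
  m mu_s, and by confluence the component does not depend on the path.
*)
theory Submission
  imports Defs
begin

section \<open>Root-saturated sets and fibres of addition\<close>

text \<open>The induction over dominant totals meets an obstacle: raising a component of a pair over
  a dominant x by a simple root \<alpha> gives the total x + \<alpha>, which need not be dominant,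
  so the induction hypothesis may not apply to it. The remedy is to replace \<alpha> by a positive
  root \<beta> of greatest height whose subtraction still reaches the given component. Maximality
  makes x + \<beta> dominant, and subtracting \<beta> is afterwards traded for a chain of simple
  subtractions, the kind for which confluence is available because distinct simple roots are obtuse.
  All this needs only a saturated set with a largest element for each base, and the base is chosen
  after x so that x is dominant. Speciality of the polytope enters in the proof of saturation: the
  vertex of a chamber pairs nonnegatively with the roots positive there, so a weight pairing
  negatively with such a root differs from the vertex by a vector pairing positively with
  it.\<close>

lemma obtuse_roots_sum:
  assumes "root_system \<Phi>" "\<beta> \<in> \<Phi>" "\<gamma> \<in> \<Phi>" "\<beta> \<bullet> \<gamma> < 0"
  shows "\<beta> + \<gamma> \<in> insert 0 \<Phi>"
proof -
  have nz: "\<beta> \<noteq> 0" "\<gamma> \<noteq> 0" using assms unfolding root_system_def by auto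
  then have pos: "\<beta> \<bullet> \<beta> > 0" "\<gamma> \<bullet> \<gamma> > 0" by auto
  obtain n m :: int where n: "\<beta> \<bullet> coroot \<gamma> = n" and m: "\<gamma> \<bullet> coroot \<beta> = m"
    using assms(1-3) unfolding root_system_def by (metis Ints_cases)
  have n': "2 * (\<beta> \<bullet> \<gamma>) = n * (\<gamma> \<bullet> \<gamma>)" and m': "2 * (\<beta> \<bullet> \<gamma>) = m * (\<beta> \<bullet> \<beta>)"
    using n m pos unfolding coroot_def by (auto simp: field_simps inner_commute)
  have "n < 0" "m < 0" using n' m' assms(4) pos by (smt (verit) mult_nonneg_nonneg of_int_0_le_iff)+
  \<comment> \<open>One Cartan integer equal to -1 makes the sum a reflected root. If both are at
    most -2, the squared norm of \<beta> + \<gamma> is at most 0, so the roots are opposite.\<close>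
  consider "n = -1" | "m = -1" | "n \<le> -2" "m \<le> -2" using \<open>n < 0\<close> \<open>m < 0\<close> by linarith
  then show ?thesis
  proof cases
    case 1
    have "\<beta> - (\<beta> \<bullet> coroot \<gamma>) *\<^sub>R \<gamma> \<in> \<Phi>" using assms(1-3) unfolding root_system_def by blast
    then show ?thesis using 1 n by simp
  next
    case 2
    have "\<gamma> - (\<gamma> \<bullet> coroot \<beta>) *\<^sub>R \<beta> \<in> \<Phi>" using assms(1-3) unfolding root_system_def by blast
    then show ?thesis using 2 m by (simp add: add.commute)
  next
    case 3
    have "2 * (\<beta> \<bullet> \<gamma>) \<le> -2 * (\<gamma> \<bullet> \<gamma>)" unfolding n' using 3 pos by (intro mult_right_mono) auto
    moreover have "2 * (\<beta> \<bullet> \<gamma>) \<le> -2 * (\<beta> \<bullet> \<beta>)" unfolding m' using 3 pos by (intro mult_right_mono) auto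
    ultimately have "(\<beta> + \<gamma>) \<bullet> (\<beta> + \<gamma>) \<le> 0"
      by (simp add: inner_add_left inner_add_right inner_commute)
    then have "\<beta> + \<gamma> = 0" using inner_gt_zero_iff[of "\<beta> + \<gamma>"] by linarith
    then show ?thesis by simp
  qed
qed

section \<open>Saturated sets, bases and descent by simple roots\<close>

lemma Nats_sum: "(\<And>x. x \<in> A \<Longrightarrow> f x \<in> \<nat>) \<Longrightarrow> sum f A \<in> (\<nat> :: 'b::semiring_1 set)"
  by (induction A rule: infinite_finite_induct) auto

lemma root_uminus:
  assumes "root_system \<Phi>" "\<beta> \<in> \<Phi>"
  shows "-\<beta> \<in> \<Phi>"
proof -
  have "\<beta> \<noteq> 0" using assms unfolding root_system_def by auto
  then have "\<beta> \<bullet> coroot \<beta> = 2" unfolding coroot_def by simp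
  moreover have "\<beta> - (\<beta> \<bullet> coroot \<beta>) *\<^sub>R \<beta> \<in> \<Phi>" using assms unfolding root_system_def by blast
  ultimately show ?thesis by (simp add: scaleR_2)
qed

text \<open>Weaker than the saturated weight sets of representation theory: the string through x may
  stop as soon as the pairing is no longer positive, since a special polytope need not be
  Weyl-invariant. In a root system it also lets \<beta> be added when the pairing is
  negative.\<close>

definition root_saturated :: "'a::euclidean_space set \<Rightarrow> 'a set \<Rightarrow> bool" where
  "root_saturated \<Phi> L \<longleftrightarrow> (\<forall>x\<in>L. \<forall>\<beta>\<in>\<Phi>. x \<bullet> \<beta> > 0 \<longrightarrow> x - \<beta> \<in> L)"

text \<open>A base together with its dual basis: \<open>y \<bullet> \<omega> \<alpha>\<close> is the
  coordinate of y at the simple root \<alpha>. Order, positivity and height become statements about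
  natural numbers, and no chamber is mentioned.\<close>

locale root_base =
  fixes \<Phi> \<Delta> :: "'a::euclidean_space set" and \<omega> :: "'a \<Rightarrow> 'a"
  assumes rs: "root_system \<Phi>"
    and base_sub: "\<Delta> \<subseteq> \<Phi>"
    and dual: "\<lbrakk>\<alpha> \<in> \<Delta>; \<beta> \<in> \<Delta>\<rbrakk> \<Longrightarrow> \<alpha> \<bullet> \<omega> \<beta> = (if \<alpha> = \<beta> then 1 else 0)"
    and expand: "y = (\<Sum>\<alpha>\<in>\<Delta>. (y \<bullet> \<omega> \<alpha>) *\<^sub>R \<alpha>)"
    and root_sign: "\<beta> \<in> \<Phi> \<Longrightarrow> (\<forall>\<alpha>\<in>\<Delta>. \<beta> \<bullet> \<omega> \<alpha> \<in> \<nat>) \<or> (\<forall>\<alpha>\<in>\<Delta>. - (\<beta> \<bullet> \<omega> \<alpha>) \<in> \<nat>)"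
    and obtuse: "\<lbrakk>\<alpha> \<in> \<Delta>; \<beta> \<in> \<Delta>; \<alpha> \<noteq> \<beta>\<rbrakk> \<Longrightarrow> \<alpha> \<bullet> \<beta> \<le> 0"
begin

definition below :: "'a \<Rightarrow> 'a \<Rightarrow> bool" where
  "below x z \<longleftrightarrow> (\<forall>\<alpha>\<in>\<Delta>. (z - x) \<bullet> \<omega> \<alpha> \<in> \<nat>)"

definition dominant :: "'a \<Rightarrow> bool" where
  "dominant x \<longleftrightarrow> (\<forall>\<alpha>\<in>\<Delta>. x \<bullet> \<alpha> \<ge> 0)"

definition pos_roots :: "'a set" where
  "pos_roots = {\<beta>\<in>\<Phi>. \<forall>\<alpha>\<in>\<Delta>. \<beta> \<bullet> \<omega> \<alpha> \<in> \<nat>}"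

text \<open>Used where the coordinates are natural numbers; there the floor and \<open>nat\<close>
  change nothing.\<close>

definition height :: "'a \<Rightarrow> nat" where
  "height y = nat \<lfloor>\<Sum>\<alpha>\<in>\<Delta>. y \<bullet> \<omega> \<alpha>\<rfloor>"

lemma fin_roots: "finite \<Phi>" and zero_root: "0 \<notin> \<Phi>"
  using rs unfolding root_system_def by auto

lemma fin_base: "finite \<Delta>" using fin_roots base_sub finite_subset by blast

lemma below_refl [simp]: "below x x" unfolding below_def by simp

lemma below_trans: "below x y \<Longrightarrow> below y z \<Longrightarrow> below x z"
  unfolding below_def
proof
  fix \<alpha> assume a: "\<forall>\<alpha>\<in>\<Delta>. (y - x) \<bullet> \<omega> \<alpha> \<in> \<nat>" "\<forall>\<alpha>\<in>\<Delta>. (z - y) \<bullet> \<omega> \<alpha> \<in> \<nat>" "\<alpha> \<in> \<Delta>"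
  then have "(y - x) \<bullet> \<omega> \<alpha> + (z - y) \<bullet> \<omega> \<alpha> \<in> \<nat>" by (intro Nats_add) auto
  then show "(z - x) \<bullet> \<omega> \<alpha> \<in> \<nat>" by (simp add: inner_diff_left)
qed

lemma simple_pos_roots: "\<alpha> \<in> \<Delta> \<Longrightarrow> \<alpha> \<in> pos_roots"
  unfolding pos_roots_def using base_sub dual by auto

lemma below_add_pos: "\<beta> \<in> pos_roots \<Longrightarrow> below x (x + \<beta>)"
  unfolding pos_roots_def below_def by simp

lemma below_simple: "\<alpha> \<in> \<Delta> \<Longrightarrow> below (z - \<alpha>) z"
  using below_add_pos[OF simple_pos_roots, of \<alpha> "z - \<alpha>"] by simp

lemma below_antisym:
  assumes "below x z" "below z x" shows "x = z"
proof -
  have "(z - x) \<bullet> \<omega> \<alpha> = 0" if "\<alpha> \<in> \<Delta>" for \<alpha>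
  proof -
    have "(z - x) \<bullet> \<omega> \<alpha> \<ge> 0" "(x - z) \<bullet> \<omega> \<alpha> \<ge> 0"
      using assms that Nats_altdef2 unfolding below_def by (auto simp: Nats_def)
    then show ?thesis by (simp add: inner_diff_left)
  qed
  then show ?thesis using expand[of "z - x"] by simp
qed

lemma height_add:
  assumes "below x y" "below y z" shows "height (z - x) = height (y - x) + height (z - y)"
proof -
  have nat: "(\<Sum>\<alpha>\<in>\<Delta>. (z - x) \<bullet> \<omega> \<alpha>) \<in> \<nat>" if "below x z" for x z
    using that unfolding below_def by (intro Nats_sum) auto
  have *: "real (height (z - x)) = (\<Sum>\<alpha>\<in>\<Delta>. (z - x) \<bullet> \<omega> \<alpha>)" if "below x z" for x z
    using nat[OF that] unfolding height_def by (auto simp: Nats_def)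
  have "real (height (z - x)) = real (height (y - x) + height (z - y))"
    using *[OF assms(1)] *[OF assms(2)] *[OF below_trans[OF assms]]
    by (simp add: sum.distrib[symmetric] inner_diff_left)
  then show ?thesis by (simp only: of_nat_eq_iff)
qed

lemma height_simple: assumes "\<alpha> \<in> \<Delta>" shows "height \<alpha> = 1"
proof -
  have "(\<Sum>\<beta>\<in>\<Delta>. \<alpha> \<bullet> \<omega> \<beta>) = (\<Sum>\<beta>\<in>\<Delta>. if \<alpha> = \<beta> then 1 else 0)"
    using assms dual by (intro sum.cong) auto
  also have "\<dots> = 1" using assms fin_base by simp
  finally show ?thesis unfolding height_def by simp
qed

lemma height_zero: assumes "below x z" "height (z - x) = 0" shows "x = z"
proof -
  have n: "\<forall>\<alpha>\<in>\<Delta>. (z - x) \<bullet> \<omega> \<alpha> \<ge> 0" using assms(1) unfolding below_def by (auto simp: Nats_def)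
  have "(\<Sum>\<alpha>\<in>\<Delta>. (z - x) \<bullet> \<omega> \<alpha>) \<in> \<nat>" using assms(1) unfolding below_def by (intro Nats_sum) auto
  then have "(\<Sum>\<alpha>\<in>\<Delta>. (z - x) \<bullet> \<omega> \<alpha>) = 0" using assms(2) unfolding height_def by (auto simp: Nats_def)
  then have "\<forall>\<alpha>\<in>\<Delta>. (z - x) \<bullet> \<omega> \<alpha> = 0" using n fin_base by (simp add: sum_nonneg_eq_0_iff)
  then show ?thesis using expand[of "z - x"] by simp
qed

lemma inner_expand: "y \<bullet> x = (\<Sum>\<alpha>\<in>\<Delta>. (y \<bullet> \<omega> \<alpha>) * (x \<bullet> \<alpha>))"
proof -
  have "y \<bullet> x = (\<Sum>\<alpha>\<in>\<Delta>. (y \<bullet> \<omega> \<alpha>) *\<^sub>R \<alpha>) \<bullet> x" using expand[of y] by metis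
  also have "\<dots> = (\<Sum>\<alpha>\<in>\<Delta>. (y \<bullet> \<omega> \<alpha>) * (x \<bullet> \<alpha>))" by (simp add: inner_sum_left inner_commute[of x])
  finally show ?thesis .
qed

lemma below_minus_simple:
  assumes "below x z" "\<alpha> \<in> \<Delta>" "(z - x) \<bullet> \<omega> \<alpha> \<noteq> 0"
  shows "below x (z - \<alpha>)"
  unfolding below_def
proof
  fix \<beta> assume b: "\<beta> \<in> \<Delta>"
  obtain n where n: "(z - x) \<bullet> \<omega> \<beta> = real n" using assms(1) b unfolding below_def by (auto simp: Nats_def)
  have "(z - \<alpha> - x) \<bullet> \<omega> \<beta> = (z - x) \<bullet> \<omega> \<beta> - \<alpha> \<bullet> \<omega> \<beta>" by (simp add: inner_diff_left)
  also have "\<dots> = real n - (if \<alpha> = \<beta> then 1 else 0)" using n dual[OF assms(2) b] by simp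
  also have "\<dots> = real (if \<alpha> = \<beta> then n - 1 else n)" using assms(3) n by (auto simp: of_nat_diff)
  finally show "(z - \<alpha> - x) \<bullet> \<omega> \<beta> \<in> \<nat>" by simp
qed

text \<open>The squared norm of z - x is the sum over \<alpha> of its coordinate times its pairing
  with \<alpha>. Some summand is positive, and as coordinates are natural numbers both factors are:
  \<alpha> pairs positively with z - x and can be subtracted from z without leaving the elements
  above x.\<close>

lemma descent:
  assumes "below x z" "x \<noteq> z"
  obtains \<alpha> where "\<alpha> \<in> \<Delta>" "(z - x) \<bullet> \<alpha> > 0" "below x (z - \<alpha>)"
proof -
  have nn: "(z - x) \<bullet> \<omega> \<alpha> \<ge> 0" if "\<alpha> \<in> \<Delta>" for \<alpha>
    using assms(1) that unfolding below_def by (auto simp: Nats_def)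
  have "(z - x) \<bullet> (z - x) > 0" using assms(2) by simp
  then have "(\<Sum>\<alpha>\<in>\<Delta>. ((z - x) \<bullet> \<omega> \<alpha>) * ((z - x) \<bullet> \<alpha>)) > 0" using inner_expand by metis
  then obtain \<alpha> where a: "\<alpha> \<in> \<Delta>" "((z - x) \<bullet> \<omega> \<alpha>) * ((z - x) \<bullet> \<alpha>) > 0"
    by (metis (no_types, lifting) not_le sum_nonpos)
  then have "(z - x) \<bullet> \<omega> \<alpha> \<noteq> 0" "(z - x) \<bullet> \<alpha> > 0" using nn[OF a(1)] by (auto simp: zero_less_mult_iff)
  then show ?thesis using that a below_minus_simple assms by blast
qed

lemma height_descent:
  assumes "below x (z - \<alpha>)" "\<alpha> \<in> \<Delta>" shows "height (z - x) = Suc (height (z - \<alpha> - x))"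
  using height_add[OF assms(1) below_simple[OF assms(2)]] height_simple[OF assms(2)] by simp

lemma dominant_pos_roots: "dominant x \<Longrightarrow> \<beta> \<in> pos_roots \<Longrightarrow> x \<bullet> \<beta> \<ge> 0"
  unfolding dominant_def pos_roots_def inner_commute[of x \<beta>] inner_expand[of \<beta> x]
  by (intro sum_nonneg mult_nonneg_nonneg) (auto simp: Nats_def)

lemma pos_roots_sub: "\<beta> \<in> pos_roots \<Longrightarrow> \<beta> \<in> \<Phi>" unfolding pos_roots_def by auto

lemma root_inner_pos: "\<beta> \<in> \<Phi> \<Longrightarrow> \<beta> \<bullet> \<beta> > 0" using zero_root by auto

lemma pos_roots_height: assumes "\<beta> \<in> pos_roots" shows "height \<beta> > 0"
proof (rule ccontr)
  assume "\<not> ?thesis"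
  then have "0 = \<beta>" using height_zero[of 0 \<beta>] assms unfolding pos_roots_def below_def by simp
  then show False using assms pos_roots_sub zero_root by auto
qed

lemma pos_roots_plus_simple:
  assumes "\<beta> \<in> pos_roots" "\<alpha> \<in> \<Delta>" "\<beta> + \<alpha> \<in> insert 0 \<Phi>" shows "\<beta> + \<alpha> \<in> pos_roots"
proof -
  have "\<forall>\<gamma>\<in>\<Delta>. (\<beta> + \<alpha>) \<bullet> \<omega> \<gamma> \<in> \<nat>"
    using assms(1) simple_pos_roots[OF assms(2)] unfolding pos_roots_def by (auto simp: inner_add_left)
  moreover have "\<beta> + \<alpha> \<noteq> 0"
  proof
    assume "\<beta> + \<alpha> = 0"
    then have "\<beta> = - \<alpha>" by (simp add: eq_neg_iff_add_eq_0)
    then have "below 0 (-\<alpha>)" using assms(1) unfolding pos_roots_def below_def by auto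
    moreover have "below (-\<alpha>) 0" using below_simple[OF assms(2), of 0] by simp
    ultimately have "\<alpha> = 0" using below_antisym by fastforce
    then show False using assms(2) base_sub zero_root by auto
  qed
  ultimately show ?thesis using assms(3) unfolding pos_roots_def by auto
qed

text \<open>Apply \<open>descent\<close> from \<beta> to 0: the simple root it finds pairs
  positively with \<beta>, so the difference is a root or 0, and it is not 0 because \<beta> is not
  simple.\<close>

lemma pos_roots_minus_simple:
  assumes "\<beta> \<in> pos_roots" "\<beta> \<notin> \<Delta>"
  obtains \<alpha> where "\<alpha> \<in> \<Delta>" "\<beta> \<bullet> \<alpha> > 0" "\<beta> - \<alpha> \<in> pos_roots" "height \<beta> = Suc (height (\<beta> - \<alpha>))"
proof -
  have b0: "below 0 \<beta>" "0 \<noteq> \<beta>" using assms zero_root unfolding pos_roots_def below_def by auto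
  obtain \<alpha> where a: "\<alpha> \<in> \<Delta>" "(\<beta> - 0) \<bullet> \<alpha> > 0" "below 0 (\<beta> - \<alpha>)" using descent[OF b0] .
  have "\<beta> + (- \<alpha>) \<in> insert 0 \<Phi>"
    using obtuse_roots_sum[OF rs pos_roots_sub[OF assms(1)] root_uminus[OF rs]] a base_sub by auto
  then have "\<beta> - \<alpha> \<in> \<Phi>" using assms(2) a(1) by auto
  then have "\<beta> - \<alpha> \<in> pos_roots" using a(3) unfolding pos_roots_def below_def by simp
  then show ?thesis using that a height_descent[of 0 \<beta> \<alpha>] by simp
qed

text \<open>Since x is dominant, a simple root pairing positively with z - x also pairs positively
  with z, so the whole descent from z stays in L. The second conclusion records the last step of the
  descent, for use in \<open>raise_simple\<close>.\<close>

lemma saturated_descent: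
  assumes "root_saturated \<Phi> L" "dominant x" "below x z" "z \<in> L"
  shows "x \<in> L \<and> (x \<noteq> z \<longrightarrow> (\<exists>\<alpha>\<in>\<Delta>. x + \<alpha> \<in> L))"
  using assms(3,4)
proof (induction "height (z - x)" arbitrary: z)
  case 0 then show ?case using height_zero by metis
next
  case (Suc n)
  then have "x \<noteq> z" by (auto simp: height_def)
  then obtain \<alpha> where a: "\<alpha> \<in> \<Delta>" "(z - x) \<bullet> \<alpha> > 0" "below x (z - \<alpha>)" using descent Suc.prems by metis
  have "x \<bullet> \<alpha> \<ge> 0" using assms(2) a unfolding dominant_def by auto
  then have "z \<bullet> \<alpha> > 0" using a by (simp add: inner_diff_left)
  then have zl: "z - \<alpha> \<in> L" using assms(1) a base_sub Suc.prems unfolding root_saturated_def by blast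
  have "n = height (z - \<alpha> - x)" using height_descent[OF a(3,1)] Suc.hyps(2) by simp
  then have "x \<in> L \<and> (x \<noteq> z - \<alpha> \<longrightarrow> (\<exists>\<alpha>\<in>\<Delta>. x + \<alpha> \<in> L))" using Suc.hyps(1) a zl by blast
  then show ?case using a(1) Suc.prems(2) by (metis diff_add_cancel)
qed

end

section \<open>Connectivity of the fibres of addition on two saturated sets\<close>

locale pair_fibres = root_base +
  fixes L L' :: "'a set" and \<mu> \<nu> :: 'a
  assumes sat: "root_saturated \<Phi> L" "root_saturated \<Phi> L'"
    and top: "\<mu> \<in> L" "\<nu> \<in> L'"
    and bounded: "x \<in> L \<Longrightarrow> below x \<mu>" "y \<in> L' \<Longrightarrow> below y \<nu>"
begin

abbreviation total :: "'a \<times> 'a \<Rightarrow> 'a" where "total h \<equiv> fst h + snd h"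

definition adj :: "'a \<times> 'a \<Rightarrow> 'a \<times> 'a \<Rightarrow> bool" where
  "adj h k \<longleftrightarrow> h \<in> L \<times> L' \<and> k \<in> L \<times> L' \<and> total h = total k \<and> fst k - fst h \<in> insert 0 \<Phi>"

abbreviation linked where "linked \<equiv> adj\<^sup>*\<^sup>*"

text \<open>
  The condition on the total guarantees that \<open>\<beta>\<close> can be subtracted from one of the components.
\<close>

definition down :: "'a \<Rightarrow> 'a \<times> 'a \<Rightarrow> 'a \<times> 'a \<Rightarrow> bool" where
  "down \<beta> h k \<longleftrightarrow> h \<in> L \<times> L' \<and> k \<in> L \<times> L' \<and> total h \<bullet> \<beta> > 0 \<and>
     (k = (fst h - \<beta>, snd h) \<or> k = (fst h, snd h - \<beta>))"

definition step :: "'a \<times> 'a \<Rightarrow> 'a \<times> 'a \<Rightarrow> bool" where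
  "step h k \<longleftrightarrow> (\<exists>\<alpha>\<in>\<Delta>. down \<alpha> h k)"

abbreviation chain where "chain \<equiv> step\<^sup>*\<^sup>*"

lemma adj_sym: "adj h k \<Longrightarrow> adj k h"
  using root_uminus[OF rs] unfolding adj_def by (metis insert_iff minus_diff_eq neg_equal_0_iff_equal)

lemma linked_sym: "linked h k \<Longrightarrow> linked k h"
  by (induction rule: rtranclp_induct) (auto intro: converse_rtranclp_into_rtranclp adj_sym)

lemma linked_total: "linked h k \<Longrightarrow> h \<in> L \<times> L' \<Longrightarrow> k \<in> L \<times> L' \<and> total k = total h"
  by (induction rule: rtranclp_induct) (auto simp: adj_def)

lemma down_total: "down \<beta> h k \<Longrightarrow> total k = total h - \<beta>"
  unfolding down_def by auto

lemma saturated_plus: "root_saturated \<Phi> M \<Longrightarrow> x \<in> M \<Longrightarrow> \<beta> \<in> \<Phi> \<Longrightarrow> x \<bullet> \<beta> < 0 \<Longrightarrow> x + \<beta> \<in> M"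
  using root_uminus[OF rs] unfolding root_saturated_def
  by (metis diff_minus_eq_add inner_minus_right neg_0_less_iff_less)

lemma saturated_minus: "root_saturated \<Phi> M \<Longrightarrow> x \<in> M \<Longrightarrow> \<beta> \<in> \<Phi> \<Longrightarrow> x \<bullet> \<beta> > 0 \<Longrightarrow> x - \<beta> \<in> M"
  unfolding root_saturated_def by blast

lemma down_exists:
  assumes "h \<in> L \<times> L'" "\<beta> \<in> \<Phi>" "total h \<bullet> \<beta> > 0"
  shows "\<exists>k. down \<beta> h k"
proof -
  obtain p q where h: "h = (p, q)" "p \<in> L" "q \<in> L'" using assms(1) by auto
  have "p \<bullet> \<beta> > 0 \<or> q \<bullet> \<beta> > 0" using assms(3) h by (simp add: inner_add_left) linarith
  then show ?thesis
    using saturated_minus[OF sat(1) h(2) assms(2)] saturated_minus[OF sat(2) h(3) assms(2)] h assms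
    unfolding down_def by auto
qed

lemma adjI: "p \<in> L \<Longrightarrow> q \<in> L' \<Longrightarrow> p' \<in> L \<Longrightarrow> q' \<in> L' \<Longrightarrow> p + q = p' + q' \<Longrightarrow> p' - p \<in> insert 0 \<Phi> \<Longrightarrow>
    linked (p, q) (p', q')"
  by (intro r_into_rtranclp) (auto simp: adj_def)

text \<open>The two possible results differ by moving \<beta> from one component to the other, so
  the choice of component does not affect the connected component reached.\<close>

lemma down_unique:
  assumes "down \<beta> h k" "down \<beta> h k'" "\<beta> \<in> \<Phi>"
  shows "linked k k'"
  using assms root_uminus[OF rs assms(3)] unfolding down_def by (auto intro!: adjI)

text \<open>
  If \<open>k\<close> arises from \<open>h\<close> by moving \<open>\<gamma>\<close> and \<open>\<beta>\<close> cannot be subtracted from the same component of both,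
  then \<open>\<gamma>\<close> has the sign against \<open>\<beta>\<close> that makes \<open>\<gamma> + \<beta>\<close> (or \<open>\<gamma> - \<beta>\<close>) a root or zero.
\<close>

lemma down_adj:
  assumes "adj h k" "down \<beta> h h'" "down \<beta> k k'" "\<beta> \<in> \<Phi>"
  shows "linked h' k'"
proof -
  obtain p q \<gamma> where h: "h = (p, q)" "p \<in> L" "q \<in> L'"
    and k: "k = (p + \<gamma>, q - \<gamma>)" "p + \<gamma> \<in> L" "q - \<gamma> \<in> L'" and g: "\<gamma> \<in> insert 0 \<Phi>"
  proof -
    obtain p q p' q' where *: "h = (p, q)" "k = (p', q')" by fastforce
    show thesis
      by (rule that[of p q "p' - p"]) (use assms(1) * in \<open>auto simp: adj_def algebra_simps\<close>)
  qed
  have pos: "p \<bullet> \<beta> + q \<bullet> \<beta> > 0" using assms(2) h unfolding down_def by (simp add: inner_add_left)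
  \<comment> \<open>One linked pair of results suffices: by \<open>down_unique\<close> all other
    results are linked to these.\<close>
  have main: "\<exists>h2 k2. down \<beta> h h2 \<and> down \<beta> k k2 \<and> linked h2 k2"
  proof -
    have total: "total h \<bullet> \<beta> > 0" "total k \<bullet> \<beta> > 0" using pos h k by (auto simp: inner_add_left inner_diff_left)
    have "p - \<beta> \<in> L \<or> q - \<beta> \<in> L'" "p + \<gamma> - \<beta> \<in> L \<or> q - \<gamma> - \<beta> \<in> L'"
      using down_exists[OF _ assms(4) total(1)] down_exists[OF _ assms(4) total(2)] h k unfolding down_def by auto
    then consider (a) "p - \<beta> \<in> L" "p + \<gamma> - \<beta> \<in> L" | (b) "q - \<beta> \<in> L'" "q - \<gamma> - \<beta> \<in> L'"
      | (c) "p + \<gamma> - \<beta> \<notin> L" "q - \<beta> \<notin> L'" | (d) "p - \<beta> \<notin> L" "q - \<gamma> - \<beta> \<notin> L'" by blast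
    then show ?thesis
    proof cases
      case a
      have "linked (p - \<beta>, q) (p + \<gamma> - \<beta>, q - \<gamma>)" using a h k g by (intro adjI) auto
      then show ?thesis using a h k total unfolding down_def by force
    next
      case b
      have "linked (p, q - \<beta>) (p + \<gamma>, q - \<gamma> - \<beta>)" using b h k g by (intro adjI) auto
      then show ?thesis using b h k total unfolding down_def by force
    next
      case c
      have le: "(p + \<gamma>) \<bullet> \<beta> \<le> 0" "q \<bullet> \<beta> \<le> 0"
        using c saturated_minus[OF sat(1) k(2) assms(4)] saturated_minus[OF sat(2) h(3) assms(4)] by force+
      then have "\<gamma> \<bullet> \<beta> < 0" and p: "p \<bullet> \<beta> > 0" using pos by (auto simp: inner_add_left)
      then have g': "\<gamma> + \<beta> \<in> insert 0 \<Phi>" using obtuse_roots_sum[OF rs _ assms(4)] g by auto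
      have 1: "p - \<beta> \<in> L" using saturated_minus[OF sat(1) h(2) assms(4) p] .
      have "(q - \<gamma>) \<bullet> \<beta> > 0" using le pos by (auto simp: inner_add_left inner_diff_left)
      then have 2: "q - \<gamma> - \<beta> \<in> L'" using saturated_minus[OF sat(2) k(3) assms(4)] by blast
      have "linked (p - \<beta>, q) (p + \<gamma>, q - \<gamma> - \<beta>)" using 1 2 h k g' by (intro adjI) (auto simp: algebra_simps)
      then show ?thesis using 1 2 h k total unfolding down_def by force
    next
      case d
      have le: "p \<bullet> \<beta> \<le> 0" "(q - \<gamma>) \<bullet> \<beta> \<le> 0"
        using d saturated_minus[OF sat(1) h(2) assms(4)] saturated_minus[OF sat(2) k(3) assms(4)] by force+
      then have "\<gamma> \<bullet> (- \<beta>) < 0" and q: "q \<bullet> \<beta> > 0" using pos by (auto simp: inner_diff_left)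
      then have "\<gamma> + (- \<beta>) \<in> insert 0 \<Phi>" using obtuse_roots_sum[OF rs _ root_uminus[OF rs assms(4)]] g by auto
      then have g': "\<gamma> - \<beta> \<in> insert 0 \<Phi>" by simp
      have 1: "q - \<beta> \<in> L'" using saturated_minus[OF sat(2) h(3) assms(4) q] .
      have "(p + \<gamma>) \<bullet> \<beta> > 0" using le pos by (auto simp: inner_add_left inner_diff_left)
      then have 2: "p + \<gamma> - \<beta> \<in> L" using saturated_minus[OF sat(1) k(2) assms(4)] by blast
      have "linked (p, q - \<beta>) (p + \<gamma> - \<beta>, q - \<gamma>)" using 1 2 h k g' by (intro adjI) (auto simp: algebra_simps)
      then show ?thesis using 1 2 h k total unfolding down_def by force
    qed
  qed
  then obtain h2 k2 where "down \<beta> h h2" "down \<beta> k k2" "linked h2 k2" by blast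
  then show ?thesis using down_unique assms(2-4) by (meson rtranclp_trans)
qed

lemma down_linked:
  assumes "linked h k" "down \<beta> h h'" "down \<beta> k k'" "\<beta> \<in> \<Phi>"
  shows "linked h' k'"
  using assms(1,3)
proof (induction arbitrary: k' rule: rtranclp_induct)
  case base then show ?case using down_unique assms by blast
next
  case (step y z)
  have "total y = total z" "y \<in> L \<times> L'" using step(2) unfolding adj_def by auto
  then have "total y \<bullet> \<beta> > 0" using step(4) unfolding down_def by simp
  then obtain y' where "down \<beta> y y'" using down_exists \<open>y \<in> _\<close> assms(4) by blast
  then show ?case using step down_adj assms(4) by (meson rtranclp_trans)
qed

lemma chain_below:
  assumes "chain h g" "h \<in> L \<times> L'" shows "g \<in> L \<times> L' \<and> below (total g) (total h)"
  using assms
proof (induction rule: rtranclp_induct)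
  case (step y z)
  then obtain \<alpha> where "\<alpha> \<in> \<Delta>" "down \<alpha> y z" unfolding step_def by blast
  then have "z \<in> L \<times> L'" "total z = total y - \<alpha>" "below (total y - \<alpha>) (total y)"
    using down_total below_simple unfolding down_def by blast+
  then show ?case using step below_trans by metis
qed auto

text \<open>Because x is dominant, each simple root supplied by \<open>descent\<close> pairs
  positively with the current total, which is the condition for subtracting it.\<close>

lemma chain_exists:
  assumes "dominant x" "h \<in> L \<times> L'" "below x (total h)"
  shows "\<exists>g. chain h g \<and> g \<in> L \<times> L' \<and> total g = x"
  using assms(2,3)
proof (induction "height (total h - x)" arbitrary: h)
  case 0 then show ?case using height_zero by (metis rtranclp.rtrancl_refl)
next
  case (Suc n)
  then have "x \<noteq> total h" by (auto simp: height_def)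
  then obtain \<alpha> where a: "\<alpha> \<in> \<Delta>" "(total h - x) \<bullet> \<alpha> > 0" "below x (total h - \<alpha>)" using descent Suc.prems by metis
  have "x \<bullet> \<alpha> \<ge> 0" using assms(1) a unfolding dominant_def by auto
  then have "total h \<bullet> \<alpha> > 0" using a by (simp add: inner_diff_left)
  then obtain k where k: "down \<alpha> h k" using down_exists Suc.prems a base_sub by blast
  then have kt: "total k = total h - \<alpha>" "k \<in> L \<times> L'" using down_total unfolding down_def by auto
  have "n = height (total k - x)" using height_descent[OF a(3,1)] Suc.hyps(2) kt by simp
  then obtain g where "chain k g" "g \<in> L \<times> L'" "total g = x" using Suc.hyps(1)[of k] kt a by auto
  moreover have "step h k" using k a unfolding step_def by blast
  ultimately show ?case by (blast intro: converse_rtranclp_into_rtranclp[where r = step])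
qed

text \<open>Obtuseness: subtracting one of the two simple roots cannot lower the pairing with the
  other, neither for the total nor for a component. So both orders are possible and meet in the same
  pair e, whichever components absorb the roots.\<close>

lemma down_diamond:
  assumes "h \<in> L \<times> L'" "\<alpha> \<in> \<Delta>" "\<beta> \<in> \<Delta>" "\<alpha> \<noteq> \<beta>" "total h \<bullet> \<alpha> > 0" "total h \<bullet> \<beta> > 0"
  shows "\<exists>a b e. down \<alpha> h a \<and> down \<beta> a e \<and> down \<beta> h b \<and> down \<alpha> b e"
proof -
  obtain p q where h: "h = (p, q)" "p \<in> L" "q \<in> L'" using assms(1) by auto
  have ab: "\<alpha> \<in> \<Phi>" "\<beta> \<in> \<Phi>" using assms base_sub by auto
  have obt: "\<alpha> \<bullet> \<beta> \<le> 0" "\<beta> \<bullet> \<alpha> \<le> 0" using obtuse assms by auto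
  have t: "(p + q) \<bullet> \<alpha> > 0" "(p + q) \<bullet> \<beta> > 0" using assms h by auto
  then have t2: "(p + q - \<beta>) \<bullet> \<alpha> > 0" "(p + q - \<alpha>) \<bullet> \<beta> > 0" using obt by (auto simp: inner_diff_left)
  have both: "x - \<alpha> - \<beta> \<in> M" if "root_saturated \<Phi> M" "x \<in> M" "x \<bullet> \<alpha> > 0" "x \<bullet> \<beta> > 0" for x M
  proof -
    have "x - \<alpha> \<in> M" using saturated_minus[OF that(1,2) ab(1) that(3)] .
    moreover have "(x - \<alpha>) \<bullet> \<beta> > 0" using that obt by (simp add: inner_diff_left)
    ultimately show ?thesis using saturated_minus[OF that(1) _ ab(2)] by blast
  qed
  consider "p \<bullet> \<alpha> > 0" "p \<bullet> \<beta> > 0" | "p \<bullet> \<alpha> > 0" "q \<bullet> \<beta> > 0" | "q \<bullet> \<alpha> > 0" "p \<bullet> \<beta> > 0" | "q \<bullet> \<alpha> > 0" "q \<bullet> \<beta> > 0"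
    using t by (simp add: inner_add_left) linarith
  then show ?thesis
  proof cases
    case 1
    have "p - \<alpha> \<in> L" "p - \<beta> \<in> L" "p - \<alpha> - \<beta> \<in> L"
      using saturated_minus[OF sat(1) h(2)] ab 1 both[OF sat(1) h(2)] by auto
    then have "down \<alpha> h (p - \<alpha>, q)" "down \<beta> (p - \<alpha>, q) (p - \<alpha> - \<beta>, q)"
      "down \<beta> h (p - \<beta>, q)" "down \<alpha> (p - \<beta>, q) (p - \<alpha> - \<beta>, q)"
      using h t t2 unfolding down_def by (auto simp: algebra_simps)
    then show ?thesis by blast
  next
    case 2
    have "p - \<alpha> \<in> L" "q - \<beta> \<in> L'"
      using saturated_minus[OF sat(1) h(2)] saturated_minus[OF sat(2) h(3)] ab 2 by auto
    then have "down \<alpha> h (p - \<alpha>, q)" "down \<beta> (p - \<alpha>, q) (p - \<alpha>, q - \<beta>)"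
      "down \<beta> h (p, q - \<beta>)" "down \<alpha> (p, q - \<beta>) (p - \<alpha>, q - \<beta>)"
      using h t t2 unfolding down_def by (auto simp: algebra_simps)
    then show ?thesis by blast
  next
    case 3
    have "p - \<beta> \<in> L" "q - \<alpha> \<in> L'"
      using saturated_minus[OF sat(1) h(2)] saturated_minus[OF sat(2) h(3)] ab 3 by auto
    then have "down \<alpha> h (p, q - \<alpha>)" "down \<beta> (p, q - \<alpha>) (p - \<beta>, q - \<alpha>)"
      "down \<beta> h (p - \<beta>, q)" "down \<alpha> (p - \<beta>, q) (p - \<beta>, q - \<alpha>)"
      using h t t2 unfolding down_def by (auto simp: algebra_simps)
    then show ?thesis by blast
  next
    case 4
    have "q - \<alpha> \<in> L'" "q - \<beta> \<in> L'" "q - \<alpha> - \<beta> \<in> L'"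
      using saturated_minus[OF sat(2) h(3)] ab 4 both[OF sat(2) h(3)] by auto
    then have "down \<alpha> h (p, q - \<alpha>)" "down \<beta> (p, q - \<alpha>) (p, q - \<alpha> - \<beta>)"
      "down \<beta> h (p, q - \<beta>)" "down \<alpha> (p, q - \<beta>) (p, q - \<alpha> - \<beta>)"
      using h t t2 unfolding down_def by (auto simp: algebra_simps)
    then show ?thesis by blast
  qed
qed

text \<open>
  Newman's argument: distinct simple roots that may both be subtracted from the total may be
  subtracted in either order, and every intermediate total still descends to \<open>x\<close>.
\<close>

lemma confluence:
  assumes "dominant x" "linked h h'" "h \<in> L \<times> L'" "chain h g" "chain h' g'" "total g = x" "total g' = x"
  shows "linked g g'"
  using assms(2-7)
proof (induction "height (total h - x)" arbitrary: h h' g g' rule: less_induct)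
  case less
  have h': "h' \<in> L \<times> L'" "total h' = total h" using linked_total less.prems by auto
  have bel: "below x (total h)" using chain_below less.prems by blast
  \<comment> \<open>A further step from total x would end strictly below x, and totals never rise
    again along a chain; so a chain over x itself is trivial.\<close>
  have strict: "total h \<noteq> x" if s: "step h k" "chain k g" "total g = x" for h k g
  proof
    assume e: "total h = x"
    obtain \<alpha> where a: "\<alpha> \<in> \<Delta>" "down \<alpha> h k" using s(1) unfolding step_def by blast
    then have "total k = x - \<alpha>" "k \<in> L \<times> L'" using e down_total unfolding down_def by auto
    then have "below x (x - \<alpha>)" using chain_below s by metis
    then have "x = x - \<alpha>" using below_antisym below_simple[OF a(1)] by blast
    then show False using a base_sub zero_root by auto
  qed
  show ?case
  proof (cases "total h = x")
    case True
    then have "h = g" "h' = g'" using less.prems(3-6) strict h' by (metis converse_rtranclpE)+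
    then show ?thesis using less.prems by simp
  next
    case False
    obtain h1 where h1: "step h h1" "chain h1 g" using less.prems(3,5) False by (metis converse_rtranclpE)
    obtain h2 where h2: "step h' h2" "chain h2 g'" using less.prems(4,6) h' False by (metis converse_rtranclpE)
    obtain \<alpha> where a: "\<alpha> \<in> \<Delta>" "down \<alpha> h h1" using h1 unfolding step_def by blast
    obtain \<beta> where b: "\<beta> \<in> \<Delta>" "down \<beta> h' h2" using h2 unfolding step_def by blast
    have ab: "\<alpha> \<in> \<Phi>" "\<beta> \<in> \<Phi>" using a b base_sub by auto
    have t1: "total h1 = total h - \<alpha>" "h1 \<in> L \<times> L'" "total h \<bullet> \<alpha> > 0" using a down_total unfolding down_def by blast+
    have t2: "total h2 = total h - \<beta>" "h2 \<in> L \<times> L'" "total h \<bullet> \<beta> > 0" using b h' down_total unfolding down_def by metis+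
    have x1: "below x (total h - \<alpha>)" using chain_below[OF h1(2) t1(2)] t1 less.prems by simp
    have x2: "below x (total h - \<beta>)" using chain_below[OF h2(2) t2(2)] t2 less.prems by simp
    have l1: "height (total h - \<alpha> - x) < height (total h - x)" using height_descent[OF x1 a(1)] by simp
    have l2: "height (total h - \<beta> - x) < height (total h - x)" using height_descent[OF x2 b(1)] by simp
    show ?thesis
    proof (cases "\<alpha> = \<beta>")
      case True
      then have "linked h1 h2" using down_linked less.prems a b ab by blast
      then show ?thesis using less.hyps[of h1 h2 g g'] l1 t1 h1 h2 less.prems by simp
    next
      case False
      obtain k1 k2 e where d: "down \<alpha> h k1" "down \<beta> k1 e" "down \<beta> h k2" "down \<alpha> k2 e"
        using down_diamond[OF less.prems(2) a(1) b(1) False t1(3) t2(3)] by blast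
      have te: "total e = total h - \<alpha> - \<beta>" "e \<in> L \<times> L'" using d down_total unfolding down_def by metis+
      \<comment> \<open>As total h - \<beta> is above x, the \<beta>-coordinate of total h - x is at
        least 1, and subtracting \<alpha> does not change it.\<close>
      have "below x (total h - \<alpha> - \<beta>)"
      proof (rule below_minus_simple[OF x1 b(1)])
        have "(total h - \<beta> - x) \<bullet> \<omega> \<beta> \<ge> 0" using x2 b(1) unfolding below_def by (auto simp: Nats_def)
        then show "(total h - \<alpha> - x) \<bullet> \<omega> \<beta> \<noteq> 0" using dual[OF a(1) b(1)] dual[OF b(1) b(1)] False
          by (simp add: inner_diff_left)
      qed
      then obtain g2 where g2: "chain e g2" "total g2 = x" using chain_exists[OF assms(1) te(2)] te by auto
      \<comment> \<open>Both branches are compared with g2 through the common pair e: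
        \<open>h1\<close> with \<open>k1\<close>, and \<open>h2\<close> with \<open>k2\<close>, the
        latter link being transported from \<open>h\<close> and \<open>h'\<close> by
        \<open>down_linked\<close>.\<close>
      have "linked h1 k1" using down_unique a d ab by blast
      moreover have "chain k1 g2" using d(2) b(1) g2 by (metis step_def converse_rtranclp_into_rtranclp)
      ultimately have 1: "linked g g2" using less.hyps[of h1 k1 g g2] l1 t1 h1 g2 less.prems by simp
      have "linked h2 k2" using down_linked[OF linked_sym[OF less.prems(1)] b(2) d(3) ab(2)] .
      moreover have "chain k2 g2" using d(4) a(1) g2 by (metis step_def converse_rtranclp_into_rtranclp)
      ultimately have "linked g' g2" using less.hyps[of h2 k2 g' g2] l2 t2 h2 g2 less.prems by simp
      then show ?thesis using 1 linked_sym by (meson rtranclp_trans)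
    qed
  qed
qed


text \<open>Split off a simple root \<alpha> with \<beta> - \<alpha> a positive root and recurse.
  Dominance of x keeps the pairings of the intermediate totals with \<alpha> and then with \<beta> -
  \<alpha> positive, and the two subtractions land next to the direct subtraction of
  \<beta>.\<close>

lemma down_pos_roots_chain:
  assumes "dominant x" "\<beta> \<in> pos_roots" "total h = x + \<beta>" "down \<beta> h k"
  shows "\<exists>g. chain h g \<and> linked g k"
  using assms(2-4)
proof (induction "height \<beta>" arbitrary: \<beta> h k rule: less_induct)
  case less
  show ?case
  proof (cases "\<beta> \<in> \<Delta>")
    case True
    then have "step h k" using less.prems unfolding step_def by blast
    then show ?thesis by blast
  next
    case False
    then obtain \<alpha> where a: "\<alpha> \<in> \<Delta>" "\<beta> \<bullet> \<alpha> > 0" "\<beta> - \<alpha> \<in> pos_roots" "height \<beta> = Suc (height (\<beta> - \<alpha>))"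
      using pos_roots_minus_simple[OF less.prems(1)] by blast
    have h: "h \<in> L \<times> L'" using less.prems unfolding down_def by blast
    have "x \<bullet> \<alpha> \<ge> 0" using assms(1) a unfolding dominant_def by auto
    then have "total h \<bullet> \<alpha> > 0" using less.prems a by (simp add: inner_add_left)
    then obtain h1 where h1: "down \<alpha> h h1" using down_exists h a base_sub by blast
    then have t1: "total h1 = x + (\<beta> - \<alpha>)" "h1 \<in> L \<times> L'"
      using down_total[OF h1] less.prems(2) unfolding down_def by (simp, blast)
    have r: "\<beta> - \<alpha> \<in> \<Phi>" "\<beta> \<in> \<Phi>" "\<alpha> \<in> \<Phi>" using a less.prems pos_roots_sub base_sub by auto
    have "total h1 \<bullet> (\<beta> - \<alpha>) > 0"
      unfolding t1 inner_add_left using dominant_pos_roots[OF assms(1) a(3)] root_inner_pos[OF r(1)] by linarith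
    then obtain k1 where k1: "down (\<beta> - \<alpha>) h1 k1" using down_exists t1 r by blast
    obtain g where g: "chain h1 g" "linked g k1" using less.hyps[OF _ a(3) t1(1) k1] a by auto
    have m: "- \<beta> \<in> \<Phi>" "- (\<beta> - \<alpha>) \<in> \<Phi>" "- \<alpha> \<in> \<Phi>" using root_uminus[OF rs] r by blast+
    \<comment> \<open>Whichever components were used, the first components differ by 0 or, up to
      sign, by one of the roots \<alpha>, \<beta>, \<beta> - \<alpha>.\<close>
    have "fst k - fst k1 \<in> insert 0 \<Phi>"
    proof -
      have k1f: "fst k1 = fst h - \<alpha> \<or> fst k1 = fst h \<or> fst k1 = fst h - \<beta> \<or> fst k1 = fst h - (\<beta> - \<alpha>)"
        using h1 k1 unfolding down_def by auto
      have kf: "fst k = fst h \<or> fst k = fst h - \<beta>" using less.prems(3) unfolding down_def by auto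
      have e: "fst h - (fst h - \<alpha>) = \<alpha>" "fst h - (fst h - \<beta>) = \<beta>" "fst h - (fst h - (\<beta> - \<alpha>)) = \<beta> - \<alpha>"
        "fst h - \<beta> - (fst h - \<alpha>) = - (\<beta> - \<alpha>)" "fst h - \<beta> - fst h = - \<beta>"
        "fst h - \<beta> - (fst h - (\<beta> - \<alpha>)) = - \<alpha>" by simp_all
      show ?thesis using k1f kf by (elim disjE; simp only: e diff_self insert_iff r m; simp)
    qed
    moreover have "total k1 = x" "total k = x" using down_total[OF k1] t1 down_total[OF less.prems(3)] less.prems(2) by simp_all
    moreover have "k1 \<in> L \<times> L'" "k \<in> L \<times> L'" using k1 less.prems(3) unfolding down_def by blast+
    ultimately have "adj k1 k" unfolding adj_def by simp
    then have "linked g k" using g by simp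
    moreover have "chain h g" using h1 g a by (metis step_def converse_rtranclp_into_rtranclp)
    ultimately show ?thesis by blast
  qed
qed

text \<open>Choose \<beta> of greatest height among the positive roots whose subtraction reaches the
  component of h. If x + \<beta> were not dominant, some simple \<alpha> would pair negatively with
  it and, x being dominant, with \<beta>. Then \<beta> + \<alpha> is a positive root, saturation
  allows adding \<alpha> to a component of the upper pair, and subtracting \<beta> + \<alpha> from
  there reaches the same component.\<close>

lemma down_from_dominant:
  assumes "dominant x" "\<beta> \<in> pos_roots" "total h' = x + \<beta>" "down \<beta> h' h''" "linked h'' h"
  shows "\<exists>\<beta>\<in>pos_roots. dominant (x + \<beta>) \<and> (\<exists>h' h''. total h' = x + \<beta> \<and> down \<beta> h' h'' \<and> linked h'' h)"
proof -
  define B where "B = {\<beta>\<in>pos_roots. \<exists>h' h''. total h' = x + \<beta> \<and> down \<beta> h' h'' \<and> linked h'' h}"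
  have "\<beta> \<in> B" using assms(2-5) unfolding B_def by blast
  moreover have "finite B" using fin_roots unfolding B_def pos_roots_def by simp
  ultimately have "finite B" "B \<noteq> {}" by auto
  then obtain \<beta> where b: "\<beta> \<in> B" and max: "\<And>\<gamma>. \<gamma> \<in> B \<Longrightarrow> height \<gamma> \<le> height \<beta>"
    using arg_min_if_finite[of B "\<lambda>\<gamma>. - int (height \<gamma>)"] by (metis neg_le_iff_le neg_less_iff_less not_le of_nat_le_iff)
  obtain p q h'' where h': "p + q = x + \<beta>" "down \<beta> (p, q) h''" "linked h'' h" and bp: "\<beta> \<in> pos_roots"
    using b unfolding B_def by auto
  have pq: "p \<in> L" "q \<in> L'" using h' unfolding down_def by auto
  have "dominant (x + \<beta>)"
  proof (rule ccontr)
    assume "\<not> ?thesis"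
    then obtain \<alpha> where a: "\<alpha> \<in> \<Delta>" "(x + \<beta>) \<bullet> \<alpha> < 0" unfolding dominant_def by force
    have "x \<bullet> \<alpha> \<ge> 0" using assms(1) a unfolding dominant_def by auto
    then have "\<beta> \<bullet> \<alpha> < 0" using a by (simp add: inner_add_left)
    then have "\<beta> + \<alpha> \<in> insert 0 \<Phi>" using obtuse_roots_sum[OF rs] bp pos_roots_sub a base_sub by blast
    then have ba: "\<beta> + \<alpha> \<in> pos_roots" using pos_roots_plus_simple bp a by blast
    have r: "\<beta> + \<alpha> \<in> \<Phi>" "\<beta> \<in> \<Phi>" "\<alpha> \<in> \<Phi>" using ba bp pos_roots_sub a base_sub by auto
    have m: "- \<beta> \<in> \<Phi>" "- (\<beta> + \<alpha>) \<in> \<Phi>" "- \<alpha> \<in> \<Phi>" using root_uminus[OF rs] r by blast+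
    have "(p + q) \<bullet> \<alpha> < 0" using a h' by simp
    then consider (1) "p \<bullet> \<alpha> < 0" | (2) "q \<bullet> \<alpha> < 0" by (simp add: inner_add_left) linarith
    then obtain h2 where h2: "h2 \<in> L \<times> L'" "h2 = (p + \<alpha>, q) \<or> h2 = (p, q + \<alpha>)"
      using saturated_plus[OF sat(1) pq(1) r(3)] saturated_plus[OF sat(2) pq(2) r(3)] pq by (metis SigmaI)
    then have t2: "total h2 = x + (\<beta> + \<alpha>)" using h' by (auto simp: algebra_simps)
    have "total h2 \<bullet> (\<beta> + \<alpha>) > 0"
      unfolding t2 inner_add_left[of x] using dominant_pos_roots[OF assms(1) ba] root_inner_pos[OF r(1)] by linarith
    then obtain k where k: "down (\<beta> + \<alpha>) h2 k" using down_exists h2 r by blast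
    have kt: "total k = x" "total h'' = x" using down_total[OF k] t2 down_total[OF h'(2)] h' by auto
    have "k \<in> L \<times> L'" "h'' \<in> L \<times> L'" using k h' unfolding down_def by auto
    \<comment> \<open>Both pairs come from (p, q) by moves involving \<alpha> and \<beta>; the
      possible differences of first components are 0 and, up to sign, \<alpha>, \<beta> and \<beta>
      + \<alpha>.\<close>
    moreover have "fst h'' - fst k \<in> insert 0 \<Phi>"
    proof -
      have kf: "fst k = p - \<beta> \<or> fst k = p \<or> fst k = p + \<alpha> \<or> fst k = p - (\<beta> + \<alpha>)" 
        using k h2 unfolding down_def by auto
      have f: "fst h'' = p - \<beta> \<and> fst k \<noteq> p \<or> fst h'' = p - \<beta> \<and> fst k = p \<or> fst h'' = p \<and> fst k \<noteq> p - \<beta> \<or> fst h'' = p \<and> fst k = p - \<beta>"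
        using h'(2) unfolding down_def by auto
      have e: "p - \<beta> - (p + \<alpha>) = - (\<beta> + \<alpha>)" "p - \<beta> - (p - (\<beta> + \<alpha>)) = \<alpha>" "p - (p + \<alpha>) = - \<alpha>"
        "p - (p - (\<beta> + \<alpha>)) = \<beta> + \<alpha>" "p - \<beta> - p = - \<beta>" "p - (p - \<beta>) = \<beta>" by simp_all
      show ?thesis using kf f by (elim disjE conjE; simp only: e diff_self insert_iff r m; simp)
    qed
    ultimately have "adj k h''" using kt unfolding adj_def by auto
    then have "linked k h" using h'(3) by (simp add: converse_rtranclp_into_rtranclp)
    then have "\<beta> + \<alpha> \<in> B" using ba t2 k unfolding B_def by blast
    then have "height (\<beta> + \<alpha>) \<le> height \<beta>" using max by blast
    moreover have "height (\<beta> + \<alpha> - 0) = Suc (height (\<beta> + \<alpha> - \<alpha> - 0))"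
      using bp a by (intro height_descent) (auto simp: pos_roots_def below_def)
    ultimately show False by simp
  qed
  then show ?thesis using h' bp by (metis fst_conv snd_conv)
qed

text \<open>At a dominant x the root comes from the last step of the descent from m; otherwise a
  simple root pairing negatively with x can be added by saturation.\<close>

lemma raise_simple:
  assumes "root_saturated \<Phi> M" "x \<in> M" "m \<in> M" "below x m" "x \<noteq> m"
  shows "\<exists>\<alpha>\<in>\<Delta>. x + \<alpha> \<in> M"
proof (cases "dominant x")
  case True
  then show ?thesis using saturated_descent assms by blast
next
  case False
  then show ?thesis using saturated_plus[OF assms(1,2)] base_sub unfolding dominant_def by (metis not_le subsetD)
qed

text \<open>Induction on the distance from the top. Any other pair can be raised by a simple root in
  one component, and \<open>down_from_dominant\<close> turns this into a subtraction starting over a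
  dominant total x + \<beta> nearer to the top, where the induction hypothesis applies.\<close>

lemma chain_from_top:
  assumes "h \<in> L \<times> L'" "dominant (total h)"
  shows "\<exists>g. chain (\<mu>, \<nu>) g \<and> linked g h"
  using assms
proof (induction "height (\<mu> + \<nu> - total h)" arbitrary: h rule: less_induct)
  case less
  have tb: "below (total k) (\<mu> + \<nu>)" if "k \<in> L \<times> L'" for k
  proof -
    have b: "below (fst k) \<mu>" "below (snd k) \<nu>" using bounded that by auto
    have "(\<mu> - fst k) \<bullet> \<omega> \<alpha> + (\<nu> - snd k) \<bullet> \<omega> \<alpha> \<in> \<nat>" if "\<alpha> \<in> \<Delta>" for \<alpha>
      using b that unfolding below_def by (intro Nats_add) auto
    then show ?thesis unfolding below_def by (simp add: inner_diff_left inner_add_left algebra_simps)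
  qed
  show ?case
  proof (cases "h = (\<mu>, \<nu>)")
    case True then show ?thesis by blast
  next
    case False
    define x where "x = total h"
    obtain p q where h: "h = (p, q)" "p \<in> L" "q \<in> L'" using less.prems by auto
    have "(\<exists>\<alpha>\<in>\<Delta>. p + \<alpha> \<in> L) \<or> (\<exists>\<alpha>\<in>\<Delta>. q + \<alpha> \<in> L')"
      using raise_simple[OF sat(1) h(2) top(1)] raise_simple[OF sat(2) h(3) top(2)] bounded h False by blast
    then obtain \<alpha> h' where a: "\<alpha> \<in> \<Delta>" "h' \<in> L \<times> L'" "h' = (p + \<alpha>, q) \<or> h' = (p, q + \<alpha>)"
      using h by (metis SigmaI)
    then have t: "total h' = x + \<alpha>" using h x_def by (auto simp: algebra_simps)
    have dx: "dominant x" using less.prems x_def by simp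
    then have "total h' \<bullet> \<alpha> > 0" using a root_inner_pos[of \<alpha>] base_sub unfolding t dominant_def
      by (auto simp: inner_add_left add_nonneg_pos)
    then have "down \<alpha> h' h" using a h unfolding down_def by auto
    then obtain \<beta> k k' where b: "\<beta> \<in> pos_roots" "dominant (x + \<beta>)" "total k = x + \<beta>" "down \<beta> k k'" "linked k' h"
      using down_from_dominant[OF dx simple_pos_roots[OF a(1)] t] by blast
    have k: "k \<in> L \<times> L'" "k' \<in> L \<times> L'" using b unfolding down_def by auto
    have "height (\<mu> + \<nu> - x) = height (x + \<beta> - x) + height (\<mu> + \<nu> - (x + \<beta>))"
      using height_add[OF below_add_pos[OF b(1)]] tb[OF k(1)] b(3) by metis
    then have "height (\<mu> + \<nu> - total k) < height (\<mu> + \<nu> - total h)" using pos_roots_height[OF b(1)] b(3) x_def by simp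
    then obtain g where g: "chain (\<mu>, \<nu>) g" "linked g k" using less.hyps[of k] k b by auto
    \<comment> \<open>The subtraction of \<beta> from k becomes a chain ending at g1, while g,
      linked to k, has its own chain to some g2 over x; \<open>confluence\<close> identifies their
      components.\<close>
    obtain g1 where g1: "chain k g1" "linked g1 k'" using down_pos_roots_chain[OF dx b(1,3,4)] by blast
    have gt: "g \<in> L \<times> L'" "total g = x + \<beta>" using linked_total[OF linked_sym[OF g(2)] k(1)] b by auto
    then have "below x (total g)" using below_add_pos b by simp
    then obtain g2 where g2: "chain g g2" "g2 \<in> L \<times> L'" "total g2 = x" using chain_exists[OF dx gt(1)] by blast
    have "total g1 = x" using linked_total[OF linked_sym[OF g1(2)] k(2)] down_total[OF b(4)] b(3) by simp
    then have "linked g2 g1" using confluence[OF dx g(2) gt(1) g2(1) g1(1) g2(3)] by blast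
    then have "linked g2 h" using g1 b(5) by (meson rtranclp_trans)
    moreover have "chain (\<mu>, \<nu>) g2" using g(1) g2(1) by (meson rtranclp_trans)
    ultimately show ?thesis by blast
  qed
qed

theorem fibre_connected:
  assumes "h \<in> L \<times> L'" "k \<in> L \<times> L'" "total h = total k" "dominant (total h)"
  shows "linked h k"
proof -
  obtain g where g: "chain (\<mu>, \<nu>) g" "linked g h" using chain_from_top assms by blast
  obtain g' where g': "chain (\<mu>, \<nu>) g'" "linked g' k" using chain_from_top assms by metis
  have "total g = total h" "total g' = total h" using linked_total linked_sym g g' assms by metis+
  then have "linked g g'" using confluence[OF assms(4) rtranclp.rtrancl_refl _ g(1) g'(1)] top by auto
  then show ?thesis using g g' linked_sym by (meson rtranclp_trans)
qed

end

section \<open>Multisets of weights and exchanges between two summands\<close>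

definition fold_sums :: "'a::comm_monoid_add set \<Rightarrow> nat \<Rightarrow> 'a set" where
  "fold_sums L m = {sum_mset X | X. size X = m \<and> set_mset X \<subseteq> L}"

text \<open>The combinatorial form of a quadratic binomial relation ab = cd multiplied by the
  monomial Z.\<close>

definition pair_swap :: "'a::comm_monoid_add set \<Rightarrow> 'a multiset \<Rightarrow> 'a multiset \<Rightarrow> bool" where
  "pair_swap L X Y \<longleftrightarrow> (\<exists>Z a b c d. X = Z + {#a, b#} \<and> Y = Z + {#c, d#} \<and> a + b = c + d \<and>
     set_mset X \<subseteq> L \<and> set_mset Y \<subseteq> L)"

lemma pair_swap_add: "pair_swap L X Y \<Longrightarrow> a \<in> L \<Longrightarrow> pair_swap L (add_mset a X) (add_mset a Y)"
proof -
  assume "pair_swap L X Y" "a \<in> L"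
  then obtain Z b c d e where "X = Z + {#b, c#}" "Y = Z + {#d, e#}" "b + c = d + e"
    "set_mset X \<subseteq> L" "set_mset Y \<subseteq> L" unfolding pair_swap_def by blast
  then show ?thesis using \<open>a \<in> L\<close> unfolding pair_swap_def
    by (intro exI[of _ "add_mset a Z"] exI[of _ b] exI[of _ c] exI[of _ d] exI[of _ e]) auto
qed

lemma pair_swaps_add: "(pair_swap L)\<^sup>*\<^sup>* X Y \<Longrightarrow> a \<in> L \<Longrightarrow> (pair_swap L)\<^sup>*\<^sup>* (add_mset a X) (add_mset a Y)"
  by (induction rule: rtranclp_induct) (auto intro: rtranclp.rtrancl_into_rtrancl pair_swap_add)

lemma sum_mset_inner_pos:
  fixes \<beta> :: "'a::real_inner"
  assumes "sum_mset X \<bullet> \<beta> > 0" obtains w where "w \<in># X" "w \<bullet> \<beta> > 0"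
proof -
  have "(\<forall>w\<in>#X. w \<bullet> \<beta> \<le> 0) \<longrightarrow> sum_mset X \<bullet> \<beta> \<le> 0"
    by (induction X) (auto simp: inner_add_left intro: add_nonpos_nonpos)
  then show thesis using assms that by (meson not_le)
qed

lemma fold_sums_saturated:
  assumes "root_saturated \<Phi> L" shows "root_saturated \<Phi> (fold_sums L m)"
  unfolding root_saturated_def
proof (intro ballI impI)
  fix x \<beta> assume x: "x \<in> fold_sums L m" and b: "\<beta> \<in> \<Phi>" "x \<bullet> \<beta> > 0"
  then obtain X where X: "x = sum_mset X" "size X = m" "set_mset X \<subseteq> L" unfolding fold_sums_def by blast
  obtain w where w: "w \<in># X" "w \<bullet> \<beta> > 0" using sum_mset_inner_pos b X by blast
  then have "w - \<beta> \<in> L" using assms b X unfolding root_saturated_def by auto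
  moreover obtain Y where Y: "X = add_mset w Y" using w(1) by (metis multi_member_split)
  moreover have "x - \<beta> = sum_mset (add_mset (w - \<beta>) Y)" unfolding X Y by simp
  ultimately show "x - \<beta> \<in> fold_sums L m" using X unfolding fold_sums_def
    by (intro CollectI exI[of _ "add_mset (w - \<beta>) Y"]) auto
qed

context root_base begin

lemma below_sum_mset:
  "(\<And>x. x \<in># X \<Longrightarrow> below x \<mu>) \<Longrightarrow> below (sum_mset X) (sum_mset (replicate_mset (size X) \<mu>))"
proof (induction X)
  case (add x X)
  have "(sum_mset (replicate_mset (size X) \<mu>) - sum_mset X) \<bullet> \<omega> \<alpha> + (\<mu> - x) \<bullet> \<omega> \<alpha> \<in> \<nat>" if "\<alpha> \<in> \<Delta>" for \<alpha>
    using add that unfolding below_def by (intro Nats_add) auto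
  then show ?case unfolding below_def by (simp add: inner_diff_left inner_add_left algebra_simps)
qed simp

lemma pair_fibres_fold_sums:
  assumes "root_saturated \<Phi> L" "\<mu> \<in> L" "\<And>x. x \<in> L \<Longrightarrow> below x \<mu>"
  shows "pair_fibres \<Phi> \<Delta> \<omega> L (fold_sums L m) \<mu> (sum_mset (replicate_mset m \<mu>))"
proof (unfold_locales)
  show "sum_mset (replicate_mset m \<mu>) \<in> fold_sums L m" using assms(2) unfolding fold_sums_def
    by (intro CollectI exI[of _ "replicate_mset m \<mu>"]) auto
  show "below y (sum_mset (replicate_mset m \<mu>))" if "y \<in> fold_sums L m" for y
    using that assms(3) below_sum_mset unfolding fold_sums_def by blast
qed (use assms fold_sums_saturated in auto)

end

text \<open>The base may depend on x: it is used for x the sum of X, which has to be dominant for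
  \<open>fibre_connected\<close>. Rests with the same sum are joined by the induction hypothesis, so
  only the moves of a root between the first summand and the rest have to be lifted.\<close>

theorem pair_swap_connected:
  assumes rs: "root_system \<Phi>" and satL: "root_saturated \<Phi> L"
    and base: "\<And>x. \<exists>\<Delta> \<omega> \<mu>. root_base \<Phi> \<Delta> \<omega> \<and> root_base.dominant \<Delta> x \<and> \<mu> \<in> L \<and> (\<forall>p\<in>L. root_base.below \<Delta> \<omega> p \<mu>)"
    and "size X = size Y" "sum_mset X = sum_mset Y" "set_mset X \<subseteq> L" "set_mset Y \<subseteq> L"
  shows "(pair_swap L)\<^sup>*\<^sup>* X Y"
  using assms(4-7)
proof (induction "size X" arbitrary: X Y)
  case 0 then show ?case by simp
next
  case (Suc m)
  obtain p X' where X: "X = add_mset p X'" using Suc.hyps(2) by (metis size_eq_Suc_imp_eq_union)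
  obtain p' Y' where Y: "Y = add_mset p' Y'" using Suc.hyps(2) Suc.prems(1) by (metis size_eq_Suc_imp_eq_union)
  obtain \<Delta> \<omega> \<mu> where base': "root_base \<Phi> \<Delta> \<omega>" "root_base.dominant \<Delta> (sum_mset X)" "\<mu> \<in> L"
    "\<forall>p\<in>L. root_base.below \<Delta> \<omega> p \<mu>" using base by blast
  interpret root_base \<Phi> \<Delta> \<omega> by fact
  interpret pair_fibres \<Phi> \<Delta> \<omega> L "fold_sums L m" \<mu> "sum_mset (replicate_mset m \<mu>)"
    using pair_fibres_fold_sums satL base' by blast
  \<comment> \<open>V and W are arbitrary representatives of the second components, so the induction
    hypothesis may replace a rest by one containing a suitable summand.\<close>
  have lift: "(pair_swap L)\<^sup>*\<^sup>* (add_mset (fst h) V) (add_mset (fst k) W)"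
    if "linked h k" "h \<in> L \<times> fold_sums L m" "sum_mset V = snd h" "sum_mset W = snd k" "size V = m" "size W = m"
      "set_mset V \<subseteq> L" "set_mset W \<subseteq> L" for h k V W
    using that(1,4,6,8)
  proof (induction arbitrary: W rule: rtranclp_induct)
    case base
    then have "(pair_swap L)\<^sup>*\<^sup>* V W" using Suc.hyps(1) that by auto
    then show ?case using pair_swaps_add that(2) by auto
  next
    case (step y z)
    obtain q r \<gamma> where y: "y = (q, r)" and z: "z = (q + \<gamma>, r - \<gamma>)"
    proof
      show "y = (fst y, snd y)" by simp
      show "z = (fst y + (fst z - fst y), snd y - (fst z - fst y))"
        using step(2) unfolding adj_def by (auto simp: prod_eq_iff algebra_simps)
    qed
    have mem: "q \<in> L" "q + \<gamma> \<in> L" and g: "\<gamma> \<in> insert 0 \<Phi>" using step(2) y z unfolding adj_def by auto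
    have sumW: "sum_mset W = r - \<gamma>" using step z by simp
    have swap: "pair_swap L (add_mset q (add_mset (w + \<gamma>) U)) (add_mset (q + \<gamma>) (add_mset w U))"
      if "w \<in> L" "w + \<gamma> \<in> L" "set_mset U \<subseteq> L" for w U
      unfolding pair_swap_def using that mem
      by (intro exI[of _ U] exI[of _ q] exI[of _ "w + \<gamma>"] exI[of _ "q + \<gamma>"] exI[of _ w]) auto
    have IH: "(pair_swap L)\<^sup>*\<^sup>* (add_mset (fst h) V) (add_mset q U)"
      if "sum_mset U = r" "size U = m" "set_mset U \<subseteq> L" for U using step.IH that y by simp
    show ?case
    proof (cases "\<gamma> = 0")
      case True then show ?thesis using IH[of W] step z sumW by simp
    next
      case False
      then have gr: "\<gamma> \<in> \<Phi>" "\<gamma> \<bullet> \<gamma> > 0" using g by auto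
      show ?thesis
      \<comment> \<open>If r pairs positively with \<gamma>, some summand of r can give up \<gamma>.
        Otherwise r - \<gamma> pairs negatively with \<gamma>, so some summand of W can take
        \<gamma>, and the exchange is read backwards from W.\<close>
      proof (cases "r \<bullet> \<gamma> > 0")
        case True
        have "r \<in> fold_sums L m" using step(2) y unfolding adj_def by auto
        then obtain U where U: "sum_mset U = r" "size U = m" "set_mset U \<subseteq> L" unfolding fold_sums_def by blast
        obtain w where w: "w \<in># U" "w \<bullet> \<gamma> > 0" using sum_mset_inner_pos True U by blast
        obtain U' where U': "U = add_mset w U'" using w by (metis multi_member_split)
        have wl: "w - \<gamma> \<in> L" using saturated_minus[OF satL _ gr(1) w(2)] w U by blast
        have 1: "pair_swap L (add_mset q U) (add_mset (q + \<gamma>) (add_mset (w - \<gamma>) U'))"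
          using swap[of "w - \<gamma>" U'] wl U U' by auto
        have "sum_mset (add_mset (w - \<gamma>) U') = sum_mset W" using U(1) U' sumW by (simp add: algebra_simps)
        then have "(pair_swap L)\<^sup>*\<^sup>* (add_mset (w - \<gamma>) U') W"
          using Suc.hyps(1)[of "add_mset (w - \<gamma>) U'" W] step U U' wl by auto
        then have "(pair_swap L)\<^sup>*\<^sup>* (add_mset (q + \<gamma>) (add_mset (w - \<gamma>) U')) (add_mset (q + \<gamma>) W)"
          using pair_swaps_add mem by blast
        then show ?thesis using 1 IH[OF U] z by (metis (no_types, lifting) converse_rtranclp_into_rtranclp fst_conv rtranclp_trans)
      next
        case False
        then have "sum_mset W \<bullet> (- \<gamma>) > 0" using gr(2) unfolding sumW inner_minus_right inner_diff_left by linarith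
        then obtain w where w: "w \<in># W" "w \<bullet> (- \<gamma>) > 0" using sum_mset_inner_pos by blast
        obtain U where U: "W = add_mset w U" using w by (metis multi_member_split)
        have wl: "w + \<gamma> \<in> L" using saturated_plus[OF satL _ gr(1)] w step by auto
        have 1: "(pair_swap L)\<^sup>*\<^sup>* (add_mset (fst h) V) (add_mset q (add_mset (w + \<gamma>) U))"
          using IH[of "add_mset (w + \<gamma>) U"] wl U sumW step by (auto simp: algebra_simps)
        have "pair_swap L (add_mset q (add_mset (w + \<gamma>) U)) (add_mset (q + \<gamma>) W)"
          unfolding U using swap[of w U] wl U step by auto
        then show ?thesis using 1 z by (simp add: rtranclp.rtrancl_into_rtrancl)
      qed
    qed
  qed
  have XY: "(p, sum_mset X') \<in> L \<times> fold_sums L m" "(p', sum_mset Y') \<in> L \<times> fold_sums L m"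
    using Suc X Y unfolding fold_sums_def by auto
  have "linked (p, sum_mset X') (p', sum_mset Y')"
    using fibre_connected[OF XY] Suc.prems X Y base' by auto
  moreover have "size X' = m" "size Y' = m" "set_mset X' \<subseteq> L" "set_mset Y' \<subseteq> L"
    using Suc.hyps(2) Suc.prems X Y by simp_all
  ultimately show ?case using lift[OF _ XY(1), of "(p', sum_mset Y')" X' Y'] unfolding X Y by simp
qed

section \<open>Weyl chambers\<close>

definition regular :: "'a::euclidean_space set \<Rightarrow> 'a \<Rightarrow> bool" where
  "regular \<Phi> v \<longleftrightarrow> (\<forall>\<alpha>\<in>\<Phi>. \<alpha> \<bullet> v \<noteq> 0)"

definition open_chamber :: "'a::euclidean_space set \<Rightarrow> 'a \<Rightarrow> 'a set" where
  "open_chamber \<Phi> v = {w. \<forall>\<alpha>\<in>\<Phi>. \<alpha> \<bullet> v > 0 \<longrightarrow> \<alpha> \<bullet> w > 0}"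

text \<open>Chambers are handled through regular representatives: signs of roots are read at v
  instead of on the interior of a set.\<close>

definition chamber :: "'a::euclidean_space set \<Rightarrow> 'a \<Rightarrow> 'a set" where
  "chamber \<Phi> v = {w. \<forall>\<alpha>\<in>\<Phi>. \<alpha> \<bullet> v > 0 \<longrightarrow> \<alpha> \<bullet> w \<ge> 0}"

definition reflection :: "'a::euclidean_space \<Rightarrow> 'a \<Rightarrow> 'a" where
  "reflection \<alpha> x = x - (x \<bullet> coroot \<alpha>) *\<^sub>R \<alpha>"

lemma regular_neg:
  assumes "root_system \<Phi>" "regular \<Phi> v" "\<alpha> \<in> \<Phi>" "\<not> \<alpha> \<bullet> v > 0"
  shows "-\<alpha> \<in> \<Phi> \<and> (-\<alpha>) \<bullet> v > 0"
  using assms root_uminus[OF assms(1,3)] unfolding regular_def by (auto simp: neq_iff)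

lemma convex_open_chamber: "convex (open_chamber \<Phi> v)"
proof -
  have "open_chamber \<Phi> v = (\<Inter>\<alpha>\<in>{\<alpha>\<in>\<Phi>. \<alpha> \<bullet> v > 0}. {w. \<alpha> \<bullet> w > 0})"
    unfolding open_chamber_def by auto
  then show ?thesis by (auto intro!: convex_INT convex_halfspace_gt)
qed

lemma open_open_chamber: "finite \<Phi> \<Longrightarrow> open (open_chamber \<Phi> v)"
proof -
  assume "finite \<Phi>"
  have "open_chamber \<Phi> v = (\<Inter>\<alpha>\<in>{\<alpha>\<in>\<Phi>. \<alpha> \<bullet> v > 0}. {w. \<alpha> \<bullet> w > 0})"
    unfolding open_chamber_def by auto
  then show ?thesis using \<open>finite \<Phi>\<close> by (auto intro!: open_INT open_halfspace_gt)
qed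

text \<open>An open chamber is convex, hence connected; conversely, by the intermediate value
  theorem a root cannot change sign on a connected set that avoids its hyperplane.\<close>

lemma connected_component_regular:
  assumes "root_system \<Phi>" "regular \<Phi> v"
  shows "connected_component_set {v. \<forall>\<alpha>\<in>\<Phi>. \<alpha> \<bullet> v \<noteq> 0} v = open_chamber \<Phi> v"
proof
  show "open_chamber \<Phi> v \<subseteq> connected_component_set {v. \<forall>\<alpha>\<in>\<Phi>. \<alpha> \<bullet> v \<noteq> 0} v"
  proof (rule connected_component_maximal)
    show "open_chamber \<Phi> v \<subseteq> {v. \<forall>\<alpha>\<in>\<Phi>. \<alpha> \<bullet> v \<noteq> 0}"
      using regular_neg[OF assms] unfolding open_chamber_def by fastforce
  qed (auto simp: open_chamber_def intro: convex_connected[OF convex_open_chamber, unfolded open_chamber_def])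
  show "connected_component_set {v. \<forall>\<alpha>\<in>\<Phi>. \<alpha> \<bullet> v \<noteq> 0} v \<subseteq> open_chamber \<Phi> v"
  proof
    fix w assume "w \<in> connected_component_set {v. \<forall>\<alpha>\<in>\<Phi>. \<alpha> \<bullet> v \<noteq> 0} v"
    then obtain T where T: "connected T" "T \<subseteq> {v. \<forall>\<alpha>\<in>\<Phi>. \<alpha> \<bullet> v \<noteq> 0}" "v \<in> T" "w \<in> T"
      unfolding connected_component_def by blast
    show "w \<in> open_chamber \<Phi> v"
      unfolding open_chamber_def
    proof (intro CollectI ballI impI, rule ccontr)
      fix \<alpha> assume a: "\<alpha> \<in> \<Phi>" "\<alpha> \<bullet> v > 0" "\<not> \<alpha> \<bullet> w > 0"
      then obtain z where "z \<in> T" "\<alpha> \<bullet> z = 0"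
        using connected_ivt_hyperplane[OF T(1) T(4) T(3), of \<alpha> 0] by auto
      then show False using T a by auto
    qed
  qed
qed

lemma closure_open_chamber: "closure (open_chamber \<Phi> v) = chamber \<Phi> v"
proof
  have "chamber \<Phi> v = (\<Inter>\<alpha>\<in>{\<alpha>\<in>\<Phi>. \<alpha> \<bullet> v > 0}. {w. \<alpha> \<bullet> w \<ge> 0})" unfolding chamber_def by auto
  then have "closed (chamber \<Phi> v)" by (auto intro!: closed_INT closed_halfspace_ge)
  moreover have "open_chamber \<Phi> v \<subseteq> chamber \<Phi> v"
    unfolding open_chamber_def chamber_def by (auto intro: less_imp_le)
  ultimately show "closure (open_chamber \<Phi> v) \<subseteq> chamber \<Phi> v" by (rule closure_minimal[rotated])
  show "chamber \<Phi> v \<subseteq> closure (open_chamber \<Phi> v)"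
  proof
    fix w assume w: "w \<in> chamber \<Phi> v"
    \<comment> \<open>Pushing w slightly in the direction of v makes the inequalities
      strict.\<close>
    have "(\<lambda>n. w + inverse (real (Suc n)) *\<^sub>R v) \<longlonglongrightarrow> w + 0 *\<^sub>R v"
      by (intro tendsto_intros LIMSEQ_inverse_real_of_nat)
    moreover have "w + inverse (real (Suc n)) *\<^sub>R v \<in> open_chamber \<Phi> v" for n
      using w unfolding chamber_def open_chamber_def by (auto simp: inner_add_right intro!: add_nonneg_pos)
    ultimately show "w \<in> closure (open_chamber \<Phi> v)" unfolding closure_sequential
      by (intro exI[of _ "\<lambda>n. w + inverse (real (Suc n)) *\<^sub>R v"]) auto
  qed
qed

lemma interior_chamber: "finite \<Phi> \<Longrightarrow> interior (chamber \<Phi> v) = open_chamber \<Phi> v"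
  unfolding closure_open_chamber[symmetric]
  by (simp add: convex_interior_closure convex_open_chamber interior_open open_open_chamber)

lemma weyl_chambers_eq:
  assumes "root_system \<Phi>" shows "weyl_chambers \<Phi> = chamber \<Phi> ` {v. regular \<Phi> v}"
proof -
  have "weyl_chambers \<Phi> = (\<lambda>v. closure (connected_component_set {v. \<forall>\<alpha>\<in>\<Phi>. \<alpha> \<bullet> v \<noteq> 0} v)) ` {v. regular \<Phi> v}"
    unfolding weyl_chambers_def components_def regular_def by auto
  also have "\<dots> = chamber \<Phi> ` {v. regular \<Phi> v}"
    by (rule image_cong[OF refl]) (simp only: mem_Collect_eq connected_component_regular[OF assms] closure_open_chamber)
  finally show ?thesis .
qed

lemma positive_roots_chamber:
  assumes "finite \<Phi>" shows "positive_roots \<Phi> (chamber \<Phi> v) = {\<alpha>\<in>\<Phi>. \<alpha> \<bullet> v > 0}"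
  unfolding positive_roots_def interior_chamber[OF assms] by (auto simp: open_chamber_def)

text \<open>Perturb x by a small positive multiple of a regular vector u: roots not orthogonal to x
  keep their sign, and the others take the sign they have at u.\<close>

lemma dominant_chamber_exists:
  fixes x :: "'a::euclidean_space"
  assumes "finite \<Phi>" "0 \<notin> \<Phi>"
  shows "\<exists>v. regular \<Phi> v \<and> (\<forall>\<alpha>\<in>\<Phi>. \<alpha> \<bullet> v > 0 \<longrightarrow> x \<bullet> \<alpha> \<ge> 0)"
proof -
  have ev: "\<forall>\<^sub>F t in at_right 0. (\<alpha> \<bullet> (a + t *\<^sub>R b) \<noteq> 0) \<and> (\<alpha> \<bullet> a \<noteq> 0 \<longrightarrow> sgn (\<alpha> \<bullet> (a + t *\<^sub>R b)) = sgn (\<alpha> \<bullet> a))"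
    if "\<alpha> \<bullet> a \<noteq> 0 \<or> \<alpha> \<bullet> b \<noteq> 0" for a b \<alpha> :: 'a
  proof (cases "\<alpha> \<bullet> a = 0")
    case True
    have "\<forall>\<^sub>F t in at_right (0::real). t > 0" by (simp add: eventually_at_right_less)
    then show ?thesis by eventually_elim (use True that in \<open>auto simp: inner_add_right\<close>)
  next
    case False
    have lim: "((\<lambda>t. \<alpha> \<bullet> (a + t *\<^sub>R b)) \<longlongrightarrow> \<alpha> \<bullet> (a + 0 *\<^sub>R b)) (at_right 0)"
      by (intro tendsto_intros)
    show ?thesis
    proof (cases "\<alpha> \<bullet> a > 0")
      case True
      have "\<forall>\<^sub>F t in at_right 0. \<alpha> \<bullet> (a + t *\<^sub>R b) > 0"
        using order_tendstoD(1)[OF lim, of 0] True by simp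
      then show ?thesis by eventually_elim (use True in auto)
    next
      case F: False
      have "\<forall>\<^sub>F t in at_right 0. \<alpha> \<bullet> (a + t *\<^sub>R b) < 0"
        using order_tendstoD(2)[OF lim, of 0] False F by simp
      then show ?thesis by eventually_elim (use False F in auto)
    qed
  qed
  have nb: "at_right (0::real) \<noteq> bot" by simp
  \<comment> \<open>Roots are added one at a time; a vector regular for the earlier ones is
    perturbed in the direction of the new root, which does not vanish on itself.\<close>
  have "\<exists>u::'a. regular \<Phi> u" using assms
  proof (induction \<Phi> rule: finite_induct)
    case empty then show ?case by (simp add: regular_def)
  next
    case (insert \<beta> F)
    then obtain u where u: "regular F u" by auto
    have "\<forall>\<^sub>F t in at_right 0. \<forall>\<alpha>\<in>insert \<beta> F. \<alpha> \<bullet> (u + t *\<^sub>R \<beta>) \<noteq> 0"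
    proof (subst eventually_ball_finite_distrib)
      show "\<forall>\<alpha>\<in>insert \<beta> F. \<forall>\<^sub>F t in at_right 0. \<alpha> \<bullet> (u + t *\<^sub>R \<beta>) \<noteq> 0"
      proof
        fix \<alpha> assume "\<alpha> \<in> insert \<beta> F"
        then have "\<alpha> \<bullet> u \<noteq> 0 \<or> \<alpha> \<bullet> \<beta> \<noteq> 0" using u insert.prems unfolding regular_def by auto
        from ev[OF this] show "\<forall>\<^sub>F t in at_right 0. \<alpha> \<bullet> (u + t *\<^sub>R \<beta>) \<noteq> 0" by eventually_elim simp
      qed
    qed (use insert in simp)
    from eventually_happens'[OF nb this] show ?case unfolding regular_def by blast
  qed
  then obtain u where u: "regular \<Phi> u" by blast
  have "\<forall>\<^sub>F t in at_right 0. \<forall>\<alpha>\<in>\<Phi>. \<alpha> \<bullet> (x + t *\<^sub>R u) \<noteq> 0 \<and> (\<alpha> \<bullet> x \<noteq> 0 \<longrightarrow> sgn (\<alpha> \<bullet> (x + t *\<^sub>R u)) = sgn (\<alpha> \<bullet> x))"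
    by (subst eventually_ball_finite_distrib) (use assms ev u in \<open>auto simp: regular_def\<close>)
  from eventually_happens'[OF nb this]
  obtain t where t: "\<forall>\<alpha>\<in>\<Phi>. \<alpha> \<bullet> (x + t *\<^sub>R u) \<noteq> 0 \<and> (\<alpha> \<bullet> x \<noteq> 0 \<longrightarrow> sgn (\<alpha> \<bullet> (x + t *\<^sub>R u)) = sgn (\<alpha> \<bullet> x))"
    by blast
  have "x \<bullet> \<alpha> \<ge> 0" if a: "\<alpha> \<in> \<Phi>" "\<alpha> \<bullet> (x + t *\<^sub>R u) > 0" for \<alpha>
  proof (cases "\<alpha> \<bullet> x = 0")
    case False
    then have "sgn (\<alpha> \<bullet> x) = 1" using t a by (metis sgn_pos)
    then show ?thesis by (metis inner_commute less_imp_le sgn_1_pos)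
  qed (simp add: inner_commute)
  then show ?thesis using t unfolding regular_def by blast
qed

lemma dual_basis_exists:
  fixes S :: "'a::euclidean_space set"
  assumes "independent S"
  shows "\<exists>\<omega>. \<forall>\<alpha>\<in>S. \<forall>\<beta>\<in>S. \<alpha> \<bullet> \<omega> \<beta> = (if \<alpha> = \<beta> then 1 else 0)"
proof -
  have "\<exists>w. \<forall>\<alpha>\<in>S. \<alpha> \<bullet> w = (if \<alpha> = \<beta> then 1 else 0)" for \<beta>
  proof -
    obtain f :: "'a \<Rightarrow> real" where f: "linear f" "\<forall>x\<in>S. f x = (if x = \<beta> then 1 else 0)"
      using linear_independent_extend[OF assms, of "\<lambda>x. if x = \<beta> then 1 else 0"] by blast
    have "f x = x \<bullet> (\<Sum>b\<in>Basis. f b *\<^sub>R b)" for x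
    proof -
      have "f x = f (\<Sum>b\<in>Basis. (x \<bullet> b) *\<^sub>R b)" by (simp add: euclidean_representation)
      also have "\<dots> = (\<Sum>b\<in>Basis. (x \<bullet> b) * f b)" using f(1) by (simp add: linear_sum linear_scale)
      finally show ?thesis by (simp add: inner_sum_right mult.commute)
    qed
    then show ?thesis using f(2) by metis
  qed
  then obtain \<omega> where "\<And>\<beta>. \<forall>\<alpha>\<in>S. \<alpha> \<bullet> \<omega> \<beta> = (if \<alpha> = \<beta> then 1 else 0)" by metis
  then show ?thesis by blast
qed

text \<open>The indecomposable positive roots form a base. They are obtuse because a root \<alpha> -
  \<beta>, or its negative, would decompose one of the two. Obtuseness together with positivity at v
  gives independence, and repeated decomposition gives natural coordinates.\<close>

lemma chamber_root_base:
  fixes \<Phi> :: "'a::euclidean_space set"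
  assumes rs: "root_system \<Phi>" and reg: "regular \<Phi> v"
  shows "\<exists>\<omega>. root_base \<Phi> (simple_roots \<Phi> (chamber \<Phi> v)) \<omega> \<and>
    root_base.pos_roots \<Phi> (simple_roots \<Phi> (chamber \<Phi> v)) \<omega> = {\<beta>\<in>\<Phi>. \<beta> \<bullet> v > 0}"
proof -
  define S where "S = simple_roots \<Phi> (chamber \<Phi> v)"
  define Q where "Q = {\<beta>\<in>\<Phi>. \<beta> \<bullet> v > 0}"
  have fin: "finite \<Phi>" "finite Q" using rs unfolding root_system_def Q_def by auto
  have S: "S = {\<alpha>\<in>Q. \<not> (\<exists>\<beta>\<in>Q. \<exists>\<gamma>\<in>Q. \<alpha> = \<beta> + \<gamma>)}"
    unfolding S_def simple_roots_def positive_roots_chamber[OF fin(1)] Q_def by simp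
  then have SQ: "S \<subseteq> Q" and finS: "finite S" using fin finite_subset by auto
  have decomp: "\<exists>k::'a \<Rightarrow> nat. \<beta> = (\<Sum>\<alpha>\<in>S. real (k \<alpha>) *\<^sub>R \<alpha>)" if "\<beta> \<in> Q" for \<beta>
    using that
  \<comment> \<open>The values at v are real numbers, so the induction counts the positive roots
    with smaller value.\<close>
  proof (induction "card {\<gamma>\<in>Q. \<gamma> \<bullet> v < \<beta> \<bullet> v}" arbitrary: \<beta> rule: less_induct)
    case less
    show ?case
    proof (cases "\<beta> \<in> S")
      case True
      then show ?thesis using finS
        by (intro exI[of _ "\<lambda>\<alpha>. if \<alpha> = \<beta> then 1 else 0"]) (simp add: if_distrib[of real] if_distrib[of "\<lambda>c. c *\<^sub>R _"] sum.delta cong: if_cong)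
    next
      case False
      then obtain \<gamma> \<delta> where g: "\<gamma> \<in> Q" "\<delta> \<in> Q" "\<beta> = \<gamma> + \<delta>" using S less.prems by auto
      then have lt: "\<gamma> \<bullet> v < \<beta> \<bullet> v" "\<delta> \<bullet> v < \<beta> \<bullet> v" unfolding Q_def by (auto simp: inner_add_left)
      have less_card: "card {\<epsilon>\<in>Q. \<epsilon> \<bullet> v < \<zeta> \<bullet> v} < card {\<epsilon>\<in>Q. \<epsilon> \<bullet> v < \<beta> \<bullet> v}" if "\<zeta> \<in> Q" "\<zeta> \<bullet> v < \<beta> \<bullet> v" for \<zeta>
        by (rule psubset_card_mono) (use fin that in auto)
      obtain k :: "'a \<Rightarrow> nat" where k: "\<gamma> = (\<Sum>\<alpha>\<in>S. real (k \<alpha>) *\<^sub>R \<alpha>)"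
        using less.hyps[OF less_card[OF g(1) lt(1)] g(1)] by blast
      obtain l :: "'a \<Rightarrow> nat" where "\<delta> = (\<Sum>\<alpha>\<in>S. real (l \<alpha>) *\<^sub>R \<alpha>)"
        using less.hyps[OF less_card[OF g(2) lt(2)] g(2)] by blast
      with k have "\<beta> = (\<Sum>\<alpha>\<in>S. real (k \<alpha> + l \<alpha>) *\<^sub>R \<alpha>)"
        using g by (simp add: sum.distrib scaleR_add_left)
      then show ?thesis by (intro exI[of _ "\<lambda>\<alpha>. k \<alpha> + l \<alpha>"])
    qed
  qed
  have obt: "\<alpha> \<bullet> \<beta> \<le> 0" if "\<alpha> \<in> S" "\<beta> \<in> S" "\<alpha> \<noteq> \<beta>" for \<alpha> \<beta>
  proof (rule ccontr)
    assume c: "\<not> ?thesis"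
    have r: "\<alpha> \<in> \<Phi>" "\<beta> \<in> \<Phi>" using that SQ unfolding Q_def by auto
    have "\<alpha> + (-\<beta>) \<in> insert 0 \<Phi>" using obtuse_roots_sum[OF rs r(1) root_uminus[OF rs r(2)]] c by simp
    then have d: "\<alpha> - \<beta> \<in> \<Phi>" using that by simp
    consider "\<alpha> - \<beta> \<in> Q" | "\<beta> - \<alpha> \<in> Q" using regular_neg[OF rs reg d] d unfolding Q_def by (cases "(\<alpha> - \<beta>) \<bullet> v > 0") auto
    then show False
    proof cases
      case 1
      have "\<alpha> = \<beta> + (\<alpha> - \<beta>)" "\<beta> \<in> Q" using that SQ by auto
      moreover have "\<not> (\<exists>\<beta>\<in>Q. \<exists>\<gamma>\<in>Q. \<alpha> = \<beta> + \<gamma>)" using that(1) unfolding S by blast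
      ultimately show ?thesis using 1 by blast
    next
      case 2
      have "\<beta> = \<alpha> + (\<beta> - \<alpha>)" "\<alpha> \<in> Q" using that SQ by auto
      moreover have "\<not> (\<exists>\<gamma>\<in>Q. \<exists>\<delta>\<in>Q. \<beta> = \<gamma> + \<delta>)" using that(2) unfolding S by blast
      ultimately show ?thesis using 2 by blast
    qed
  qed
  have ind: "independent S"
    unfolding dependent_finite[OF finS]
  proof (clarify)
    fix c :: "'a \<Rightarrow> real" and \<delta> assume z: "(\<Sum>\<alpha>\<in>S. c \<alpha> *\<^sub>R \<alpha>) = 0" and d: "\<delta> \<in> S" "c \<delta> \<noteq> 0"
    \<comment> \<open>Separate the positive and negative coefficients of the relation: u = w, while
      u \<bullet> w \<le> 0 because only distinct simple roots contribute to the product. So u = 0,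
      and pairing with v, which is positive on every simple root, kills all coefficients.\<close>
    define u where "u = (\<Sum>\<alpha>\<in>S. max 0 (c \<alpha>) *\<^sub>R \<alpha>)"
    define w where "w = (\<Sum>\<alpha>\<in>S. max 0 (- c \<alpha>) *\<^sub>R \<alpha>)"
    have "u - w = (\<Sum>\<alpha>\<in>S. c \<alpha> *\<^sub>R \<alpha>)"
      unfolding u_def w_def sum_subtractf[symmetric] scaleR_diff_left[symmetric] by (intro sum.cong) auto
    then have uw: "u = w" using z by simp
    have "u \<bullet> w = (\<Sum>\<beta>\<in>S. \<Sum>\<alpha>\<in>S. max 0 (- c \<beta>) * (max 0 (c \<alpha>) * (\<alpha> \<bullet> \<beta>)))"
      unfolding u_def w_def by (simp add: inner_sum_left inner_sum_right sum_distrib_left)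
    also have "\<dots> \<le> 0"
    proof (intro sum_nonpos)
      fix \<alpha> \<beta> assume ab: "\<alpha> \<in> S" "\<beta> \<in> S"
      show "max 0 (- c \<beta>) * (max 0 (c \<alpha>) * (\<alpha> \<bullet> \<beta>)) \<le> 0"
      proof (cases "\<alpha> = \<beta>")
        case False then show ?thesis using obt[OF ab] by (intro mult_nonneg_nonpos) auto
      qed (auto simp: max_def)
    qed
    finally have "u = 0" using uw by (metis inner_gt_zero_iff not_le)
    then have "u \<bullet> v = 0" "w \<bullet> v = 0" using uw by simp_all
    then have "(\<Sum>\<alpha>\<in>S. max 0 (c \<alpha>) * (\<alpha> \<bullet> v)) = 0" "(\<Sum>\<alpha>\<in>S. max 0 (- c \<alpha>) * (\<alpha> \<bullet> v)) = 0"
      unfolding u_def w_def by (simp_all add: inner_sum_left)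
    moreover have "\<alpha> \<bullet> v > 0" if "\<alpha> \<in> S" for \<alpha> using that SQ unfolding Q_def by auto
    ultimately have "max 0 (c \<delta>) * (\<delta> \<bullet> v) = 0" "max 0 (- c \<delta>) * (\<delta> \<bullet> v) = 0"
      using finS d by (subst (asm) sum_nonneg_eq_0_iff; force intro: mult_nonneg_nonneg less_imp_le)+
    moreover have "\<delta> \<bullet> v > 0" using d SQ unfolding Q_def by auto
    ultimately show False using d by (auto simp: max_def split: if_splits)
  qed
  obtain \<omega> where w: "\<And>\<alpha> \<beta>. \<alpha> \<in> S \<Longrightarrow> \<beta> \<in> S \<Longrightarrow> \<alpha> \<bullet> \<omega> \<beta> = (if \<alpha> = \<beta> then 1 else 0)"
    using dual_basis_exists[OF ind] by blast
  have coord: "(\<Sum>\<alpha>\<in>S. c \<alpha> *\<^sub>R \<alpha>) \<bullet> \<omega> \<beta> = c \<beta>" if "\<beta> \<in> S" for c \<beta>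
  proof -
    have "(\<Sum>\<alpha>\<in>S. c \<alpha> *\<^sub>R \<alpha>) \<bullet> \<omega> \<beta> = (\<Sum>\<alpha>\<in>S. if \<alpha> = \<beta> then c \<alpha> else 0)"
      unfolding inner_sum_left using w that by (intro sum.cong) auto
    then show ?thesis using that finS by simp
  qed
  have Qc: "\<beta> \<bullet> \<omega> \<alpha> \<in> \<nat>" if ba: "\<beta> \<in> Q" "\<alpha> \<in> S" for \<alpha> \<beta>
  proof -
    obtain k :: "'a \<Rightarrow> nat" where "\<beta> = (\<Sum>\<alpha>\<in>S. real (k \<alpha>) *\<^sub>R \<alpha>)" using decomp[OF ba(1)] by blast
    then show ?thesis using coord[OF ba(2), of "\<lambda>\<alpha>. real (k \<alpha>)"] by simp
  qed
  have "\<Phi> \<subseteq> span S"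
  proof
    fix \<beta> assume b: "\<beta> \<in> \<Phi>"
    have *: "\<gamma> \<in> span S" if g: "\<gamma> \<in> Q" for \<gamma>
    proof -
      obtain k :: "'a \<Rightarrow> nat" where "\<gamma> = (\<Sum>\<alpha>\<in>S. real (k \<alpha>) *\<^sub>R \<alpha>)" using decomp[OF g] by blast
      moreover have "(\<Sum>\<alpha>\<in>S. real (k \<alpha>) *\<^sub>R \<alpha>) \<in> span S" by (intro span_sum span_scale span_base)
      ultimately show ?thesis by simp
    qed
    show "\<beta> \<in> span S"
    proof (cases "\<beta> \<bullet> v > 0")
      case True then show ?thesis using * b unfolding Q_def by auto
    next
      case False
      then have "- \<beta> \<in> span S" using * regular_neg[OF rs reg b] unfolding Q_def by auto
      then show ?thesis using span_neg by fastforce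
    qed
  qed
  then have sp: "span S = UNIV" using rs span_mono span_span unfolding root_system_def by (metis top.extremum_unique)
  have ex: "y = (\<Sum>\<alpha>\<in>S. (y \<bullet> \<omega> \<alpha>) *\<^sub>R \<alpha>)" for y
  proof -
    obtain c where "y = (\<Sum>\<alpha>\<in>S. c \<alpha> *\<^sub>R \<alpha>)" using sp span_finite[OF finS] by (metis (no_types, lifting) UNIV_I imageE)
    then show ?thesis using coord by (auto intro!: sum.cong)
  qed
  have nQ: "- \<beta> \<in> Q" if "\<beta> \<in> \<Phi>" "\<beta> \<notin> Q" for \<beta>
    using regular_neg[OF rs reg that(1)] that unfolding Q_def by auto
  have rb: "root_base \<Phi> S \<omega>"
  proof
    show "root_system \<Phi>" by fact
    show "S \<subseteq> \<Phi>" using SQ unfolding Q_def by auto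
    show "\<alpha> \<bullet> \<omega> \<beta> = (if \<alpha> = \<beta> then 1 else 0)" if "\<alpha> \<in> S" "\<beta> \<in> S" for \<alpha> \<beta> using w that .
    show "y = (\<Sum>\<alpha>\<in>S. (y \<bullet> \<omega> \<alpha>) *\<^sub>R \<alpha>)" for y by (rule ex)
    show "(\<forall>\<alpha>\<in>S. \<beta> \<bullet> \<omega> \<alpha> \<in> \<nat>) \<or> (\<forall>\<alpha>\<in>S. - (\<beta> \<bullet> \<omega> \<alpha>) \<in> \<nat>)" if "\<beta> \<in> \<Phi>" for \<beta>
      using Qc nQ[OF that] by (cases "\<beta> \<in> Q") fastforce+
    show "\<alpha> \<bullet> \<beta> \<le> 0" if "\<alpha> \<in> S" "\<beta> \<in> S" "\<alpha> \<noteq> \<beta>" for \<alpha> \<beta> using obt that .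
  qed
  have "root_base.pos_roots \<Phi> S \<omega> = Q"
    unfolding root_base.pos_roots_def[OF rb]
  proof (intro equalityI subsetI)
    fix \<beta> assume "\<beta> \<in> {\<beta> \<in> \<Phi>. \<forall>\<alpha>\<in>S. \<beta> \<bullet> \<omega> \<alpha> \<in> \<nat>}"
    then have b: "\<beta> \<in> \<Phi>" "\<forall>\<alpha>\<in>S. \<beta> \<bullet> \<omega> \<alpha> \<in> \<nat>" by auto
    have "\<beta> \<bullet> v = (\<Sum>\<alpha>\<in>S. (\<beta> \<bullet> \<omega> \<alpha>) * (v \<bullet> \<alpha>))" using root_base.inner_expand[OF rb] .
    also have "\<dots> \<ge> 0"
      using b(2) SQ by (intro sum_nonneg mult_nonneg_nonneg) (auto simp: Nats_def Q_def inner_commute intro: less_imp_le)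
    finally show "\<beta> \<in> Q" using b reg unfolding Q_def regular_def by (auto simp: order_less_le)
  next
    fix \<beta> assume "\<beta> \<in> Q"
    then show "\<beta> \<in> {\<beta> \<in> \<Phi>. \<forall>\<alpha>\<in>S. \<beta> \<bullet> \<omega> \<alpha> \<in> \<nat>}" using Qc unfolding Q_def by auto
  qed
  then show ?thesis using rb unfolding S_def Q_def by blast
qed

section \<open>The weights of a special bundle\<close>

text \<open>A chosen dual basis of the simple roots, that is, the fundamental coweights of the
  chamber of v; only the values at simple roots are meaningful.\<close>

definition coweight :: "'a::euclidean_space set \<Rightarrow> 'a \<Rightarrow> 'a \<Rightarrow> 'a" where
  "coweight \<Phi> v = (SOME \<omega>. root_base \<Phi> (simple_roots \<Phi> (chamber \<Phi> v)) \<omega> \<and>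
    root_base.pos_roots \<Phi> (simple_roots \<Phi> (chamber \<Phi> v)) \<omega> = {\<beta>\<in>\<Phi>. \<beta> \<bullet> v > 0})"

lemma
  assumes "root_system \<Phi>" "regular \<Phi> v"
  shows root_base_coweight: "root_base \<Phi> (simple_roots \<Phi> (chamber \<Phi> v)) (coweight \<Phi> v)"
    and pos_roots_coweight: "root_base.pos_roots \<Phi> (simple_roots \<Phi> (chamber \<Phi> v)) (coweight \<Phi> v) = {\<beta>\<in>\<Phi>. \<beta> \<bullet> v > 0}"
  using someI_ex[OF chamber_root_base[OF assms]] unfolding coweight_def by blast+

lemma mem_chamber: "w \<in> chamber \<Phi> v \<longleftrightarrow> (\<forall>\<alpha>\<in>\<Phi>. \<alpha> \<bullet> v > 0 \<longrightarrow> \<alpha> \<bullet> w \<ge> 0)"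
  unfolding chamber_def by simp

lemma reflection_inner: "reflection \<alpha> x \<bullet> y = x \<bullet> reflection \<alpha> y"
  unfolding reflection_def coroot_def by (simp add: inner_diff_left inner_diff_right inner_commute)

lemma reflection_self: "\<alpha> \<noteq> 0 \<Longrightarrow> reflection \<alpha> \<alpha> = - \<alpha>"
  unfolding reflection_def coroot_def by (simp add: scaleR_2)

lemma reflection_uminus: "reflection \<alpha> (- x) = - reflection \<alpha> x"
  unfolding reflection_def by simp

lemma reflection_root: "root_system \<Phi> \<Longrightarrow> \<alpha> \<in> \<Phi> \<Longrightarrow> \<beta> \<in> \<Phi> \<Longrightarrow> reflection \<alpha> \<beta> \<in> \<Phi>"
  unfolding root_system_def reflection_def by blast

lemma
  shows root_lattice_zero: "0 \<in> root_lattice \<Phi>"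
    and root_lattice_add: "x \<in> root_lattice \<Phi> \<Longrightarrow> y \<in> root_lattice \<Phi> \<Longrightarrow> x + y \<in> root_lattice \<Phi>"
    and root_lattice_uminus: "x \<in> root_lattice \<Phi> \<Longrightarrow> - x \<in> root_lattice \<Phi>"
proof -
  show "0 \<in> root_lattice \<Phi>" unfolding root_lattice_def by (intro CollectI exI[of _ "\<lambda>_. 0"]) simp
  show "x + y \<in> root_lattice \<Phi>" if xy: "x \<in> root_lattice \<Phi>" "y \<in> root_lattice \<Phi>"
  proof -
    obtain k where k: "x = (\<Sum>\<alpha>\<in>\<Phi>. of_int (k \<alpha>) *\<^sub>R \<alpha>)"
      using xy(1) unfolding root_lattice_def by blast
    obtain l where l: "y = (\<Sum>\<alpha>\<in>\<Phi>. of_int (l \<alpha>) *\<^sub>R \<alpha>)"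
      using xy(2) unfolding root_lattice_def by blast
    from k l have "x + y = (\<Sum>\<alpha>\<in>\<Phi>. of_int (k \<alpha> + l \<alpha>) *\<^sub>R \<alpha>)" by (simp add: sum.distrib scaleR_add_left)
    then show ?thesis unfolding root_lattice_def by (intro CollectI exI[of _ "\<lambda>\<alpha>. k \<alpha> + l \<alpha>"]) simp
  qed
  show "- x \<in> root_lattice \<Phi>" if xl: "x \<in> root_lattice \<Phi>"
  proof -
    obtain k where "x = (\<Sum>\<alpha>\<in>\<Phi>. of_int (k \<alpha>) *\<^sub>R \<alpha>)"
      using xl unfolding root_lattice_def by blast
    then have "- x = (\<Sum>\<alpha>\<in>\<Phi>. of_int (- k \<alpha>) *\<^sub>R \<alpha>)" by (simp add: sum_negf)
    then show ?thesis unfolding root_lattice_def by (intro CollectI exI[of _ "\<lambda>\<alpha>. - k \<alpha>"]) simp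
  qed
qed

lemma root_lattice_root: assumes "finite \<Phi>" "\<alpha> \<in> \<Phi>" shows "\<alpha> \<in> root_lattice \<Phi>"
proof -
  have "(\<Sum>\<beta>\<in>\<Phi>. of_int (if \<beta> = \<alpha> then 1 else 0) *\<^sub>R \<beta>) = (\<Sum>\<beta>\<in>\<Phi>. if \<beta> = \<alpha> then \<beta> else 0)"
    by (intro sum.cong) auto
  then have "\<alpha> = (\<Sum>\<beta>\<in>\<Phi>. of_int (if \<beta> = \<alpha> then 1 else 0) *\<^sub>R \<beta>)" using assms by simp
  then show ?thesis unfolding root_lattice_def by (intro CollectI exI[of _ "\<lambda>\<beta>. if \<beta> = \<alpha> then 1 else 0"]) simp
qed

lemma root_lattice_of_nat: "x \<in> root_lattice \<Phi> \<Longrightarrow> real n *\<^sub>R x \<in> root_lattice \<Phi>"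
  by (induction n) (auto simp: scaleR_add_left intro: root_lattice_zero root_lattice_add)

lemma root_lattice_of_int: "x \<in> root_lattice \<Phi> \<Longrightarrow> real_of_int n *\<^sub>R x \<in> root_lattice \<Phi>"
  using root_lattice_of_nat root_lattice_uminus[OF root_lattice_of_nat[of x \<Phi>]] by (cases n rule: int_cases2) auto

lemma root_lattice_sum: "(\<And>i. i \<in> I \<Longrightarrow> f i \<in> root_lattice \<Phi>) \<Longrightarrow> sum f I \<in> root_lattice \<Phi>"
  by (induction I rule: infinite_finite_induct) (auto intro: root_lattice_zero root_lattice_add)

lemma root_lattice_sub_weight_lattice:
  assumes "root_system \<Phi>" shows "root_lattice \<Phi> \<subseteq> weight_lattice \<Phi>"
  using assms unfolding root_lattice_def weight_lattice_def root_system_def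
  by (auto simp: inner_sum_left intro!: Ints_sum Ints_mult)

section \<open>Simple reflections, walls and lattice cones of a chamber\<close>

context
  fixes \<Phi> :: "'a::euclidean_space set" and v :: 'a
  assumes rs: "root_system \<Phi>" and red: "reduced_roots \<Phi>" and reg: "regular \<Phi> v"
begin

interpretation root_base \<Phi> "simple_roots \<Phi> (chamber \<Phi> v)" "coweight \<Phi> v"
  by (rule root_base_coweight[OF rs reg])

lemma pos_roots_eq: "pos_roots = {\<beta>\<in>\<Phi>. \<beta> \<bullet> v > 0}" by (rule pos_roots_coweight[OF rs reg])

text \<open>The reflection changes only the \<alpha>-coordinate. If the image were negative, all
  other coordinates of \<beta> would vanish, and in a reduced system the only positive multiple of
  \<alpha> that is a root is \<alpha> itself.\<close>

lemma simple_reflection_pos: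
  assumes "\<alpha> \<in> simple_roots \<Phi> (chamber \<Phi> v)" "\<beta> \<in> \<Phi>" "\<beta> \<bullet> v > 0" "\<beta> \<noteq> \<alpha>"
  shows "reflection \<alpha> \<beta> \<bullet> v > 0"
proof (rule ccontr)
  let ?\<omega> = "coweight \<Phi> v"
  assume neg: "\<not> ?thesis"
  have a: "\<alpha> \<in> \<Phi>" using assms base_sub by auto
  have bp: "\<beta> \<in> pos_roots" using assms pos_roots_eq by auto
  have "- reflection \<alpha> \<beta> \<in> pos_roots"
    using regular_neg[OF rs reg reflection_root[OF rs a assms(2)]] neg pos_roots_eq by auto
  then have n: "- (reflection \<alpha> \<beta> \<bullet> ?\<omega> \<gamma>) \<ge> 0" if "\<gamma> \<in> simple_roots \<Phi> (chamber \<Phi> v)" for \<gamma>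
    using that unfolding pos_roots_def by (force simp: Nats_def)
  have p: "\<beta> \<bullet> ?\<omega> \<gamma> \<ge> 0" if "\<gamma> \<in> simple_roots \<Phi> (chamber \<Phi> v)" for \<gamma>
    using that bp unfolding pos_roots_def by (force simp: Nats_def)
  have z: "\<beta> \<bullet> ?\<omega> \<gamma> = 0" if "\<gamma> \<in> simple_roots \<Phi> (chamber \<Phi> v)" "\<gamma> \<noteq> \<alpha>" for \<gamma>
    using n[OF that(1)] p[OF that(1)] dual[OF assms(1) that(1)] that(2)
    by (simp add: reflection_def inner_diff_left)
  have "\<beta> = (\<Sum>\<gamma>\<in>simple_roots \<Phi> (chamber \<Phi> v). (\<beta> \<bullet> ?\<omega> \<gamma>) *\<^sub>R \<gamma>)" by (rule expand)
  also have "\<dots> = (\<Sum>\<gamma>\<in>simple_roots \<Phi> (chamber \<Phi> v). if \<gamma> = \<alpha> then (\<beta> \<bullet> ?\<omega> \<gamma>) *\<^sub>R \<gamma> else 0)"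
    using z by (intro sum.cong) auto
  also have "\<dots> = (\<beta> \<bullet> ?\<omega> \<alpha>) *\<^sub>R \<alpha>" using assms(1) fin_base by simp
  finally have e: "\<beta> = (\<beta> \<bullet> ?\<omega> \<alpha>) *\<^sub>R \<alpha>" .
  then have "\<beta> \<bullet> ?\<omega> \<alpha> = 1 \<or> \<beta> \<bullet> ?\<omega> \<alpha> = -1" using red a assms(2) unfolding reduced_roots_def by metis
  then have "\<beta> = \<alpha>" using e p[OF assms(1)] by auto
  then show False using assms by simp
qed

lemma simple_root_props:
  assumes "\<alpha> \<in> simple_roots \<Phi> (chamber \<Phi> v)"
  shows "\<alpha> \<in> \<Phi>" "\<alpha> \<bullet> v > 0" "\<alpha> \<noteq> 0"
  using simple_pos_roots[OF assms] pos_roots_eq zero_root by auto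

lemma regular_reflection:
  assumes "\<alpha> \<in> simple_roots \<Phi> (chamber \<Phi> v)"
  shows "regular \<Phi> (reflection \<alpha> v)"
  using reg reflection_root[OF rs] simple_root_props[OF assms] unfolding regular_def reflection_inner[symmetric] by blast

text \<open>Inductions that cross walls use counts of roots with prescribed signs as measures; they
  decrease because only \<alpha> and -\<alpha> change sign. The converse direction applies
  \<open>simple_reflection_pos\<close> to -\<beta>.\<close>

lemma reflection_sign:
  assumes "\<alpha> \<in> simple_roots \<Phi> (chamber \<Phi> v)" "\<beta> \<in> \<Phi>" "\<beta> \<noteq> \<alpha>" "\<beta> \<noteq> - \<alpha>"
  shows "\<beta> \<bullet> reflection \<alpha> v > 0 \<longleftrightarrow> \<beta> \<bullet> v > 0"
proof
  show "\<beta> \<bullet> reflection \<alpha> v > 0" if "\<beta> \<bullet> v > 0"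
    using simple_reflection_pos[OF assms(1,2) that assms(3)] by (simp add: reflection_inner)
  show "\<beta> \<bullet> v > 0" if p: "\<beta> \<bullet> reflection \<alpha> v > 0"
  proof (rule ccontr)
    assume "\<not> ?thesis"
    then have n: "- \<beta> \<in> \<Phi>" "(- \<beta>) \<bullet> v > 0" using regular_neg[OF rs reg assms(2)] by auto
    have "- \<beta> \<noteq> \<alpha>" using assms(4) by auto
    then have "reflection \<alpha> (- \<beta>) \<bullet> v > 0" using simple_reflection_pos[OF assms(1) n] by simp
    then show False using p by (simp add: reflection_uminus reflection_inner)
  qed
qed

lemma reflection_sign_self:
  assumes "\<alpha> \<in> simple_roots \<Phi> (chamber \<Phi> v)"
  shows "\<alpha> \<bullet> reflection \<alpha> v < 0" "(- \<alpha>) \<bullet> reflection \<alpha> v > 0"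
  using simple_root_props[OF assms] by (auto simp: reflection_inner[symmetric] reflection_self reflection_uminus)

lemma coweight_chamber:
  assumes "\<gamma> \<in> simple_roots \<Phi> (chamber \<Phi> v)" shows "coweight \<Phi> v \<gamma> \<in> chamber \<Phi> v"
  unfolding mem_chamber
proof (intro ballI impI)
  fix \<beta> assume "\<beta> \<in> \<Phi>" "\<beta> \<bullet> v > 0"
  then have "\<beta> \<in> pos_roots" using pos_roots_eq by simp
  then have "\<beta> \<bullet> coweight \<Phi> v \<gamma> \<in> \<nat>" using assms unfolding pos_roots_def by blast
  then show "\<beta> \<bullet> coweight \<Phi> v \<gamma> \<ge> 0" by (auto simp: Nats_def)
qed

lemma chamber_iff_simple:
  "w \<in> chamber \<Phi> v \<longleftrightarrow> (\<forall>\<alpha>\<in>simple_roots \<Phi> (chamber \<Phi> v). w \<bullet> \<alpha> \<ge> 0)"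
proof
  show "\<forall>\<alpha>\<in>simple_roots \<Phi> (chamber \<Phi> v). w \<bullet> \<alpha> \<ge> 0" if "w \<in> chamber \<Phi> v"
    using that simple_root_props(1,2) unfolding mem_chamber inner_commute[of w] by blast
  assume "\<forall>\<alpha>\<in>simple_roots \<Phi> (chamber \<Phi> v). w \<bullet> \<alpha> \<ge> 0"
  then have "dominant w" unfolding dominant_def .
  then show "w \<in> chamber \<Phi> v" using dominant_pos_roots[of w] pos_roots_eq unfolding mem_chamber inner_commute[of w] by blast
qed

text \<open>The coweight of another simple root lies on the wall of \<alpha>, so the reflection
  fixes it and it belongs to both chambers. This carries coordinate inequalities from one chamber to
  the other.\<close>

lemma coweight_chamber_reflection:
  assumes "\<alpha> \<in> simple_roots \<Phi> (chamber \<Phi> v)" "\<gamma> \<in> simple_roots \<Phi> (chamber \<Phi> v)" "\<gamma> \<noteq> \<alpha>"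
  shows "coweight \<Phi> v \<gamma> \<in> chamber \<Phi> (reflection \<alpha> v)"
  unfolding mem_chamber
proof (intro ballI impI)
  fix \<delta> assume d: "\<delta> \<in> \<Phi>" "\<delta> \<bullet> reflection \<alpha> v > 0"
  have "reflection \<alpha> \<delta> \<in> \<Phi>" "reflection \<alpha> \<delta> \<bullet> v > 0" using d reflection_root[OF rs] simple_root_props[OF assms(1)] by (auto simp: reflection_inner)
  then have "reflection \<alpha> \<delta> \<bullet> coweight \<Phi> v \<gamma> \<ge> 0" using coweight_chamber[OF assms(2)] unfolding mem_chamber by blast
  then show "\<delta> \<bullet> coweight \<Phi> v \<gamma> \<ge> 0" using dual[OF assms(1,2)] assms(3) by (simp add: reflection_def inner_diff_left)
qed

text \<open>Fundamental coweights lie in the chamber and roots have integral coordinates, so lattice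
  points of the dual cone are the natural combinations of simple roots. This turns the toric
  condition on characters into the order \<open>below\<close>.\<close>

lemma lattice_cone_iff:
  "y \<in> root_lattice \<Phi> \<and> (\<forall>w\<in>chamber \<Phi> v. y \<bullet> w \<ge> 0) \<longleftrightarrow>
   (\<forall>\<alpha>\<in>simple_roots \<Phi> (chamber \<Phi> v). y \<bullet> coweight \<Phi> v \<alpha> \<in> \<nat>)"
proof (intro iffI ballI conjI)
  fix \<alpha> assume y: "y \<in> root_lattice \<Phi> \<and> (\<forall>w\<in>chamber \<Phi> v. y \<bullet> w \<ge> 0)" and a: "\<alpha> \<in> simple_roots \<Phi> (chamber \<Phi> v)"
  have "\<beta> \<bullet> coweight \<Phi> v \<alpha> \<in> \<int>" if "\<beta> \<in> \<Phi>" for \<beta>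
  proof -
    have "\<beta> \<bullet> coweight \<Phi> v \<alpha> \<in> \<nat> \<or> - (\<beta> \<bullet> coweight \<Phi> v \<alpha>) \<in> \<nat>" using root_sign[OF that] a by blast
    then show ?thesis using Nats_subset_Ints by (metis minus_in_Ints_iff subsetD)
  qed
  moreover obtain k :: "'a \<Rightarrow> int" where "y = (\<Sum>\<alpha>\<in>\<Phi>. of_int (k \<alpha>) *\<^sub>R \<alpha>)"
    using y unfolding root_lattice_def by auto
  ultimately have "y \<bullet> coweight \<Phi> v \<alpha> \<in> \<int>" by (auto simp: inner_sum_left intro!: Ints_sum Ints_mult)
  moreover have "y \<bullet> coweight \<Phi> v \<alpha> \<ge> 0" using y coweight_chamber[OF a] by blast
  ultimately show "y \<bullet> coweight \<Phi> v \<alpha> \<in> \<nat>" using Nats_altdef2 by blast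
next
  assume y: "\<forall>\<alpha>\<in>simple_roots \<Phi> (chamber \<Phi> v). y \<bullet> coweight \<Phi> v \<alpha> \<in> \<nat>"
  have "(y \<bullet> coweight \<Phi> v \<alpha>) *\<^sub>R \<alpha> \<in> root_lattice \<Phi>" if a: "\<alpha> \<in> simple_roots \<Phi> (chamber \<Phi> v)" for \<alpha>
  proof -
    have "y \<bullet> coweight \<Phi> v \<alpha> \<in> \<nat>" using y a by blast
    then obtain n where "y \<bullet> coweight \<Phi> v \<alpha> = real n" by (rule Nats_cases)
    then show ?thesis using root_lattice_of_nat[OF root_lattice_root[OF fin_roots simple_root_props(1)[OF a]]] by simp
  qed
  then show "y \<in> root_lattice \<Phi>" by (subst expand[of y]) (rule root_lattice_sum)
  fix w assume "w \<in> chamber \<Phi> v"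
  then show "y \<bullet> w \<ge> 0" unfolding inner_expand[of y w] using y chamber_iff_simple
    by (intro sum_nonneg mult_nonneg_nonneg) (auto simp: Nats_def)
qed

lemma adjacent_reflection:
  assumes a: "\<alpha> \<in> simple_roots \<Phi> (chamber \<Phi> v)"
  shows "adjacent_chambers \<Phi> (chamber \<Phi> v) (chamber \<Phi> (reflection \<alpha> v))"
proof -
  let ?S = "simple_roots \<Phi> (chamber \<Phi> v)"
  note props = simple_root_props[OF a]
  define U where "U = (\<Inter>\<beta>\<in>{\<beta>\<in>\<Phi>. \<beta> \<bullet> v > 0 \<and> \<beta> \<noteq> \<alpha>}. {w. \<beta> \<bullet> w > 0})"
  \<comment> \<open>The sum of the other fundamental coweights lies on the wall of \<alpha> and is
    strictly positive on every other positive root; a neighbourhood of it in the wall belongs to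
    both chambers and gives the intersection its dimension.\<close>
  define w0 where "w0 = (\<Sum>\<gamma>\<in>?S - {\<alpha>}. coweight \<Phi> v \<gamma>)"
  have "open U" unfolding U_def using fin_roots by (auto intro!: open_INT open_halfspace_gt)
  have w0a: "\<alpha> \<bullet> w0 = 0"
    unfolding w0_def inner_sum_right using dual[OF a] by (intro sum.neutral) auto
  have "w0 \<in> U"
    unfolding U_def
  proof clarify
    fix \<beta> assume b: "\<beta> \<in> \<Phi>" "\<beta> \<bullet> v > 0" "\<beta> \<noteq> \<alpha>"
    have bw: "\<beta> \<bullet> w0 = (\<Sum>\<gamma>\<in>?S - {\<alpha>}. \<beta> \<bullet> coweight \<Phi> v \<gamma>)" unfolding w0_def inner_sum_right ..
    have nn: "\<beta> \<bullet> coweight \<Phi> v \<gamma> \<ge> 0" if "\<gamma> \<in> ?S" for \<gamma>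
      using coweight_chamber[OF that] b unfolding mem_chamber by auto
    \<comment> \<open>Otherwise \<beta> has no coordinate outside \<alpha>, so its reflection is
      -\<beta>, against \<open>simple_reflection_pos\<close>.\<close>
    show "\<beta> \<bullet> w0 > 0"
    proof (rule ccontr)
      assume "\<not> ?thesis"
      then have "(\<Sum>\<gamma>\<in>?S - {\<alpha>}. \<beta> \<bullet> coweight \<Phi> v \<gamma>) = 0" using bw nn sum_nonneg[of "?S - {\<alpha>}" "\<lambda>\<gamma>. \<beta> \<bullet> coweight \<Phi> v \<gamma>"] by auto
      then have z: "\<beta> \<bullet> coweight \<Phi> v \<gamma> = 0" if "\<gamma> \<in> ?S - {\<alpha>}" for \<gamma>
        using that nn fin_base by (subst (asm) sum_nonneg_eq_0_iff) auto
      have sb: "reflection \<alpha> \<beta> \<in> pos_roots" "\<beta> \<in> pos_roots"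
        using simple_reflection_pos[OF a b] reflection_root[OF rs props(1) b(1)] pos_roots_eq b by auto
      have e: "\<beta> = (\<beta> \<bullet> coweight \<Phi> v \<alpha>) *\<^sub>R \<alpha>"
      proof -
        have "\<beta> = (\<Sum>\<gamma>\<in>?S. (\<beta> \<bullet> coweight \<Phi> v \<gamma>) *\<^sub>R \<gamma>)" by (rule expand)
        also have "\<dots> = (\<Sum>\<gamma>\<in>?S. if \<gamma> = \<alpha> then (\<beta> \<bullet> coweight \<Phi> v \<gamma>) *\<^sub>R \<gamma> else 0)"
          using z by (intro sum.cong) auto
        finally show ?thesis using a fin_base by simp
      qed
      then have "reflection \<alpha> \<beta> = - \<beta>" using reflection_self[OF props(3)] unfolding reflection_def
        by (metis (no_types, lifting) inner_scaleR_left scaleR_minus_right scaleR_right_diff_distrib scaleR_scaleR)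
      then have "reflection \<alpha> \<beta> \<bullet> v < 0" using b(2) by simp
      then show False using simple_reflection_pos[OF a b] by simp
    qed
  qed
  have sub: "{w. \<alpha> \<bullet> w = 0} \<inter> U \<subseteq> chamber \<Phi> v \<inter> chamber \<Phi> (reflection \<alpha> v)"
  proof
    fix w assume w: "w \<in> {w. \<alpha> \<bullet> w = 0} \<inter> U"
    have "\<beta> \<bullet> w \<ge> 0" if "\<beta> \<in> \<Phi>" "\<beta> \<bullet> v > 0" for \<beta>
      using w that unfolding U_def by (cases "\<beta> = \<alpha>") (auto intro: less_imp_le)
    moreover have "\<beta> \<bullet> w \<ge> 0" if "\<beta> \<in> \<Phi>" "\<beta> \<bullet> reflection \<alpha> v > 0" for \<beta>
      using w that reflection_sign[OF a that(1)] unfolding U_def by (cases "\<beta> = \<alpha> \<or> \<beta> = - \<alpha>") (auto intro: less_imp_le)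
    ultimately show "w \<in> chamber \<Phi> v \<inter> chamber \<Phi> (reflection \<alpha> v)" unfolding Int_iff mem_chamber by blast
  qed
  have sup: "chamber \<Phi> v \<inter> chamber \<Phi> (reflection \<alpha> v) \<subseteq> {w. \<alpha> \<bullet> w = 0}"
  proof
    fix w assume w: "w \<in> chamber \<Phi> v \<inter> chamber \<Phi> (reflection \<alpha> v)"
    then have "\<alpha> \<bullet> w \<ge> 0" "(- \<alpha>) \<bullet> w \<ge> 0"
      using props reflection_sign_self[OF a] root_uminus[OF rs props(1)] unfolding Int_iff mem_chamber by blast+
    then show "w \<in> {w. \<alpha> \<bullet> w = 0}" by simp
  qed
  have "aff_dim ({w. \<alpha> \<bullet> w = 0} \<inter> U) = aff_dim {w. \<alpha> \<bullet> w = 0}"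
    using \<open>open U\<close> \<open>w0 \<in> U\<close> w0a by (intro aff_dim_convex_Int_open convex_hyperplane) auto
  also have "\<dots> = int DIM('a) - 1" using props(3) by (simp add: aff_dim_hyperplane)
  finally have "aff_dim (chamber \<Phi> v \<inter> chamber \<Phi> (reflection \<alpha> v)) = int DIM('a) - 1"
    using aff_dim_subset[OF sub] aff_dim_subset[OF sup] props(3) by (simp add: aff_dim_hyperplane)
  moreover have "chamber \<Phi> v \<noteq> chamber \<Phi> (reflection \<alpha> v)"
  proof
    assume e: "chamber \<Phi> v = chamber \<Phi> (reflection \<alpha> v)"
    have "v \<in> chamber \<Phi> v" unfolding mem_chamber by (auto intro: less_imp_le)
    then have "(- \<alpha>) \<bullet> v \<ge> 0" unfolding e using reflection_sign_self[OF a] root_uminus[OF rs props(1)] unfolding mem_chamber by blast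
    then show False using props by simp
  qed
  ultimately show ?thesis
    using reg regular_reflection[OF a] unfolding adjacent_chambers_def weyl_chambers_eq[OF rs] by auto
qed

lemma wall_root_reflection:
  assumes a: "\<alpha> \<in> simple_roots \<Phi> (chamber \<Phi> v)"
  shows "wall_root \<Phi> (chamber \<Phi> v) (chamber \<Phi> (reflection \<alpha> v)) = \<alpha>"
  unfolding wall_root_def interior_chamber[OF fin_roots]
proof (rule the_equality)
  note props = simple_root_props[OF a] and m = root_uminus[OF rs simple_root_props(1)[OF a]]
  have "\<alpha> \<bullet> w < 0" if "w \<in> open_chamber \<Phi> (reflection \<alpha> v)" for w
  proof -
    have "(- \<alpha>) \<bullet> w > 0" using that reflection_sign_self(2)[OF a] m unfolding open_chamber_def by blast
    then show ?thesis by simp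
  qed
  then show "\<alpha> \<in> \<Phi> \<and> (\<forall>v\<in>open_chamber \<Phi> v. 0 < \<alpha> \<bullet> v) \<and> (\<forall>v\<in>open_chamber \<Phi> (reflection \<alpha> v). \<alpha> \<bullet> v < 0)"
    using props unfolding open_chamber_def by auto
  fix \<beta> assume b: "\<beta> \<in> \<Phi> \<and> (\<forall>v\<in>open_chamber \<Phi> v. 0 < \<beta> \<bullet> v) \<and> (\<forall>v\<in>open_chamber \<Phi> (reflection \<alpha> v). \<beta> \<bullet> v < 0)"
  have "v \<in> open_chamber \<Phi> v" "reflection \<alpha> v \<in> open_chamber \<Phi> (reflection \<alpha> v)" unfolding open_chamber_def by auto
  then have s: "\<beta> \<bullet> v > 0" "\<beta> \<bullet> reflection \<alpha> v < 0" using b by auto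
  then have "\<beta> = \<alpha> \<or> \<beta> = - \<alpha>" using reflection_sign[OF a, of \<beta>] b by auto
  then show "\<beta> = \<alpha>" using s props by auto
qed

end


text \<open>Weights are described by the cones at all vertices instead of by a convex hull;
  \<open>m v\<close> is the vertex of the chamber of v. This matches the toric side, where m v - x
  has to be a regular character on the chart of every chamber.\<close>

definition bundle_weights :: "'a::euclidean_space set \<Rightarrow> ('a \<Rightarrow> 'a) \<Rightarrow> 'a set" where
  "bundle_weights \<Phi> m = {x. \<forall>v. regular \<Phi> v \<longrightarrow>
     m v - x \<in> root_lattice \<Phi> \<and> (\<forall>w\<in>chamber \<Phi> v. (m v - x) \<bullet> w \<ge> 0)}"

text \<open>The polytope data with vertices indexed by regular vectors, as chambers are. Adjacency
  is kept in the form of simple reflections, and \<open>special\<close> is stated for all positive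
  roots, these being sums of simple ones.\<close>

locale special_weights =
  fixes \<Phi> :: "'a::euclidean_space set" and m :: "'a \<Rightarrow> 'a"
  assumes rs: "root_system \<Phi>" and red: "reduced_roots \<Phi>"
    and weight: "regular \<Phi> v \<Longrightarrow> m v \<in> weight_lattice \<Phi>"
    and same_chamber: "chamber \<Phi> v = chamber \<Phi> u \<Longrightarrow> m v = m u"
    and wall: "\<lbrakk>regular \<Phi> v; \<alpha> \<in> simple_roots \<Phi> (chamber \<Phi> v)\<rbrakk> \<Longrightarrow>
      \<exists>r::int. r > 0 \<and> m v - m (reflection \<alpha> v) = of_int r *\<^sub>R \<alpha>"
    and special: "\<lbrakk>regular \<Phi> v; \<beta> \<in> \<Phi>; \<beta> \<bullet> v > 0\<rbrakk> \<Longrightarrow> m v \<bullet> \<beta> \<ge> 0"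
begin

lemma fin: "finite \<Phi>" and nz: "0 \<notin> \<Phi>" using rs unfolding root_system_def by auto

text \<open>Cross the walls of v one at a time towards u: each crossing adds a positive multiple of
  a root separating v from u. The cone these roots span is described by its pairings because it is
  applied that way, with w in the chamber of v or in both chambers.\<close>

lemma vertex_diff:
  assumes "regular \<Phi> v" "regular \<Phi> u"
  shows "m v - m u \<in> root_lattice \<Phi> \<and>
    (\<forall>w. (\<forall>\<beta>\<in>\<Phi>. \<beta> \<bullet> v > 0 \<and> \<beta> \<bullet> u < 0 \<longrightarrow> \<beta> \<bullet> w \<ge> 0) \<longrightarrow> (m v - m u) \<bullet> w \<ge> 0)"
  using assms(1)
proof (induction "card {\<beta>\<in>\<Phi>. \<beta> \<bullet> v > 0 \<and> \<beta> \<bullet> u < 0}" arbitrary: v rule: less_induct)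
  case less
  interpret root_base \<Phi> "simple_roots \<Phi> (chamber \<Phi> v)" "coweight \<Phi> v"
    by (rule root_base_coweight[OF rs less.prems])
  note pos_roots = pos_roots_eq[OF rs red less.prems]
  show ?case
  proof (cases "\<exists>\<alpha>\<in>simple_roots \<Phi> (chamber \<Phi> v). \<alpha> \<bullet> u < 0")
    case False
    then have "dominant u" unfolding dominant_def by (force simp: inner_commute)
    then have pos: "\<beta> \<bullet> u > 0" if "\<beta> \<in> \<Phi>" "\<beta> \<bullet> v > 0" for \<beta>
      using dominant_pos_roots[of u \<beta>] pos_roots that assms(2) unfolding regular_def by (force simp: inner_commute order_less_le)
    have "\<beta> \<bullet> v > 0 \<longleftrightarrow> \<beta> \<bullet> u > 0" if "\<beta> \<in> \<Phi>" for \<beta>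
      using pos[OF that] pos[of "- \<beta>"] regular_neg[OF rs less.prems that] by fastforce
    then have "chamber \<Phi> v = chamber \<Phi> u" unfolding chamber_def by auto
    then have "m v = m u" by (rule same_chamber)
    then show ?thesis by (simp add: root_lattice_zero)
  next
    case True
    then obtain \<alpha> where a: "\<alpha> \<in> simple_roots \<Phi> (chamber \<Phi> v)" "\<alpha> \<bullet> u < 0" by blast
    note props = simple_root_props[OF rs red less.prems a(1)]
    let ?v = "reflection \<alpha> v"
    have reg': "regular \<Phi> ?v" by (rule regular_reflection[OF rs red less.prems a(1)])
    have sub: "{\<beta>\<in>\<Phi>. \<beta> \<bullet> ?v > 0 \<and> \<beta> \<bullet> u < 0} \<subseteq> {\<beta>\<in>\<Phi>. \<beta> \<bullet> v > 0 \<and> \<beta> \<bullet> u < 0}"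
    proof clarify
      fix \<beta> assume b: "\<beta> \<in> \<Phi>" "\<beta> \<bullet> ?v > 0" "\<beta> \<bullet> u < 0"
      have "\<beta> \<noteq> \<alpha>" using reflection_sign_self(1)[OF rs red less.prems a(1)] b by auto
      moreover have "\<beta> \<noteq> - \<alpha>" using a b by auto
      ultimately show "\<beta> \<bullet> v > 0" using reflection_sign[OF rs red less.prems a(1) b(1)] b by simp
    qed
    have "{\<beta>\<in>\<Phi>. \<beta> \<bullet> ?v > 0 \<and> \<beta> \<bullet> u < 0} \<subset> {\<beta>\<in>\<Phi>. \<beta> \<bullet> v > 0 \<and> \<beta> \<bullet> u < 0}"
    proof -
      have "\<alpha> \<notin> {\<beta>\<in>\<Phi>. \<beta> \<bullet> ?v > 0 \<and> \<beta> \<bullet> u < 0}" using reflection_sign_self(1)[OF rs red less.prems a(1)] by simp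
      moreover have "\<alpha> \<in> {\<beta>\<in>\<Phi>. \<beta> \<bullet> v > 0 \<and> \<beta> \<bullet> u < 0}" using props a by simp
      ultimately show ?thesis using sub by blast
    qed
    then have "card {\<beta>\<in>\<Phi>. \<beta> \<bullet> ?v > 0 \<and> \<beta> \<bullet> u < 0} < card {\<beta>\<in>\<Phi>. \<beta> \<bullet> v > 0 \<and> \<beta> \<bullet> u < 0}"
      using fin by (intro psubset_card_mono) auto
    from less.hyps[OF this reg'] have IH: "m ?v - m u \<in> root_lattice \<Phi>"
      "\<And>w. \<forall>\<beta>\<in>\<Phi>. \<beta> \<bullet> ?v > 0 \<and> \<beta> \<bullet> u < 0 \<longrightarrow> \<beta> \<bullet> w \<ge> 0 \<Longrightarrow> (m ?v - m u) \<bullet> w \<ge> 0" by blast+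
    obtain r :: int where r: "r > 0" "m v - m ?v = of_int r *\<^sub>R \<alpha>" using wall[OF less.prems a(1)] by blast
    then have e: "m v - m u = of_int r *\<^sub>R \<alpha> + (m ?v - m u)" by (simp add: algebra_simps)
    show ?thesis
    proof (intro conjI allI impI)
      show "m v - m u \<in> root_lattice \<Phi>"
        unfolding e using IH root_lattice_root[OF fin props(1)] by (intro root_lattice_add root_lattice_of_int)
      fix w assume w: "\<forall>\<beta>\<in>\<Phi>. \<beta> \<bullet> v > 0 \<and> \<beta> \<bullet> u < 0 \<longrightarrow> \<beta> \<bullet> w \<ge> 0"
      then have "\<forall>\<beta>\<in>\<Phi>. \<beta> \<bullet> ?v > 0 \<and> \<beta> \<bullet> u < 0 \<longrightarrow> \<beta> \<bullet> w \<ge> 0" using sub by blast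
      moreover have "\<alpha> \<bullet> w \<ge> 0" using w props a by blast
      ultimately show "(m v - m u) \<bullet> w \<ge> 0" unfolding e using IH(2)[of w] r(1) by (simp add: inner_add_left)
    qed
  qed
qed

lemma vertex_in_bundle_weights: "regular \<Phi> v \<Longrightarrow> m v \<in> bundle_weights \<Phi> m"
  unfolding bundle_weights_def using vertex_diff by (auto simp: mem_chamber)

lemma bundle_weights_below:
  assumes "regular \<Phi> v" "x \<in> bundle_weights \<Phi> m"
  shows "root_base.below (simple_roots \<Phi> (chamber \<Phi> v)) (coweight \<Phi> v) x (m v)"
  unfolding root_base.below_def[OF root_base_coweight[OF rs assms(1)]]
  using lattice_cone_iff[OF rs red assms(1), of "m v - x"] assms unfolding bundle_weights_def by blast

text \<open>
  Reflecting the chamber in simple roots that pair positively with \<open>\<beta>\<close> reduces to the case that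
  \<open>\<beta>\<close> is simple. The reflection in \<open>\<alpha>\<close> leaves all coordinates except the one at \<open>\<alpha>\<close> unchanged; if
  \<open>\<alpha>\<close> is the only simple root pairing positively with \<open>\<beta>\<close>, that coordinate is bounded by
  pairing with \<open>\<beta>\<close>, using that \<open>m v\<close> pairs strictly positively with \<open>\<beta>\<close> because the vertex of the
  reflected chamber is dominant.
\<close>

lemma bundle_weights_plus:
  assumes x: "x \<in> bundle_weights \<Phi> m" and b: "\<beta> \<in> \<Phi>" "x \<bullet> \<beta> < 0" and v: "regular \<Phi> v" "\<beta> \<bullet> v > 0"
  shows "\<forall>w\<in>chamber \<Phi> v. (m v - x - \<beta>) \<bullet> w \<ge> 0"
  using v
proof (induction "card {\<gamma>\<in>\<Phi>. \<gamma> \<bullet> v > 0 \<and> \<gamma> \<bullet> \<beta> > 0}" arbitrary: v rule: less_induct)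
  case less
  let ?S = "simple_roots \<Phi> (chamber \<Phi> v)" and ?\<omega> = "coweight \<Phi> v"
  interpret root_base \<Phi> ?S ?\<omega> by (rule root_base_coweight[OF rs less.prems(1)])
  note pos_roots = pos_roots_eq[OF rs red less.prems(1)]
  define y where "y = m v - x"
  have yn: "y \<bullet> ?\<omega> \<alpha> \<in> \<nat>" if "\<alpha> \<in> ?S" for \<alpha>
    using bundle_weights_below[OF less.prems(1) x] that unfolding below_def y_def by blast
  have bp: "\<beta> \<in> pos_roots" using b less.prems pos_roots by simp
  have bn: "\<beta> \<bullet> ?\<omega> \<alpha> \<in> \<nat>" if "\<alpha> \<in> ?S" for \<alpha> using bp that unfolding pos_roots_def by blast
  have bb: "\<beta> \<bullet> \<beta> > 0" using root_inner_pos b by blast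
  \<comment> \<open>Integrality: a positive Cartan integer is at least 1. Applied below to \<alpha>
    and to -x.\<close>
  have half: "\<beta> \<bullet> \<beta> \<le> 2 * (z \<bullet> \<beta>)" if z: "z \<in> weight_lattice \<Phi>" "z \<bullet> \<beta> > 0" for z
  proof -
    obtain k :: int where k: "z \<bullet> coroot \<beta> = of_int k" using z(1) b unfolding weight_lattice_def by (metis (mono_tags, lifting) Ints_cases mem_Collect_eq)
    then have e: "2 * (z \<bullet> \<beta>) = of_int k * (\<beta> \<bullet> \<beta>)" using bb unfolding coroot_def by (simp add: field_simps)
    then have "of_int k * (\<beta> \<bullet> \<beta>) > 0" using z by linarith
    then have "k \<ge> 1" using bb by (simp add: zero_less_mult_iff)
    then have "1 * (\<beta> \<bullet> \<beta>) \<le> of_int k * (\<beta> \<bullet> \<beta>)" using bb by (intro mult_right_mono) auto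
    then show ?thesis using e z by simp
  qed
  have coords: "(y - \<beta>) \<bullet> ?\<omega> \<alpha> \<ge> 0" if al: "\<alpha> \<in> ?S" for \<alpha>
  proof (cases "\<beta> \<in> ?S")
    case True
    \<comment> \<open>By speciality y pairs positively with \<beta>. The other simple roots
      contribute nonpositive terms to this pairing, so the natural coordinate of y at \<beta> is at
      least 1.\<close>
    have "y \<bullet> \<beta> > 0" using special[OF less.prems(1) b(1) less.prems(2)] b unfolding y_def by (simp add: inner_diff_left)
    then have p: "(\<Sum>\<gamma>\<in>?S. (y \<bullet> ?\<omega> \<gamma>) * (\<beta> \<bullet> \<gamma>)) > 0" using inner_expand[of y \<beta>] by simp
    have "y \<bullet> ?\<omega> \<beta> \<noteq> 0"
    proof
      assume z: "y \<bullet> ?\<omega> \<beta> = 0"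
      have "(y \<bullet> ?\<omega> \<gamma>) * (\<beta> \<bullet> \<gamma>) \<le> 0" if g: "\<gamma> \<in> ?S" for \<gamma>
      proof (cases "\<gamma> = \<beta>")
        case False
        have "y \<bullet> ?\<omega> \<gamma> \<ge> 0" using yn[OF g] by (auto simp: Nats_def)
        then show ?thesis using obtuse[OF True g] False by (intro mult_nonneg_nonpos) auto
      qed (simp add: z)
      then show False using p sum_nonpos[of ?S "\<lambda>\<gamma>. (y \<bullet> ?\<omega> \<gamma>) * (\<beta> \<bullet> \<gamma>)"] by force
    qed
    then have "y \<bullet> ?\<omega> \<beta> \<ge> 1" using yn[OF True] by (auto simp: Nats_def)
    moreover have "y \<bullet> ?\<omega> \<alpha> \<ge> 0" using yn[OF al] by (auto simp: Nats_def)
    ultimately show ?thesis using dual[OF True al] by (auto simp: inner_diff_left split: if_splits)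
  next
    case nS: False
    have others: "(y - \<beta>) \<bullet> ?\<omega> \<gamma> \<ge> 0"
      and steep: "\<delta> \<bullet> \<beta> \<le> m v \<bullet> \<beta>"
      if d: "\<delta> \<in> ?S" "\<delta> \<bullet> \<beta> > 0" and g: "\<gamma> \<in> ?S" "\<gamma> \<noteq> \<delta>" for \<gamma> \<delta>
    proof -
      let ?v = "reflection \<delta> v"
      note props = simple_root_props[OF rs red less.prems(1) d(1)]
      have reg': "regular \<Phi> ?v" by (rule regular_reflection[OF rs red less.prems(1) d(1)])
      have ne: "\<beta> \<noteq> \<delta>" "\<beta> \<noteq> - \<delta>" using nS d bb less.prems(2) props by auto
      have bv: "\<beta> \<bullet> ?v > 0" using reflection_sign[OF rs red less.prems(1) d(1) b(1) ne] less.prems by simp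
      have "{\<gamma>\<in>\<Phi>. \<gamma> \<bullet> ?v > 0 \<and> \<gamma> \<bullet> \<beta> > 0} \<subset> {\<gamma>\<in>\<Phi>. \<gamma> \<bullet> v > 0 \<and> \<gamma> \<bullet> \<beta> > 0}"
      proof -
        have "\<delta> \<notin> {\<gamma>\<in>\<Phi>. \<gamma> \<bullet> ?v > 0 \<and> \<gamma> \<bullet> \<beta> > 0}"
          using reflection_sign_self(1)[OF rs red less.prems(1) d(1)] by simp
        moreover have "\<delta> \<in> {\<gamma>\<in>\<Phi>. \<gamma> \<bullet> v > 0 \<and> \<gamma> \<bullet> \<beta> > 0}" using props d by simp
        moreover have "\<epsilon> \<bullet> v > 0" if "\<epsilon> \<in> \<Phi>" "\<epsilon> \<bullet> ?v > 0" "\<epsilon> \<bullet> \<beta> > 0" for \<epsilon>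
          using reflection_sign[OF rs red less.prems(1) d(1) that(1)] that d(2) reflection_sign_self(1)[OF rs red less.prems(1) d(1)]
          by (cases "\<epsilon> = \<delta> \<or> \<epsilon> = - \<delta>") auto
        ultimately show ?thesis by blast
      qed
      then have "card {\<gamma>\<in>\<Phi>. \<gamma> \<bullet> ?v > 0 \<and> \<gamma> \<bullet> \<beta> > 0} < card {\<gamma>\<in>\<Phi>. \<gamma> \<bullet> v > 0 \<and> \<gamma> \<bullet> \<beta> > 0}"
        using fin by (intro psubset_card_mono) auto
      from less.hyps[OF this reg' bv] have IH: "(m ?v - x - \<beta>) \<bullet> ?\<omega> \<gamma> \<ge> 0"
        using coweight_chamber_reflection[OF rs red less.prems(1) d(1) g] by blast
      obtain r :: int where r: "r > 0" "m v - m ?v = of_int r *\<^sub>R \<delta>" using wall[OF less.prems(1) d(1)] by blast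
      then have mv: "m v = m ?v + of_int r *\<^sub>R \<delta>" by (simp add: algebra_simps)
      show "(y - \<beta>) \<bullet> ?\<omega> \<gamma> \<ge> 0" using IH dual[OF d(1) g(1)] g(2)
        unfolding y_def mv by (simp add: inner_diff_left inner_add_left)
      have "m ?v \<bullet> \<beta> \<ge> 0" using special[OF reg' b(1) bv] .
      moreover have "1 * (\<delta> \<bullet> \<beta>) \<le> of_int r * (\<delta> \<bullet> \<beta>)" using r(1) d(2) by (intro mult_right_mono) auto
      ultimately show "\<delta> \<bullet> \<beta> \<le> m v \<bullet> \<beta>" unfolding mv by (simp add: inner_add_left)
    qed
    show ?thesis
    proof (rule ccontr)
      assume neg: "\<not> ?thesis"
      obtain \<delta> where d: "\<delta> \<in> ?S" "\<delta> \<bullet> \<beta> > 0" using pos_roots_minus_simple[OF bp nS] by (metis inner_commute)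
      have unique: "\<gamma> = \<alpha>" if "\<gamma> \<in> ?S" "\<gamma> \<bullet> \<beta> > 0" for \<gamma>
        using others[OF that al] neg by auto
      then have da: "\<delta> = \<alpha>" using d by blast
      have apos: "\<alpha> \<bullet> \<beta> > 0" using d da by simp
      \<comment> \<open>\<open>steep\<close> is available in the presence of a second simple root.
        With \<alpha> alone, \<beta> would be a positive multiple of \<alpha>, hence equal to it and
        simple.\<close>
      have "\<exists>\<gamma>\<in>?S. \<gamma> \<noteq> \<alpha>"
      proof (rule ccontr)
        assume "\<not> ?thesis"
        then have "?S = {\<alpha>}" using al by blast
        then have e: "\<beta> = (\<beta> \<bullet> ?\<omega> \<alpha>) *\<^sub>R \<alpha>" using expand[of \<beta>] by simp
        then have "\<beta> \<bullet> ?\<omega> \<alpha> = 1 \<or> \<beta> \<bullet> ?\<omega> \<alpha> = -1"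
          using red b(1) al base_sub unfolding reduced_roots_def by (metis subsetD)
        moreover have "\<beta> \<bullet> ?\<omega> \<alpha> \<ge> 0" using bn[OF al] by (auto simp: Nats_def)
        ultimately have "\<beta> = \<alpha>" using e by auto
        then show False using nS al by simp
      qed
      then obtain \<gamma> where g: "\<gamma> \<in> ?S" "\<gamma> \<noteq> \<alpha>" by blast
      have mvb: "\<alpha> \<bullet> \<beta> \<le> m v \<bullet> \<beta>" using steep[OF al apos g] .
      have neg1: "(y - \<beta>) \<bullet> ?\<omega> \<alpha> \<le> - 1"
        using neg yn[OF al] bn[OF al] by (auto simp: Nats_def inner_diff_left)
      \<comment> \<open>The coordinate at \<alpha> is a negative integer, so its term is at most
        -(\<alpha> \<bullet> \<beta>); every other simple root has a nonnegative coordinate and a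
        nonpositive pairing with \<beta>.\<close>
      have "(y - \<beta>) \<bullet> \<beta> = (\<Sum>\<gamma>\<in>?S. ((y - \<beta>) \<bullet> ?\<omega> \<gamma>) * (\<beta> \<bullet> \<gamma>))" by (rule inner_expand)
      also have "\<dots> \<le> (\<Sum>\<gamma>\<in>?S. if \<gamma> = \<alpha> then - (\<beta> \<bullet> \<alpha>) else 0)"
      proof (rule sum_mono)
        fix \<gamma> assume g: "\<gamma> \<in> ?S"
        show "((y - \<beta>) \<bullet> ?\<omega> \<gamma>) * (\<beta> \<bullet> \<gamma>) \<le> (if \<gamma> = \<alpha> then - (\<beta> \<bullet> \<alpha>) else 0)"
        proof (cases "\<gamma> = \<alpha>")
          case True
          have "((y - \<beta>) \<bullet> ?\<omega> \<alpha>) * (\<beta> \<bullet> \<alpha>) \<le> (- 1) * (\<beta> \<bullet> \<alpha>)"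
            using neg1 apos by (intro mult_right_mono) (auto simp: inner_commute)
          then show ?thesis using True by simp
        next
          case False
          then have "\<gamma> \<bullet> \<beta> \<le> 0" using unique[OF g] by force
          then show ?thesis using others[OF al apos g False] False by (auto simp: inner_commute intro: mult_nonneg_nonpos)
        qed
      qed
      also have "\<dots> = - (\<alpha> \<bullet> \<beta>)" using al fin_base by (simp add: inner_commute)
      finally have 1: "(y - \<beta>) \<bullet> \<beta> \<le> - (\<alpha> \<bullet> \<beta>)" .
      have "\<alpha> \<in> weight_lattice \<Phi>"
        using root_lattice_sub_weight_lattice[OF rs] root_lattice_root[OF fin] al base_sub by blast
      then have 2: "\<beta> \<bullet> \<beta> \<le> 2 * (\<alpha> \<bullet> \<beta>)" using half[of \<alpha>] apos by simp
      have "- x \<in> weight_lattice \<Phi>"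
      proof -
        have "y \<in> weight_lattice \<Phi>"
          using x less.prems(1) root_lattice_sub_weight_lattice[OF rs] unfolding bundle_weights_def y_def by blast
        moreover have "- x = y - m v" unfolding y_def by simp
        ultimately show ?thesis using weight[OF less.prems(1)] unfolding weight_lattice_def
          by (auto simp: inner_diff_left)
      qed
      then have 3: "\<beta> \<bullet> \<beta> \<le> 2 * (- x \<bullet> \<beta>)" using half[of "- x"] b by simp
      have "(y - \<beta>) \<bullet> \<beta> = m v \<bullet> \<beta> - x \<bullet> \<beta> - \<beta> \<bullet> \<beta>" unfolding y_def by (simp add: inner_diff_left)
      \<comment> \<open>Half of \<beta> \<bullet> \<beta> is supplied by -x and half by m v, whose
        pairing is at least \<alpha> \<bullet> \<beta>; so (y - \<beta>) \<bullet> \<beta> \<ge> 0,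
        against the negative bound -(\<alpha> \<bullet> \<beta>).\<close>
      then show False using 1 2 3 mvb bb by simp
    qed
  qed
  show ?case
  proof
    fix w assume "w \<in> chamber \<Phi> v"
    then have w: "w \<bullet> \<alpha> \<ge> 0" if "\<alpha> \<in> ?S" for \<alpha> using chamber_iff_simple[OF rs red less.prems(1)] that by blast
    have "(y - \<beta>) \<bullet> w \<ge> 0" unfolding inner_expand[of "y - \<beta>" w]
      using coords w by (intro sum_nonneg mult_nonneg_nonneg)
    then show "(m v - x - \<beta>) \<bullet> w \<ge> 0" unfolding y_def .
  qed
qed

text \<open>In chambers where \<beta> is positive, subtracting \<beta> only improves the inequality.
  The content lies in the chambers where \<beta> is negative, to which
  \<open>bundle_weights_plus\<close> applies with -\<beta>.\<close>

lemma bundle_weights_saturated: "root_saturated \<Phi> (bundle_weights \<Phi> m)"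
  unfolding root_saturated_def
proof (intro ballI impI)
  fix x \<beta> assume x: "x \<in> bundle_weights \<Phi> m" and b: "\<beta> \<in> \<Phi>" "x \<bullet> \<beta> > 0"
  have nb: "- \<beta> \<in> \<Phi>" "x \<bullet> (- \<beta>) < 0" using root_uminus[OF rs] b by auto
  show "x - \<beta> \<in> bundle_weights \<Phi> m"
    unfolding bundle_weights_def
  proof (intro CollectI allI impI conjI ballI)
    fix v assume v: "regular \<Phi> v"
    have e: "m v - (x - \<beta>) = (m v - x) + \<beta>" by simp
    show "m v - (x - \<beta>) \<in> root_lattice \<Phi>"
      unfolding e using x v root_lattice_root[OF fin b(1)] unfolding bundle_weights_def by (intro root_lattice_add) auto
    fix w assume w: "w \<in> chamber \<Phi> v"
    show "(m v - (x - \<beta>)) \<bullet> w \<ge> 0"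
    proof (cases "\<beta> \<bullet> v > 0")
      case True
      then have "\<beta> \<bullet> w \<ge> 0" using w b unfolding mem_chamber by blast
      moreover have "(m v - x) \<bullet> w \<ge> 0" using x v w unfolding bundle_weights_def by blast
      ultimately show ?thesis unfolding e inner_add_left by simp
    next
      case False
      then have "(- \<beta>) \<bullet> v > 0" using regular_neg[OF rs v b(1)] by blast
      then show ?thesis using bundle_weights_plus[OF x nb v] w unfolding e by simp
    qed
  qed
qed

lemma base_at:
  "\<exists>v. regular \<Phi> v \<and> root_base \<Phi> (simple_roots \<Phi> (chamber \<Phi> v)) (coweight \<Phi> v) \<and>
     root_base.dominant (simple_roots \<Phi> (chamber \<Phi> v)) x"
proof -
  obtain v where v: "regular \<Phi> v" "\<forall>\<alpha>\<in>\<Phi>. \<alpha> \<bullet> v > 0 \<longrightarrow> x \<bullet> \<alpha> \<ge> 0"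
    using dominant_chamber_exists[OF fin nz] by blast
  note rb = root_base_coweight[OF rs v(1)]
  have "root_base.dominant (simple_roots \<Phi> (chamber \<Phi> v)) x"
    unfolding root_base.dominant_def[OF rb] using simple_root_props[OF rs red v(1)] v(2) by blast
  then show ?thesis using v rb by blast
qed

theorem bundle_weights_connected:
  assumes "size X = size Y" "sum_mset X = sum_mset Y" "set_mset X \<subseteq> bundle_weights \<Phi> m" "set_mset Y \<subseteq> bundle_weights \<Phi> m"
  shows "(pair_swap (bundle_weights \<Phi> m))\<^sup>*\<^sup>* X Y"
proof (rule pair_swap_connected[OF rs bundle_weights_saturated _ assms])
  fix x
  obtain v where v: "regular \<Phi> v" "root_base \<Phi> (simple_roots \<Phi> (chamber \<Phi> v)) (coweight \<Phi> v)"
     "root_base.dominant (simple_roots \<Phi> (chamber \<Phi> v)) x" using base_at by blast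
  then show "\<exists>\<Delta> \<omega> \<mu>. root_base \<Phi> \<Delta> \<omega> \<and> root_base.dominant \<Delta> x \<and> \<mu> \<in> bundle_weights \<Phi> m \<and>
      (\<forall>p\<in>bundle_weights \<Phi> m. root_base.below \<Delta> \<omega> p \<mu>)"
    using vertex_in_bundle_weights bundle_weights_below by blast
qed

text \<open>This is the integer decomposition property of the polytope; it gives generation in
  degree one and presents the weights in degree n as an n-fold sum set.\<close>

theorem bundle_weights_power: "bundle_weights \<Phi> (\<lambda>v. real n *\<^sub>R m v) = fold_sums (bundle_weights \<Phi> m) n"
proof
  show "fold_sums (bundle_weights \<Phi> m) n \<subseteq> bundle_weights \<Phi> (\<lambda>v. real n *\<^sub>R m v)"
  proof
    fix x assume "x \<in> fold_sums (bundle_weights \<Phi> m) n"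
    then obtain X where X: "x = sum_mset X" "size X = n" "set_mset X \<subseteq> bundle_weights \<Phi> m" unfolding fold_sums_def by blast
    have "real (size X) *\<^sub>R m v - sum_mset X \<in> root_lattice \<Phi> \<and>
        (\<forall>w\<in>chamber \<Phi> v. (real (size X) *\<^sub>R m v - sum_mset X) \<bullet> w \<ge> 0)" if v: "regular \<Phi> v" for v
      using X(3)
    proof (induction X)
      case empty then show ?case by (simp add: root_lattice_zero)
    next
      case (add a X)
      have e: "real (size (add_mset a X)) *\<^sub>R m v - sum_mset (add_mset a X) =
          (m v - a) + (real (size X) *\<^sub>R m v - sum_mset X)" by (simp add: algebra_simps)
      have a: "m v - a \<in> root_lattice \<Phi>" "\<forall>w\<in>chamber \<Phi> v. (m v - a) \<bullet> w \<ge> 0"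
        using add.prems v unfolding bundle_weights_def by auto
      then show ?case unfolding e inner_add_left using add by (auto intro: root_lattice_add)
    qed
    then show "x \<in> bundle_weights \<Phi> (\<lambda>v. real n *\<^sub>R m v)" using X unfolding bundle_weights_def by blast
  qed
  show "bundle_weights \<Phi> (\<lambda>v. real n *\<^sub>R m v) \<subseteq> fold_sums (bundle_weights \<Phi> m) n"
  proof
    fix x assume x: "x \<in> bundle_weights \<Phi> (\<lambda>v. real n *\<^sub>R m v)"
    obtain v where v: "regular \<Phi> v" "root_base \<Phi> (simple_roots \<Phi> (chamber \<Phi> v)) (coweight \<Phi> v)"
     "root_base.dominant (simple_roots \<Phi> (chamber \<Phi> v)) x" using base_at by blast
    have s: "sum_mset (replicate_mset n (m v)) = real n *\<^sub>R m v"
      by (induction n) (auto simp: algebra_simps)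
    have "root_base.below (simple_roots \<Phi> (chamber \<Phi> v)) (coweight \<Phi> v) x (real n *\<^sub>R m v)"
      unfolding root_base.below_def[OF v(2)]
      using lattice_cone_iff[OF rs red v(1), of "real n *\<^sub>R m v - x"] x v(1) unfolding bundle_weights_def by blast
    moreover have "real n *\<^sub>R m v \<in> fold_sums (bundle_weights \<Phi> m) n"
      unfolding fold_sums_def using vertex_in_bundle_weights[OF v(1)] s
      by (intro CollectI exI[of _ "replicate_mset n (m v)"]) auto
    ultimately show "x \<in> fold_sums (bundle_weights \<Phi> m) n"
      using root_base.saturated_descent[OF v(2) fold_sums_saturated[OF bundle_weights_saturated] v(3)] by blast
  qed
qed

end

lemma special_weights_of_polytope:
  assumes "root_system \<Phi>" "reduced_roots \<Phi>" "ample_polytope \<Phi> P \<mu>" "special_polytope \<Phi> \<mu>"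
  shows "special_weights \<Phi> (\<lambda>v. \<mu> (chamber \<Phi> v))"
proof
  show "root_system \<Phi>" "reduced_roots \<Phi>" by fact+
  have ch: "chamber \<Phi> v \<in> weyl_chambers \<Phi>" if "regular \<Phi> v" for v
    using that unfolding weyl_chambers_eq[OF assms(1)] by blast
  show "\<mu> (chamber \<Phi> v) \<in> weight_lattice \<Phi>" if "regular \<Phi> v" for v
    using ch[OF that] assms(3) unfolding ample_polytope_def by blast
  show "\<mu> (chamber \<Phi> v) = \<mu> (chamber \<Phi> u)" if "chamber \<Phi> v = chamber \<Phi> u" for u v using that by simp
  show "\<exists>r::int. r > 0 \<and> \<mu> (chamber \<Phi> v) - \<mu> (chamber \<Phi> (reflection \<alpha> v)) = of_int r *\<^sub>R \<alpha>"
    if v: "regular \<Phi> v" and a: "\<alpha> \<in> simple_roots \<Phi> (chamber \<Phi> v)" for v \<alpha>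
    using adjacent_reflection[OF assms(1,2) v a] wall_root_reflection[OF assms(1,2) v a] assms(3)
    unfolding ample_polytope_def by metis
  show "\<mu> (chamber \<Phi> v) \<bullet> \<beta> \<ge> 0" if v: "regular \<Phi> v" and b: "\<beta> \<in> \<Phi>" "\<beta> \<bullet> v > 0" for v \<beta>
  proof -
    have "\<mu> (chamber \<Phi> v) \<bullet> \<alpha> \<ge> 0" if a: "\<alpha> \<in> simple_roots \<Phi> (chamber \<Phi> v)" for \<alpha>
    proof -
      have "\<mu> (chamber \<Phi> v) \<bullet> coroot \<alpha> \<ge> 0"
        using assms(4) ch[OF v] a unfolding special_polytope_def chamber_dominant_def by blast
      moreover have "\<alpha> \<bullet> \<alpha> > 0" using simple_root_props(3)[OF assms(1,2) v a] by simp
      ultimately show ?thesis unfolding coroot_def by (simp add: zero_le_mult_iff zero_le_divide_iff)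
    qed
    then have "\<mu> (chamber \<Phi> v) \<in> chamber \<Phi> v" using chamber_iff_simple[OF assms(1,2) v] by blast
    then show ?thesis using b unfolding mem_chamber by (simp add: inner_commute)
  qed
qed

section \<open>Algebras with a multiplicative basis\<close>

lemma poly_mapping_expand: "f = (\<Sum>k\<in>Poly_Mapping.keys f. Poly_Mapping.single k (Poly_Mapping.lookup f k))"
proof (rule poly_mapping_eqI)
  fix i
  show "Poly_Mapping.lookup f i = Poly_Mapping.lookup (\<Sum>k\<in>Poly_Mapping.keys f. Poly_Mapping.single k (Poly_Mapping.lookup f k)) i"
    by (simp add: lookup_sum lookup_single when_def sum.delta in_keys_iff)
qed

lemma mvpolys_zero: "0 \<in> mvpolys V" unfolding mvpolys_def by simp

lemma mvpolys_add: "f \<in> mvpolys V \<Longrightarrow> g \<in> mvpolys V \<Longrightarrow> f + g \<in> mvpolys V"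
  unfolding mvpolys_def using keys_add[of f g] by blast

lemma mvpolys_diff: "f \<in> mvpolys V \<Longrightarrow> g \<in> mvpolys V \<Longrightarrow> f - g \<in> mvpolys V"
  unfolding mvpolys_def using keys_diff[of f g] by blast

lemma mvpolys_mult: "f \<in> mvpolys V \<Longrightarrow> g \<in> mvpolys V \<Longrightarrow> f * g \<in> mvpolys V"
  unfolding mvpolys_def using keys_mult[of f g] by fastforce

lemma mvpolys_sum: "(\<And>i. i \<in> I \<Longrightarrow> f i \<in> mvpolys V) \<Longrightarrow> sum f I \<in> mvpolys V"
  by (induction I rule: infinite_finite_induct) (auto intro: mvpolys_zero mvpolys_add)

lemma mvpolys_single: "set_mset M \<subseteq> V \<Longrightarrow> Poly_Mapping.single M c \<in> mvpolys V"
  unfolding mvpolys_def by simp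

lemma mvpolys_var: "v \<in> V \<Longrightarrow> poly_var v \<in> mvpolys V"
  and mvpolys_const: "poly_const c \<in> mvpolys V"
  unfolding poly_var_def poly_const_def by (auto intro!: mvpolys_single)

lemma mvpolys_mono: "U \<subseteq> V \<Longrightarrow> mvpolys U \<subseteq> mvpolys V"
  unfolding mvpolys_def by blast

lemma ideal_zero: "0 \<in> ideal_generated S G"
  unfolding ideal_generated_def by (intro CollectI exI[of _ "{}"] exI[of _ "\<lambda>_. 0"]) auto

lemma ideal_generator: "1 \<in> S \<Longrightarrow> g \<in> G \<Longrightarrow> g \<in> ideal_generated S G"
  unfolding ideal_generated_def by (intro CollectI exI[of _ "{g}"] exI[of _ "\<lambda>_. 1"]) auto

lemma ideal_add:
  assumes "\<And>a b. a \<in> S \<Longrightarrow> b \<in> S \<Longrightarrow> a + b \<in> S" "0 \<in> S"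
    and "x \<in> ideal_generated S G" "y \<in> ideal_generated S G"
  shows "x + y \<in> ideal_generated S G"
proof -
  obtain B h where B: "finite B" "B \<subseteq> G" "h ` B \<subseteq> S" "x = (\<Sum>g\<in>B. h g * g)"
    using assms(3) unfolding ideal_generated_def by blast
  obtain C k where C: "finite C" "C \<subseteq> G" "k ` C \<subseteq> S" "y = (\<Sum>g\<in>C. k g * g)"
    using assms(4) unfolding ideal_generated_def by blast
  \<comment> \<open>A member of the ideal uses each generator once, so the two coefficient functions
    are extended by 0 and added on the union.\<close>
  define l where "l g = (if g \<in> B then h g else 0) + (if g \<in> C then k g else 0)" for g
  have "(\<Sum>g\<in>B \<union> C. l g * g) = (\<Sum>g\<in>B \<union> C. (if g \<in> B then h g else 0) * g) + (\<Sum>g\<in>B \<union> C. (if g \<in> C then k g else 0) * g)"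
    unfolding l_def by (simp add: distrib_right sum.distrib)
  also have "(\<Sum>g\<in>B \<union> C. (if g \<in> B then h g else 0) * g) = x"
    unfolding B(4) using B C by (intro sum.mono_neutral_cong_right) auto
  also have "(\<Sum>g\<in>B \<union> C. (if g \<in> C then k g else 0) * g) = y"
    unfolding C(4) using B C by (intro sum.mono_neutral_cong_right) auto
  finally have "x + y = (\<Sum>g\<in>B \<union> C. l g * g)" by simp
  moreover have "l ` (B \<union> C) \<subseteq> S" using B(3) C(3) assms(1,2) unfolding l_def by (auto simp: image_subset_iff)
  ultimately show ?thesis using B C unfolding ideal_generated_def
    by (intro CollectI exI[of _ "B \<union> C"] exI[of _ l]) auto
qed

lemma ideal_mult:
  assumes "\<And>a b. a \<in> S \<Longrightarrow> b \<in> S \<Longrightarrow> a * b \<in> S" "a \<in> S" "x \<in> ideal_generated S G"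
  shows "a * x \<in> ideal_generated S G"
proof -
  obtain B h where B: "finite B" "B \<subseteq> G" "h ` B \<subseteq> S" "x = (\<Sum>g\<in>B. h g * g)"
    using assms(3) unfolding ideal_generated_def by blast
  have "a * x = (\<Sum>g\<in>B. (a * h g) * g)" unfolding B by (simp add: sum_distrib_left mult.assoc)
  then show ?thesis using B assms unfolding ideal_generated_def
    by (intro CollectI exI[of _ B] exI[of _ "\<lambda>g. a * h g"]) auto
qed

text \<open>The algebra of the semigroup of pairs (n, x), with basis E n x. Independence is required
  across degrees and yields injectivity of \<iota> and directness of the grading. The unit is
  \<iota> 1, which may differ from that of the ambient ring; hence \<open>E_unit\<close>.\<close>

locale graded_semigroup_algebra =
  fixes \<iota> :: "complex \<Rightarrow> 'r::comm_ring_1" and A :: "nat \<Rightarrow> 'r set"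
    and L :: "'a::comm_monoid_add set" and E :: "nat \<Rightarrow> 'a \<Rightarrow> 'r"
  assumes \<iota>_add: "\<iota> (a + b) = \<iota> a + \<iota> b" and \<iota>_mult: "\<iota> (a * b) = \<iota> a * \<iota> b"
    and A_eq: "A n = {\<Sum>x\<in>B. \<iota> (c x) * E n x | B c. finite B \<and> B \<subseteq> fold_sums L n}"
    and E_mult: "\<lbrakk>x \<in> fold_sums L n; y \<in> fold_sums L k\<rbrakk> \<Longrightarrow> E n x * E k y = E (n + k) (x + y)"
    and E_zero: "E 0 0 = \<iota> 1"
    and E_unit: "x \<in> fold_sums L n \<Longrightarrow> \<iota> 1 * E n x = E n x"
    and E_indep: "\<lbrakk>finite B; \<And>t. t \<in> B \<Longrightarrow> snd t \<in> fold_sums L (fst t);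
        (\<Sum>t\<in>B. \<iota> (c t) * E (fst t) (snd t)) = 0; t \<in> B\<rbrakk> \<Longrightarrow> c t = 0"
    and connected: "\<lbrakk>size X = size Y; sum_mset X = sum_mset Y; set_mset X \<subseteq> L; set_mset Y \<subseteq> L\<rbrakk> \<Longrightarrow>
        (pair_swap L)\<^sup>*\<^sup>* X Y"
begin

lemma \<iota>_zero [simp]: "\<iota> 0 = 0" using \<iota>_add[of 0 0] by simp

lemma \<iota>_minus: "\<iota> (a - b) = \<iota> a - \<iota> b" using \<iota>_add[of "a - b" b] by (simp add: algebra_simps)

lemma \<iota>_sum: "\<iota> (sum f I) = (\<Sum>i\<in>I. \<iota> (f i))"
  by (induction I rule: infinite_finite_induct) (auto simp: \<iota>_add)

lemma fold_sums_1: "fold_sums L 1 = L"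
proof
  show "fold_sums L 1 \<subseteq> L"
  proof
    fix x assume "x \<in> fold_sums L 1"
    then obtain X where X: "x = sum_mset X" "size X = 1" "set_mset X \<subseteq> L" unfolding fold_sums_def by blast
    then obtain a where "X = {#a#}" using size_1_singleton_mset by blast
    then show "x \<in> L" using X by simp
  qed
  show "L \<subseteq> fold_sums L 1" unfolding fold_sums_def by (auto intro!: exI[of _ "{#_#}"])
qed

lemma fold_sums_0: "fold_sums L 0 = {0}" unfolding fold_sums_def by auto

lemma fold_sums_sum: "set_mset X \<subseteq> L \<Longrightarrow> sum_mset X \<in> fold_sums L (size X)"
  unfolding fold_sums_def by blast

lemma fold_sums_add:
  assumes "x \<in> fold_sums L n" "y \<in> fold_sums L k" shows "x + y \<in> fold_sums L (n + k)"
proof -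
  obtain X Y where X: "x = sum_mset X" "size X = n" "set_mset X \<subseteq> L"
    and Y: "y = sum_mset Y" "size Y = k" "set_mset Y \<subseteq> L"
    using assms unfolding fold_sums_def by blast
  then show ?thesis using fold_sums_sum[of "X + Y"] by simp
qed

text \<open>The factor \<iota> 1 matters for the empty multiset: the empty product is the unit of
  the ambient ring, whereas E 0 0 is \<iota> 1.\<close>

lemma E_prod: "set_mset X \<subseteq> L \<Longrightarrow> \<iota> 1 * prod_mset (image_mset (E 1) X) = E (size X) (sum_mset X)"
proof (induction X)
  case empty then show ?case by (simp add: E_zero)
next
  case (add x X)
  then have "x \<in> fold_sums L 1" "sum_mset X \<in> fold_sums L (size X)" using fold_sums_1 fold_sums_sum by auto
  then have "E 1 x * E (size X) (sum_mset X) = E (1 + size X) (x + sum_mset X)" by (rule E_mult)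
  moreover have "\<iota> 1 * prod_mset (image_mset (E 1) (add_mset x X)) = E 1 x * (\<iota> 1 * prod_mset (image_mset (E 1) X))"
    by (simp add: mult.left_commute)
  moreover have "\<iota> 1 * prod_mset (image_mset (E 1) X) = E (size X) (sum_mset X)" using add by simp
  ultimately have "\<iota> 1 * prod_mset (image_mset (E 1) (add_mset x X)) = E (1 + size X) (x + sum_mset X)" by (simp only:)
  then show ?case by simp
qed

lemma \<iota>_absorb: "\<iota> c * \<iota> 1 = \<iota> c" using \<iota>_mult[of c 1] by simp

lemma in_A: "x \<in> fold_sums L n \<Longrightarrow> \<iota> c * E n x \<in> A n"
  unfolding A_eq by (intro CollectI exI[of _ "{x}"] exI[of _ "\<lambda>_. c"]) auto

lemma E_in_A: "x \<in> fold_sums L n \<Longrightarrow> E n x \<in> A n"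
  using in_A[of x n 1] E_unit by simp

lemma A_zero: "0 \<in> A n" unfolding A_eq by (intro CollectI exI[of _ "{}"]) auto

lemma A_add: assumes "x \<in> A n" "y \<in> A n" shows "x + y \<in> A n"
proof -
  obtain B c where B: "finite B" "B \<subseteq> fold_sums L n" "x = (\<Sum>x\<in>B. \<iota> (c x) * E n x)"
    using assms(1) unfolding A_eq by blast
  obtain C d where C: "finite C" "C \<subseteq> fold_sums L n" "y = (\<Sum>x\<in>C. \<iota> (d x) * E n x)"
    using assms(2) unfolding A_eq by blast
  define l where "l z = (if z \<in> B then c z else 0) + (if z \<in> C then d z else 0)" for z
  have "(\<Sum>z\<in>B \<union> C. \<iota> (l z) * E n z) = (\<Sum>z\<in>B \<union> C. \<iota> (if z \<in> B then c z else 0) * E n z)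
      + (\<Sum>z\<in>B \<union> C. \<iota> (if z \<in> C then d z else 0) * E n z)"
    unfolding l_def by (simp add: distrib_right sum.distrib \<iota>_add)
  also have "(\<Sum>z\<in>B \<union> C. \<iota> (if z \<in> B then c z else 0) * E n z) = x"
    unfolding B(3) using B C by (intro sum.mono_neutral_cong_right) auto
  also have "(\<Sum>z\<in>B \<union> C. \<iota> (if z \<in> C then d z else 0) * E n z) = y"
    unfolding C(3) using B C by (intro sum.mono_neutral_cong_right) auto
  finally show ?thesis using B C unfolding A_eq
    by (intro CollectI exI[of _ "B \<union> C"] exI[of _ l]) auto
qed

lemma A_sum: "(\<And>i. i \<in> I \<Longrightarrow> f i \<in> A n) \<Longrightarrow> sum f I \<in> A n"
  by (induction I rule: infinite_finite_induct) (auto intro: A_zero A_add)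

lemma A_mult: assumes "x \<in> A n" "y \<in> A k" shows "x * y \<in> A (n + k)"
proof -
  obtain B c where B: "finite B" "B \<subseteq> fold_sums L n" "x = (\<Sum>x\<in>B. \<iota> (c x) * E n x)"
    using assms(1) unfolding A_eq by blast
  obtain C d where C: "finite C" "C \<subseteq> fold_sums L k" "y = (\<Sum>x\<in>C. \<iota> (d x) * E k x)"
    using assms(2) unfolding A_eq by blast
  have "\<iota> (c x) * E n x * (\<iota> (d y) * E k y) \<in> A (n + k)" if "x \<in> B" "y \<in> C" for x y
  proof -
    have xy: "x \<in> fold_sums L n" "y \<in> fold_sums L k" using that B C by auto
    have "\<iota> (c x) * E n x * (\<iota> (d y) * E k y) = \<iota> (c x * d y) * (E n x * E k y)" by (simp add: \<iota>_mult mult_ac)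
    then show ?thesis using E_mult[OF xy] in_A[OF fold_sums_add[OF xy]] by simp
  qed
  then show ?thesis unfolding B(3) C(3) sum_product by (intro A_sum)
qed

lemma A_unit: assumes "x \<in> A n" shows "\<iota> 1 * x = x"
proof -
  obtain B c where "x = (\<Sum>x\<in>B. \<iota> (c x) * E n x)"
    using assms(1) unfolding A_eq by blast
  moreover have "\<iota> 1 * (\<iota> c * y) = \<iota> c * y" for c y
    using \<iota>_absorb[of c] by (metis mult.assoc mult.commute)
  ultimately show ?thesis by (simp add: sum_distrib_left)
qed

lemma \<iota>_inj: "inj \<iota>"
proof (rule injI)
  fix a b assume "\<iota> a = \<iota> b"
  then have "\<iota> (a - b) * E 0 0 = 0" by (simp add: \<iota>_minus)
  then have "a - b = 0" using E_indep[of "{(0, 0)}" "\<lambda>_. a - b" "(0, 0)"] fold_sums_0 by simp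
  then show "a = b" by simp
qed

lemma A_0: "A 0 = range \<iota>"
proof
  show "range \<iota> \<subseteq> A 0" using in_A[of 0 0] fold_sums_0 E_zero \<iota>_absorb by fastforce
  show "A 0 \<subseteq> range \<iota>"
  proof
    fix x assume "x \<in> A 0"
    then obtain B c where B: "B \<subseteq> {0}" "x = (\<Sum>x\<in>B. \<iota> (c x) * E 0 x)"
      unfolding A_eq fold_sums_0 by blast
    then consider "B = {}" | "B = {0}" by blast
    then show "x \<in> range \<iota>"
    proof cases
      case 1 then show ?thesis using B by (metis \<iota>_zero rangeI sum.empty)
    next
      case 2 then show ?thesis using B E_zero \<iota>_absorb by simp
    qed
  qed
qed

lemma A_direct:
  assumes a: "\<And>n. a n \<in> A n" and s: "(\<Sum>n\<le>N. a n) = 0" and n: "n \<le> N"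
  shows "a n = 0"
proof -
  have "\<forall>n. \<exists>B c. finite B \<and> B \<subseteq> fold_sums L n \<and> a n = (\<Sum>x\<in>B. \<iota> (c x) * E n x)"
    using a unfolding A_eq by blast
  then obtain B c where B: "\<And>n. finite (B n)" "\<And>n. B n \<subseteq> fold_sums L n"
    "\<And>n. a n = (\<Sum>x\<in>B n. \<iota> (c n x) * E n x)" by metis
  have "(\<Sum>t\<in>Sigma {..N} B. \<iota> (c (fst t) (snd t)) * E (fst t) (snd t)) = (\<Sum>n\<le>N. a n)"
    unfolding B(3) using B(1) by (subst sum.Sigma) (auto simp: case_prod_beta)
  then have sz: "(\<Sum>t\<in>Sigma {..N} B. \<iota> (c (fst t) (snd t)) * E (fst t) (snd t)) = 0" using s by simp
  have fin: "finite (Sigma {..N} B)" using B(1) by simp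
  have mem: "snd t \<in> fold_sums L (fst t)" if "t \<in> Sigma {..N} B" for t using B(2)[of "fst t"] that by auto
  have z: "c (fst t) (snd t) = 0" if "t \<in> Sigma {..N} B" for t
    using E_indep[of "Sigma {..N} B" "\<lambda>t. c (fst t) (snd t)", OF fin mem sz that] .
  have "c n x = 0" if "x \<in> B n" for x using z[of "(n, x)"] that n by simp
  then show ?thesis unfolding B(3) by simp
qed

lemma connected_graded: "connected_graded_algebra \<iota> A"
  unfolding connected_graded_algebra_def
proof (intro conjI allI ballI impI)
  show "a n = 0" if "(\<forall>m. a m \<in> A m) \<and> (\<Sum>m\<le>N. a m) = 0" "n \<le> N" for a N n
    using A_direct[of a N n] that by blast
qed (fact \<iota>_inj \<iota>_add \<iota>_mult A_0 A_zero | (rule A_unit A_add A_mult; assumption))+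

section \<open>Evaluation and the ideal of linear and quadratic relations\<close>

abbreviation ev where "ev \<equiv> mvpoly_eval \<iota>"

lemma ev_add: "ev (f + g) = ev f + ev g"
  unfolding mvpoly_eval_def
  by (rule setsum_keys_plus_distrib) (auto simp: \<iota>_add distrib_right)

lemma ev_single: "ev (Poly_Mapping.single M c) = \<iota> c * prod_mset M"
  unfolding mvpoly_eval_def by simp

lemma ev_zero: "ev 0 = 0" unfolding mvpoly_eval_def by simp

lemma ev_minus: "ev (f - g) = ev f - ev g"
  using ev_add[of "f - g" g] by (simp add: algebra_simps)

lemma ev_sum: "ev (sum f I) = (\<Sum>i\<in>I. ev (f i))"
  by (induction I rule: infinite_finite_induct) (auto simp: ev_zero ev_add)

lemma ev_mult: "ev (f * g) = ev f * ev g"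
proof -
  have "f * g = (\<Sum>M\<in>Poly_Mapping.keys f. \<Sum>N\<in>Poly_Mapping.keys g.
      Poly_Mapping.single (M + N) (Poly_Mapping.lookup f M * Poly_Mapping.lookup g N))"
    using arg_cong2[where f = "(*)", OF poly_mapping_expand[of f] poly_mapping_expand[of g]]
    by (simp only: sum_product mult_single)
  then have "ev (f * g) = (\<Sum>M\<in>Poly_Mapping.keys f. \<Sum>N\<in>Poly_Mapping.keys g.
      \<iota> (Poly_Mapping.lookup f M * Poly_Mapping.lookup g N) * prod_mset (M + N))"
    by (simp add: ev_sum ev_single)
  then show ?thesis unfolding mvpoly_eval_def sum_product by (simp add: \<iota>_mult mult_ac)
qed

definition quads :: "'r mvpoly set" where
  "quads = {f \<in> eval_kernel \<iota> (A 1). \<forall>M\<in>Poly_Mapping.keys f. size M = 2}"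

definition rels :: "'r mvpoly set" where
  "rels = ideal_generated (mvpolys (A 1)) (linearity_relations \<iota> (A 1) \<union> quads)"

lemma one_mvpolys: "1 \<in> mvpolys V"
  using mvpolys_single[of "{#}" V 1] by (metis empty_subsetI set_mset_empty single_one zero_multiset_def)

lemma A_1_scale: "v \<in> A 1 \<Longrightarrow> \<iota> c * v \<in> A 1"
  using A_mult[of "\<iota> c" 0 v 1] A_0 by auto

lemma rels_sub: "rels \<subseteq> eval_kernel \<iota> (A 1)"
proof
  fix f assume "f \<in> rels"
  then obtain B h where B: "B \<subseteq> linearity_relations \<iota> (A 1) \<union> quads" "h ` B \<subseteq> mvpolys (A 1)"
    "f = (\<Sum>g\<in>B. h g * g)" unfolding rels_def ideal_generated_def by blast
  have "g \<in> mvpolys (A 1) \<and> ev g = 0" if "g \<in> B" for g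
  proof -
    consider v w where "g = poly_var (v + w) - poly_var v - poly_var w" "v \<in> A 1" "w \<in> A 1"
      | c v where "g = poly_var (\<iota> c * v) - poly_const c * poly_var v" "v \<in> A 1"
      | "g \<in> quads" using B(1) \<open>g \<in> B\<close> unfolding linearity_relations_def by blast
    then show ?thesis
    proof cases
      case 1
      have "ev g = \<iota> 1 * (v + w) - \<iota> 1 * v - \<iota> 1 * w" unfolding 1 ev_minus by (simp add: poly_var_def ev_single)
      then have "ev g = 0" by (simp add: algebra_simps)
      moreover have "g \<in> mvpolys (A 1)" unfolding 1(1) using 1(2,3) by (intro mvpolys_diff mvpolys_var A_add)
      ultimately show ?thesis by blast
    next
      case 2
      have "ev g = \<iota> 1 * (\<iota> c * v) - \<iota> c * (\<iota> 1 * v)"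
        unfolding 2 ev_minus ev_mult by (simp add: poly_var_def poly_const_def ev_single)
      then have "ev g = 0" by (simp add: algebra_simps)
      moreover have "g \<in> mvpolys (A 1)"
        unfolding 2(1) using 2(2) by (intro mvpolys_diff mvpolys_mult mvpolys_const mvpolys_var A_1_scale)
      ultimately show ?thesis by blast
    next
      case 3 then show ?thesis unfolding quads_def eval_kernel_def by blast
    qed
  qed
  then show "f \<in> eval_kernel \<iota> (A 1)"
    using B unfolding eval_kernel_def by (auto simp: ev_sum ev_mult intro!: mvpolys_sum mvpolys_mult)
qed

lemma rels_zero: "0 \<in> rels" unfolding rels_def by (rule ideal_zero)

lemma rels_add: "f \<in> rels \<Longrightarrow> g \<in> rels \<Longrightarrow> f + g \<in> rels"
  unfolding rels_def by (rule ideal_add[OF mvpolys_add mvpolys_zero])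

lemma rels_mult: "f \<in> mvpolys (A 1) \<Longrightarrow> g \<in> rels \<Longrightarrow> f * g \<in> rels"
  unfolding rels_def by (rule ideal_mult[OF mvpolys_mult])

lemma rels_sum: "(\<And>i. i \<in> I \<Longrightarrow> f i \<in> rels) \<Longrightarrow> sum f I \<in> rels"
  by (induction I rule: infinite_finite_induct) (auto intro: rels_zero rels_add)

lemma rels_generator: "g \<in> linearity_relations \<iota> (A 1) \<union> quads \<Longrightarrow> g \<in> rels"
  unfolding rels_def by (rule ideal_generator[OF one_mvpolys])

lemma rels_trans: "f - g \<in> rels \<Longrightarrow> g - h \<in> rels \<Longrightarrow> f - h \<in> rels"
  using rels_add[of "f - g" "g - h"] by simp

section \<open>Reduction to the basis variables and the kernel of evaluation\<close>

abbreviation basis :: "'r set" where "basis \<equiv> E 1 ` L"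

lemma basis_sub: "basis \<subseteq> A 1" using E_in_A fold_sums_1 by auto

lemma reduce_var: assumes "v \<in> A 1" shows "\<exists>g\<in>mvpolys basis. poly_var v - g \<in> rels"
proof -
  obtain B c where B: "finite B" "B \<subseteq> L" "v = (\<Sum>x\<in>B. \<iota> (c x) * E 1 x)"
    using assms unfolding A_eq fold_sums_1 by blast
  have "(\<Sum>x\<in>B. \<iota> (c x) * E 1 x) \<in> A 1 \<and> (\<exists>g\<in>mvpolys basis. poly_var (\<Sum>x\<in>B. \<iota> (c x) * E 1 x) - g \<in> rels)"
    using B(1,2)
  proof (induction B)
    case empty
    \<comment> \<open>The variable attached to the zero vector is not the zero polynomial; it is a
      relation, namely the scalar relation with factor 0.\<close>
    have "poly_var (\<iota> 0 * 0) - poly_const 0 * poly_var 0 \<in> rels"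
      by (rule rels_generator) (use A_zero in \<open>auto simp: linearity_relations_def intro!: exI[of _ 0]\<close>)
    then have "poly_var (\<Sum>x\<in>{}. \<iota> (c x) * E 1 x) - 0 \<in> rels" by (simp add: poly_const_def)
    moreover have "(\<Sum>x\<in>{}. \<iota> (c x) * E 1 x) \<in> A 1" using A_zero by simp
    ultimately show ?case using mvpolys_zero by blast
  next
    case (insert x B)
    define w where "w = (\<Sum>x\<in>B. \<iota> (c x) * E 1 x)"
    obtain g where w: "w \<in> A 1" and g: "g \<in> mvpolys basis" "poly_var w - g \<in> rels"
      using insert unfolding w_def by auto
    have x: "E 1 x \<in> A 1" "\<iota> (c x) * E 1 x \<in> A 1" using insert E_in_A in_A fold_sums_1 by auto
    let ?g = "poly_const (c x) * poly_var (E 1 x) + g"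
    have 1: "poly_var (\<iota> (c x) * E 1 x + w) - poly_var (\<iota> (c x) * E 1 x) - poly_var w \<in> rels"
      by (rule rels_generator) (use x w in \<open>auto simp: linearity_relations_def\<close>)
    have 2: "poly_var (\<iota> (c x) * E 1 x) - poly_const (c x) * poly_var (E 1 x) \<in> rels"
      by (rule rels_generator) (use x w in \<open>auto simp: linearity_relations_def\<close>)
    have "poly_var (\<iota> (c x) * E 1 x + w) - ?g \<in> rels"
      using rels_add[OF rels_add[OF 1 2] g(2)] by (simp add: algebra_simps)
    moreover have "?g \<in> mvpolys basis"
      using insert g by (auto intro!: mvpolys_add mvpolys_mult mvpolys_const mvpolys_var)
    ultimately show ?case using insert.hyps A_add[OF x(2) w] unfolding w_def by auto
  qed
  then show ?thesis using B by simp
qed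

lemma reduce_monomial:
  assumes "set_mset M \<subseteq> A 1" shows "\<exists>g\<in>mvpolys basis. Poly_Mapping.single M c - g \<in> rels"
  using assms
proof (induction M)
  case empty
  show ?case by (intro bexI[of _ "Poly_Mapping.single {#} c"]) (auto intro: rels_zero mvpolys_single)
next
  case (add v M)
  obtain g where g: "g \<in> mvpolys basis" "Poly_Mapping.single M c - g \<in> rels" using add by auto
  obtain h where h: "h \<in> mvpolys basis" "poly_var v - h \<in> rels" using reduce_var add by auto
  have M: "Poly_Mapping.single M c \<in> mvpolys (A 1)" using add by (auto intro: mvpolys_single)
  have "h \<in> mvpolys (A 1)" using h mvpolys_mono[OF basis_sub] by blast
  \<comment> \<open>Telescoping: replace v by h next to the monomial, then the monomial by g next to
    h.\<close>
  then have 1: "Poly_Mapping.single M c * (poly_var v - h) + h * (Poly_Mapping.single M c - g) \<in> rels"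
    using g h M by (intro rels_add rels_mult)
  have "poly_var v * Poly_Mapping.single M c = Poly_Mapping.single (add_mset v M) c"
    unfolding poly_var_def by (simp add: mult_single)
  then have "Poly_Mapping.single M c * (poly_var v - h) + h * (Poly_Mapping.single M c - g) =
      Poly_Mapping.single (add_mset v M) c - h * g" by (simp add: algebra_simps)
  then show ?case using 1 g h by (metis mvpolys_mult)
qed

lemma reduce_poly:
  assumes "f \<in> mvpolys (A 1)" shows "\<exists>g\<in>mvpolys basis. f - g \<in> rels"
proof -
  have "\<forall>M\<in>Poly_Mapping.keys f. \<exists>g\<in>mvpolys basis. Poly_Mapping.single M (Poly_Mapping.lookup f M) - g \<in> rels"
    using assms reduce_monomial unfolding mvpolys_def by blast
  then obtain g where g: "\<And>M. M \<in> Poly_Mapping.keys f \<Longrightarrow> g M \<in> mvpolys basis \<and>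
      Poly_Mapping.single M (Poly_Mapping.lookup f M) - g M \<in> rels" by metis
  have "(\<Sum>M\<in>Poly_Mapping.keys f. Poly_Mapping.single M (Poly_Mapping.lookup f M) - g M) \<in> rels"
    using g by (intro rels_sum) auto
  then have "f - (\<Sum>M\<in>Poly_Mapping.keys f. g M) \<in> rels"
    unfolding sum_subtractf poly_mapping_expand[symmetric] .
  moreover have "(\<Sum>M\<in>Poly_Mapping.keys f. g M) \<in> mvpolys basis" using g by (intro mvpolys_sum) auto
  ultimately show ?thesis by blast
qed

abbreviation mon :: "'a multiset \<Rightarrow> 'r mvpoly" where
  "mon X \<equiv> Poly_Mapping.single (image_mset (E 1) X) 1"

lemma ev_mon: "set_mset X \<subseteq> L \<Longrightarrow> ev (mon X) = E (size X) (sum_mset X)"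
  by (simp only: ev_single E_prod)

lemma mon_mvpolys: "set_mset X \<subseteq> L \<Longrightarrow> mon X \<in> mvpolys basis"
  by (rule mvpolys_single) auto

text \<open>The binomial in the four exchanged variables is a quadratic relation; multiply it by the
  monomial of the common part.\<close>

lemma swap_rels: assumes "pair_swap L X Y" shows "mon X - mon Y \<in> rels"
proof -
  obtain Z a b c d where *: "X = Z + {#a, b#}" "Y = Z + {#c, d#}" "a + b = c + d"
     "set_mset X \<subseteq> L" "set_mset Y \<subseteq> L" using assms unfolding pair_swap_def by blast
  have L: "set_mset {#a, b#} \<subseteq> L" "set_mset {#c, d#} \<subseteq> L" "set_mset Z \<subseteq> L" using * by auto
  let ?q = "mon {#a, b#} - mon {#c, d#}"
  have "ev ?q = 0" unfolding ev_minus using ev_mon[OF L(1)] ev_mon[OF L(2)] *(3) by simp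
  moreover have "?q \<in> mvpolys (A 1)" using mvpolys_mono[OF basis_sub] mon_mvpolys L by (intro mvpolys_diff) blast+
  moreover have "\<forall>M\<in>Poly_Mapping.keys ?q. size M = 2"
    using keys_diff[of "mon {#a, b#}" "mon {#c, d#}"] by fastforce
  ultimately have "?q \<in> quads" unfolding quads_def eval_kernel_def by blast
  then have "mon Z * ?q \<in> rels"
    using mvpolys_mono[OF basis_sub] mon_mvpolys L by (intro rels_mult rels_generator) blast+
  moreover have "mon Z * ?q = mon X - mon Y" unfolding * by (simp add: right_diff_distrib mult_single)
  ultimately show ?thesis by simp
qed

lemma connected_rels:
  assumes "size X = size Y" "sum_mset X = sum_mset Y" "set_mset X \<subseteq> L" "set_mset Y \<subseteq> L"
  shows "mon X - mon Y \<in> rels"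
  using connected[OF assms]
proof (induction rule: rtranclp_induct)
  case base then show ?case by (simp add: rels_zero)
next
  case (step y z)
  then show ?case using rels_trans swap_rels by blast
qed

text \<open>Induction on the number of monomials. By independence of the E n x, a monomial of g
  cannot be alone in its degree and weight. The difference of two monomials of the same degree and
  weight lies in \<open>rels\<close> by connectedness, and subtracting a multiple of it removes one
  of them.\<close>

lemma kernel_basis:
  assumes "g \<in> mvpolys basis" "ev g = 0" shows "g \<in> rels"
  using assms
proof (induction "card (Poly_Mapping.keys g)" arbitrary: g rule: less_induct)
  case less
  let ?K = "Poly_Mapping.keys g"
  have "\<forall>M\<in>?K. \<exists>X. set_mset X \<subseteq> L \<and> image_mset (E 1) X = M"
  proof
    fix M assume "M \<in> ?K"
    then have "set_mset M \<subseteq> E 1 ` L" using less.prems unfolding mvpolys_def by blast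
    then show "\<exists>X. set_mset X \<subseteq> L \<and> image_mset (E 1) X = M"
    proof (induction M)
      case (add v M)
      then obtain X x where "set_mset X \<subseteq> L" "image_mset (E 1) X = M" "x \<in> L" "v = E 1 x" by auto
      then show ?case by (intro exI[of _ "add_mset x X"]) auto
    qed auto
  qed
  \<comment> \<open>Each monomial gets one chosen multiset of weights, which fixes its degree and
    weight \<tau>.\<close>
  then obtain \<xi> where xi: "\<And>M. M \<in> ?K \<Longrightarrow> set_mset (\<xi> M) \<subseteq> L \<and> image_mset (E 1) (\<xi> M) = M" by metis
  define \<tau> where "\<tau> M = (size (\<xi> M), sum_mset (\<xi> M))" for M
  show ?case
  proof (cases "?K = {}")
    case True then show ?thesis using rels_zero by simp
  next
    case False
    then obtain N where N: "N \<in> ?K" by blast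
    have "\<exists>N'\<in>?K. N' \<noteq> N \<and> \<tau> N' = \<tau> N"
    proof (rule ccontr)
      assume "\<not> ?thesis"
      then have only: "{M\<in>?K. \<tau> M = \<tau> N} = {N}" using N by blast
      \<comment> \<open>Coefficients are collected by degree and weight; for the class of N the sum
        is the single coefficient of N.\<close>
      define c where "c t = (\<Sum>M\<in>{M\<in>?K. \<tau> M = t}. Poly_Mapping.lookup g M)" for t
      have "0 = (\<Sum>M\<in>?K. \<iota> (Poly_Mapping.lookup g M) * prod_mset M)" using less.prems unfolding mvpoly_eval_def by simp
      also have "\<dots> = (\<Sum>M\<in>?K. \<iota> (Poly_Mapping.lookup g M) * E (fst (\<tau> M)) (snd (\<tau> M)))"
      proof (rule sum.cong[OF refl])
        fix M assume "M \<in> ?K"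
        then have "\<iota> 1 * prod_mset M = E (fst (\<tau> M)) (snd (\<tau> M))" using E_prod[of "\<xi> M"] xi unfolding \<tau>_def by simp
        then show "\<iota> (Poly_Mapping.lookup g M) * prod_mset M = \<iota> (Poly_Mapping.lookup g M) * E (fst (\<tau> M)) (snd (\<tau> M))"
          using \<iota>_absorb by (metis mult.assoc)
      qed
      also have "\<dots> = (\<Sum>t\<in>\<tau> ` ?K. \<Sum>M\<in>{M\<in>?K. \<tau> M = t}. \<iota> (Poly_Mapping.lookup g M) * E (fst (\<tau> M)) (snd (\<tau> M)))"
        by (rule sum.image_gen) simp
      also have "\<dots> = (\<Sum>t\<in>\<tau> ` ?K. \<iota> (c t) * E (fst t) (snd t))"
        unfolding c_def \<iota>_sum sum_distrib_right by (intro sum.cong) auto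
      finally have "(\<Sum>t\<in>\<tau> ` ?K. \<iota> (c t) * E (fst t) (snd t)) = 0" by simp
      then have "c (\<tau> N) = 0"
        by (rule E_indep[rotated 2]) (use N xi fold_sums_sum in \<open>auto simp: \<tau>_def\<close>)
      then show False using N unfolding c_def only by (simp add: in_keys_iff)
    qed
    then obtain N' where N': "N' \<in> ?K" "N' \<noteq> N" "\<tau> N' = \<tau> N" by blast
    define a where "a = Poly_Mapping.lookup g N"
    \<comment> \<open>Subtracting r shifts the coefficient of N to N'.\<close>
    define r where "r = Poly_Mapping.single {#} a * (mon (\<xi> N) - mon (\<xi> N'))"
    have r: "r = Poly_Mapping.single N a - Poly_Mapping.single N' a"
      unfolding r_def using xi[OF N] xi[OF N'(1)] by (simp add: right_diff_distrib mult_single)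
    have rr: "r \<in> rels" unfolding r_def
      using connected_rels[of "\<xi> N" "\<xi> N'"] xi[OF N] xi[OF N'(1)] N'(3) unfolding \<tau>_def
      by (intro rels_mult mvpolys_single) auto
    have "Poly_Mapping.keys (g - r) \<subset> ?K"
    proof -
      have "M \<in> ?K - {N}" if "M \<in> Poly_Mapping.keys (g - r)" for M
      proof -
        have nz: "Poly_Mapping.lookup g M \<noteq> (a when N = M) - (a when N' = M)"
          using that unfolding r in_keys_iff by (simp add: lookup_minus lookup_single)
        have "M \<noteq> N" using nz N'(2) unfolding a_def by (auto simp: when_def)
        moreover have "M \<in> ?K" using nz N N' calculation by (cases "M = N'") (auto simp: when_def in_keys_iff)
        ultimately show ?thesis by blast
      qed
      then show ?thesis using N by blast
    qed
    then have "card (Poly_Mapping.keys (g - r)) < card ?K" by (intro psubset_card_mono) auto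
    moreover have "g - r \<in> mvpolys basis"
      unfolding r using less.prems N N' by (intro mvpolys_diff mvpolys_single) (auto simp: mvpolys_def)
    moreover have "ev (g - r) = 0" using rels_sub rr less.prems unfolding ev_minus eval_kernel_def by auto
    ultimately have "g - r \<in> rels" by (rule less.hyps)
    then show ?thesis using rels_add[OF _ rr, of "g - r"] by simp
  qed
qed

lemma kernel_eq: "eval_kernel \<iota> (A 1) = rels"
proof
  show "eval_kernel \<iota> (A 1) \<subseteq> rels"
  proof
    fix f assume f: "f \<in> eval_kernel \<iota> (A 1)"
    then obtain g where g: "g \<in> mvpolys basis" "f - g \<in> rels" using reduce_poly unfolding eval_kernel_def by blast
    then have "ev (f - g) = 0" using rels_sub unfolding eval_kernel_def by blast
    then have "ev g = 0" using f unfolding ev_minus eval_kernel_def by simp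
    then show "f \<in> rels" using rels_add[OF g(2) kernel_basis[OF g(1)]] by simp
  qed
qed (rule rels_sub)

lemma generated: "A n \<subseteq> ev ` mvpolys (A 1)"
proof
  fix z assume "z \<in> A n"
  then obtain B c where B: "finite B" "B \<subseteq> fold_sums L n" "z = (\<Sum>x\<in>B. \<iota> (c x) * E n x)"
    unfolding A_eq by blast
  have "\<exists>f\<in>mvpolys (A 1). ev f = \<iota> (c x) * E n x" if "x \<in> B" for x
  proof -
    obtain X where X: "x = sum_mset X" "size X = n" "set_mset X \<subseteq> L"
      using B(2) \<open>x \<in> B\<close> unfolding fold_sums_def by blast
    have "ev (Poly_Mapping.single (image_mset (E 1) X) (c x)) = \<iota> (c x) * (\<iota> 1 * prod_mset (image_mset (E 1) X))"
      unfolding ev_single using \<iota>_absorb by (metis mult.assoc)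
    also have "\<dots> = \<iota> (c x) * E n x" using E_prod[OF X(3)] X by simp
    finally have "ev (Poly_Mapping.single (image_mset (E 1) X) (c x)) = \<iota> (c x) * E n x" .
    moreover have "set_mset (image_mset (E 1) X) \<subseteq> A 1" unfolding set_image_mset using X(3) basis_sub by blast
    ultimately show ?thesis using mvpolys_single by blast
  qed
  then obtain f where f: "\<And>x. x \<in> B \<Longrightarrow> f x \<in> mvpolys (A 1) \<and> ev (f x) = \<iota> (c x) * E n x" by metis
  then have "z = ev (\<Sum>x\<in>B. f x)" unfolding B(3) ev_sum by simp
  moreover have "(\<Sum>x\<in>B. f x) \<in> mvpolys (A 1)" using f by (intro mvpolys_sum) auto
  ultimately show "z \<in> ev ` mvpolys (A 1)" by blast
qed

theorem quadratic: "quadratic_algebra \<iota> A"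
  unfolding quadratic_algebra_def
  using connected_graded generated kernel_eq unfolding rels_def quads_def by blast

end

section \<open>Sections of the bundle\<close>

text \<open>The classical argument for independence of characters: comparing the relation at y + z
  with exp (f j \<bullet> z) times the relation at y eliminates the term of j.\<close>

lemma exp_inner_independent:
  fixes f :: "'i \<Rightarrow> 'a::real_inner" and a :: "'i \<Rightarrow> complex"
  assumes "finite I" "inj_on f I" "\<And>y. (\<Sum>i\<in>I. a i * exp (of_real (f i \<bullet> y))) = 0" "i \<in> I"
  shows "a i = 0"
  using assms
proof (induction I arbitrary: a i rule: finite_induct)
  case (insert j I)
  let ?e = "\<lambda>i y. exp (of_real (f i \<bullet> y)) :: complex"
  have z: "a j * ?e j y + (\<Sum>i\<in>I. a i * ?e i y) = 0" for y
    using insert.prems(2)[of y] insert.hyps by simp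
  have I: "a i = 0" if i: "i \<in> I" for i
  proof -
    have "(\<Sum>i\<in>I. (a i * (?e i z - ?e j z)) * ?e i y) = 0" for y z
    proof -
      have "(\<Sum>i\<in>I. (a i * (?e i z - ?e j z)) * ?e i y) =
          (a j * ?e j (y + z) + (\<Sum>i\<in>I. a i * ?e i (y + z))) - ?e j z * (a j * ?e j y + (\<Sum>i\<in>I. a i * ?e i y))"
        by (simp add: inner_add_right exp_add algebra_simps sum_distrib_left sum_subtractf)
      then show ?thesis using z by simp
    qed
    then have "a i * (?e i z - ?e j z) = 0" for z
      using insert.IH[of "\<lambda>i. a i * (?e i z - ?e j z)" i] insert.prems(1) i by auto
    \<comment> \<open>At z = f i - f j the two exponents differ by the squared norm of z, which is
      positive as f is injective.\<close>
    moreover have "?e i (f i - f j) \<noteq> ?e j (f i - f j)"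
    proof
      assume "?e i (f i - f j) = ?e j (f i - f j)"
      then have "exp (f i \<bullet> (f i - f j)) = exp (f j \<bullet> (f i - f j))" by (metis exp_of_real of_real_eq_iff)
      then have "(f i - f j) \<bullet> (f i - f j) = 0" by (simp add: inner_diff_left)
      then show False using insert.prems(1) insert.hyps i by (auto simp: inj_on_def)
    qed
    ultimately show "a i = 0" by (metis mult_eq_0_iff right_minus_eq)
  qed
  then have "a j = 0" using z[of 0] by simp
  then show ?case using I insert.prems(3) by auto
qed simp

section \<open>Points of the toric variety and of its torus\<close>

lemma toric_mult:
  assumes "p \<in> toric_variety M F" "u \<in> dual_cone (fst p) \<inter> M" "w \<in> dual_cone (fst p) \<inter> M"
  shows "snd p (u + w) = snd p u * snd p w"
  using assms unfolding toric_variety_def by auto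

lemma toric_zero: "p \<in> toric_variety M F \<Longrightarrow> snd p 0 = 1"
  unfolding toric_variety_def by auto

lemma chart_dual_cone:
  assumes "p \<in> toric_chart M F \<sigma>" shows "p \<in> toric_variety M F" "dual_cone \<sigma> \<subseteq> dual_cone (fst p)"
  using assms unfolding toric_chart_def dual_cone_def by auto

lemma dual_cone_of_nat: "u \<in> dual_cone \<tau> \<Longrightarrow> real n *\<^sub>R u \<in> dual_cone \<tau>"
  unfolding dual_cone_def by auto

lemma toric_power:
  assumes "p \<in> toric_variety (root_lattice \<Phi>) F" "u \<in> dual_cone (fst p) \<inter> root_lattice \<Phi>"
  shows "snd p (real n *\<^sub>R u) = snd p u ^ n"
proof (induction n)
  case 0 then show ?case using toric_zero[OF assms(1)] by simp
next
  case (Suc n)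
  have "snd p (u + real n *\<^sub>R u) = snd p u * snd p (real n *\<^sub>R u)"
    using assms by (intro toric_mult[OF assms(1)]) (auto intro: root_lattice_of_nat dual_cone_of_nat)
  then show ?case using Suc by (simp add: scaleR_add_left add.commute)
qed

text \<open>Points of the dense torus with positive real coordinates. They lie in the chart of every
  chamber, and they suffice for comparing coefficients because the exponentials of distinct
  characters are independent.\<close>

definition torus_point :: "'a::real_inner set \<Rightarrow> 'a \<Rightarrow> 'a toric_point" where
  "torus_point M y = ({0}, \<lambda>u. if u \<in> M then exp (of_real (u \<bullet> y)) else 0)"

lemma torus_point_variety:
  assumes "{0} \<in> F" "0 \<in> M" "\<And>u v. u \<in> M \<Longrightarrow> v \<in> M \<Longrightarrow> u + v \<in> M"
  shows "torus_point M y \<in> toric_variety M F"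
  using assms unfolding torus_point_def toric_variety_def perp_def
  by (auto simp: inner_add_left exp_add)

context special_weights begin

text \<open>Chambers are pointed because the roots span: the endpoints of a segment in a chamber
  with 0 in its interior are orthogonal to every root.\<close>

lemma origin_in_fan: "{0} \<in> weyl_fan \<Phi>"
proof -
  obtain v where v: "regular \<Phi> v" using dominant_chamber_exists[OF fin nz] by blast
  have "{0} face_of chamber \<Phi> v"
    unfolding face_of_def
  proof (intro conjI ballI impI)
    show "{0} \<subseteq> chamber \<Phi> v" by (simp add: mem_chamber)
    fix a b x assume ab: "a \<in> chamber \<Phi> v" "b \<in> chamber \<Phi> v" "x \<in> {0}" "x \<in> open_segment a b"
    then obtain t where t: "0 < t" "t < 1" "0 = (1 - t) *\<^sub>R a + t *\<^sub>R b" unfolding in_segment by auto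
    have z: "\<alpha> \<bullet> a = 0 \<and> \<alpha> \<bullet> b = 0" if al: "\<alpha> \<in> \<Phi>" "\<alpha> \<bullet> v > 0" for \<alpha>
    proof -
      have "\<alpha> \<bullet> a \<ge> 0" "\<alpha> \<bullet> b \<ge> 0" using ab al unfolding mem_chamber by blast+
      then have nn: "(1 - t) * (\<alpha> \<bullet> a) \<ge> 0" "t * (\<alpha> \<bullet> b) \<ge> 0" using t by auto
      have "0 = \<alpha> \<bullet> ((1 - t) *\<^sub>R a + t *\<^sub>R b)" using t(3) by simp
      then have "(1 - t) * (\<alpha> \<bullet> a) + t * (\<alpha> \<bullet> b) = 0" by (simp add: inner_add_right)
      then have "(1 - t) * (\<alpha> \<bullet> a) = 0" "t * (\<alpha> \<bullet> b) = 0" using nn by linarith+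
      then show ?thesis using t by auto
    qed
    have z': "\<alpha> \<bullet> a = 0 \<and> \<alpha> \<bullet> b = 0" if al: "\<alpha> \<in> \<Phi>" for \<alpha>
    proof (cases "\<alpha> \<bullet> v > 0")
      case False
      then show ?thesis using z[of "- \<alpha>"] regular_neg[OF rs v al] by auto
    qed (use z al in auto)
    have "c = 0" if c: "\<And>\<alpha>. \<alpha> \<in> \<Phi> \<Longrightarrow> \<alpha> \<bullet> c = 0" for c
    proof -
      have "subspace {w. w \<bullet> c = 0}" by (auto simp: subspace_def inner_add_left)
      then have "span \<Phi> \<subseteq> {w. w \<bullet> c = 0}" using c by (intro span_minimal) auto
      moreover have "c \<in> span \<Phi>" using rs unfolding root_system_def by blast
      ultimately have "c \<bullet> c = 0" by blast
      then show ?thesis by simp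
    qed
    then show "a \<in> {0}" "b \<in> {0}" using z' by auto
  qed auto
  then show ?thesis using v unfolding weyl_fan_def weyl_chambers_eq[OF rs] by blast
qed

lemma torus_point_chart:
  assumes "\<sigma> \<in> weyl_chambers \<Phi>"
  shows "torus_point (root_lattice \<Phi>) y \<in> toric_chart (root_lattice \<Phi>) (weyl_fan \<Phi>) \<sigma>"
proof -
  have "0 \<in> \<sigma>" using assms unfolding weyl_chambers_eq[OF rs] by (auto simp: mem_chamber)
  then show ?thesis unfolding toric_chart_def
    using torus_point_variety[OF origin_in_fan root_lattice_zero root_lattice_add]
    by (auto simp: torus_point_def)
qed

end

text \<open>The value 0 off the charts is the default prescribed by \<open>bundle_fibre\<close> and
  \<open>global_sections\<close>.\<close>

definition weight_section :: "'a::real_inner set \<Rightarrow> 'a set set \<Rightarrow> 'a set set \<Rightarrow> ('a set \<Rightarrow> 'a) \<Rightarrow> nat \<Rightarrow> 'a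
    \<Rightarrow> 'a toric_point \<Rightarrow> 'a set \<Rightarrow> complex" where
  "weight_section M F C \<mu> n x = (\<lambda>p \<sigma>. if \<sigma> \<in> C \<and> p \<in> toric_chart M F \<sigma> then snd p (real n *\<^sub>R \<mu> \<sigma> - x) else 0)"

section \<open>Global sections as combinations of weight sections\<close>

locale special_bundle = special_weights \<Phi> "\<lambda>v. \<mu> (chamber \<Phi> v)" for \<Phi> :: "'a::euclidean_space set" and \<mu>
begin

abbreviation M where "M \<equiv> root_lattice \<Phi>"
abbreviation F where "F \<equiv> weyl_fan \<Phi>"
abbreviation C where "C \<equiv> weyl_chambers \<Phi>"
abbreviation Weights where "Weights n \<equiv> bundle_weights \<Phi> (\<lambda>v. real n *\<^sub>R \<mu> (chamber \<Phi> v))"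
abbreviation sec where "sec \<equiv> weight_section M F C \<mu>"
abbreviation scalar where "scalar \<equiv> section_scalar M F C"

lemma mem_Weights: "x \<in> Weights n \<longleftrightarrow> (\<forall>\<sigma>\<in>C. real n *\<^sub>R \<mu> \<sigma> - x \<in> dual_cone \<sigma> \<inter> M)"
  unfolding bundle_weights_def weyl_chambers_eq[OF rs] dual_cone_def by auto

lemma chamber_exists: obtains \<sigma> where "\<sigma> \<in> C"
  using dominant_chamber_exists[OF fin nz] that unfolding weyl_chambers_eq[OF rs] by blast

text \<open>A point common to both chambers satisfies the condition of \<open>vertex_diff\<close> in
  both orders, so the difference of the vertices vanishes on it. Transition characters are therefore
  nonzero on overlaps of charts.\<close>

lemma vertex_perp:
  assumes "\<sigma> \<in> C" "\<sigma>' \<in> C" "\<tau> \<subseteq> \<sigma>" "\<tau> \<subseteq> \<sigma>'"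
  shows "\<mu> \<sigma> - \<mu> \<sigma>' \<in> perp \<tau> \<inter> M"
proof -
  obtain v u where v: "regular \<Phi> v" "\<sigma> = chamber \<Phi> v" and u: "regular \<Phi> u" "\<sigma>' = chamber \<Phi> u"
    using assms(1,2) unfolding weyl_chambers_eq[OF rs] by blast
  have "(\<mu> \<sigma> - \<mu> \<sigma>') \<bullet> w = 0" if "w \<in> \<tau>" for w
  proof -
    have w: "w \<in> chamber \<Phi> v" "w \<in> chamber \<Phi> u" using that assms u v by auto
    then have "(\<mu> \<sigma> - \<mu> \<sigma>') \<bullet> w \<ge> 0" "(\<mu> \<sigma>' - \<mu> \<sigma>) \<bullet> w \<ge> 0"
      using vertex_diff[OF v(1) u(1)] vertex_diff[OF u(1) v(1)] unfolding u v mem_chamber by blast+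
    then show ?thesis by (simp add: inner_diff_left)
  qed
  then show ?thesis using vertex_diff[OF v(1) u(1)] u v unfolding perp_def by auto
qed

lemma vertex_dual:
  assumes "\<sigma> \<in> C" "\<sigma>' \<in> C" "p \<in> toric_chart M F \<sigma>" "p \<in> toric_chart M F \<sigma>'"
  shows "\<mu> \<sigma> - \<mu> \<sigma>' \<in> dual_cone (fst p) \<inter> M"
  using vertex_perp[OF assms(1,2), of "fst p"] assms(3,4)
  unfolding toric_chart_def perp_def dual_cone_def by auto

lemma sec_transition:
  assumes "x \<in> Weights n" "\<sigma> \<in> C" "\<sigma>' \<in> C" "p \<in> toric_chart M F \<sigma>" "p \<in> toric_chart M F \<sigma>'"
  shows "snd p (real n *\<^sub>R \<mu> \<sigma> - x) = snd p (\<mu> \<sigma> - \<mu> \<sigma>') ^ n * snd p (real n *\<^sub>R \<mu> \<sigma>' - x)"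
proof -
  note pv = chart_dual_cone[OF assms(4)] and d = vertex_dual[OF assms(2-5)]
  have e: "real n *\<^sub>R \<mu> \<sigma> - x = real n *\<^sub>R (\<mu> \<sigma> - \<mu> \<sigma>') + (real n *\<^sub>R \<mu> \<sigma>' - x)" by (simp add: algebra_simps)
  have a: "real n *\<^sub>R (\<mu> \<sigma> - \<mu> \<sigma>') \<in> dual_cone (fst p) \<inter> M"
    using d by (auto intro: root_lattice_of_nat dual_cone_of_nat)
  have b: "real n *\<^sub>R \<mu> \<sigma>' - x \<in> dual_cone (fst p) \<inter> M"
    using assms(1,3) chart_dual_cone[OF assms(5)] unfolding mem_Weights by blast
  show ?thesis by (subst e) (simp only: toric_mult[OF pv(1) a b] toric_power[OF pv(1) d])
qed

lemma combination_global:
  assumes "finite B" "B \<subseteq> Weights n"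
  shows "(\<lambda>p \<sigma>. \<Sum>x\<in>B. c x * sec n x p \<sigma>) \<in> global_sections M F C (bundle_power (polytope_bundle \<mu>) n)"
  unfolding global_sections_def
proof (intro CollectI conjI ballI allI impI)
  fix p assume "p \<in> toric_variety M F"
  show "(\<lambda>\<sigma>. \<Sum>x\<in>B. c x * sec n x p \<sigma>) \<in> bundle_fibre M F C (bundle_power (polytope_bundle \<mu>) n) p"
    unfolding bundle_fibre_def
  proof (intro CollectI conjI ballI allI impI)
    fix \<sigma> assume "\<not> (\<sigma> \<in> C \<and> p \<in> toric_chart M F \<sigma>)"
    then show "(\<Sum>x\<in>B. c x * sec n x p \<sigma>) = 0" unfolding weight_section_def by auto
  next
    fix \<sigma> \<sigma>' assume s: "\<sigma> \<in> C" "\<sigma>' \<in> C" "p \<in> toric_chart M F \<sigma> \<inter> toric_chart M F \<sigma>'"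
    show "(\<Sum>x\<in>B. c x * sec n x p \<sigma>) = bundle_power (polytope_bundle \<mu>) n \<sigma> \<sigma>' p * (\<Sum>x\<in>B. c x * sec n x p \<sigma>')"
      unfolding sum_distrib_left
    proof (rule sum.cong[OF refl])
      fix x assume "x \<in> B"
      then have "sec n x p \<sigma> = bundle_power (polytope_bundle \<mu>) n \<sigma> \<sigma>' p * sec n x p \<sigma>'"
        using sec_transition[of x n \<sigma> \<sigma>' p] assms s
        unfolding weight_section_def bundle_power_def polytope_bundle_def character_value_def by auto
      then show "c x * sec n x p \<sigma> = bundle_power (polytope_bundle \<mu>) n \<sigma> \<sigma>' p * (c x * sec n x p \<sigma>')" by simp
    qed
  qed
next
  fix p assume "p \<notin> toric_variety M F"
  then show "(\<lambda>\<sigma>. \<Sum>x\<in>B. c x * sec n x p \<sigma>) = 0"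
    unfolding weight_section_def toric_chart_def by (auto simp: fun_eq_iff)
next
  fix \<sigma> assume s: "\<sigma> \<in> C"
  have inj: "inj_on (\<lambda>x. real n *\<^sub>R \<mu> \<sigma> - x) B" by (auto simp: inj_on_def)
  show "regular_on_chart M F \<sigma> (\<lambda>p. \<Sum>x\<in>B. c x * sec n x p \<sigma>)"
    unfolding regular_on_chart_def
  proof (intro exI conjI ballI)
    show "finite ((\<lambda>x. real n *\<^sub>R \<mu> \<sigma> - x) ` B)" using assms by simp
    show "(\<lambda>x. real n *\<^sub>R \<mu> \<sigma> - x) ` B \<subseteq> dual_cone \<sigma> \<inter> M" using assms s unfolding mem_Weights subset_iff by blast
    fix p assume "p \<in> toric_chart M F \<sigma>"
    then show "(\<Sum>x\<in>B. c x * sec n x p \<sigma>) =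
        (\<Sum>u\<in>(\<lambda>x. real n *\<^sub>R \<mu> \<sigma> - x) ` B. c (real n *\<^sub>R \<mu> \<sigma> - u) * character_value u p)"
      using s unfolding sum.reindex[OF inj] by (simp add: weight_section_def character_value_def)
  qed
qed

lemma torus_value: "u \<in> M \<Longrightarrow> snd (torus_point M y) u = exp (of_real (u \<bullet> y))"
  unfolding torus_point_def by simp

text \<open>On each chart a section is a finite combination of characters. Indexed by weights and
  compared on the torus, where exponentials are independent, these expansions have the same
  coefficients on all charts, so they come from one combination of weight sections.\<close>

lemma global_combination:
  assumes s: "s \<in> global_sections M F C (bundle_power (polytope_bundle \<mu>) n)"
  shows "\<exists>B c. finite B \<and> B \<subseteq> Weights n \<and> s = (\<lambda>p \<sigma>. \<Sum>x\<in>B. c x * sec n x p \<sigma>)"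
proof -
  define expansion where "expansion \<sigma> S c \<longleftrightarrow> finite S \<and> S \<subseteq> dual_cone \<sigma> \<inter> M \<and>
        (\<forall>p\<in>toric_chart M F \<sigma>. s p \<sigma> = (\<Sum>u\<in>S. c u * character_value u p))" for \<sigma> S c
  have "\<forall>\<sigma>\<in>C. \<exists>S c. expansion \<sigma> S c"
    using s unfolding global_sections_def regular_on_chart_def expansion_def by blast
  then obtain S c where "\<And>\<sigma>. \<sigma> \<in> C \<Longrightarrow> expansion \<sigma> (S \<sigma>) (c \<sigma>)" by metis
  then obtain S c where S: "\<And>\<sigma>. \<sigma> \<in> C \<Longrightarrow> finite (S \<sigma>)" "\<And>\<sigma>. \<sigma> \<in> C \<Longrightarrow> S \<sigma> \<subseteq> dual_cone \<sigma> \<inter> M"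
    and c: "\<And>\<sigma> p. \<sigma> \<in> C \<Longrightarrow> p \<in> toric_chart M F \<sigma> \<Longrightarrow> s p \<sigma> = (\<Sum>u\<in>S \<sigma>. c \<sigma> u * character_value u p)"
    unfolding expansion_def by blast
  define X where "X \<sigma> = (\<lambda>u. real n *\<^sub>R \<mu> \<sigma> - u) ` S \<sigma>" for \<sigma>
  \<comment> \<open>Coefficients are indexed by the weight x = n \<mu> \<sigma> - u instead of the
    character u and extended by 0, so that different charts can be compared.\<close>
  define e where "e \<sigma> x = (if x \<in> X \<sigma> then c \<sigma> (real n *\<^sub>R \<mu> \<sigma> - x) else 0)" for \<sigma> x
  have inj: "inj_on (\<lambda>u. real n *\<^sub>R \<mu> \<sigma> - u) (S \<sigma>)" for \<sigma> by (auto simp: inj_on_def)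
  have val: "s p \<sigma> = (\<Sum>x\<in>Z. e \<sigma> x * snd p (real n *\<^sub>R \<mu> \<sigma> - x))"
    if "\<sigma> \<in> C" "p \<in> toric_chart M F \<sigma>" "finite Z" "X \<sigma> \<subseteq> Z" for \<sigma> p Z
  proof -
    have "s p \<sigma> = (\<Sum>x\<in>X \<sigma>. e \<sigma> x * snd p (real n *\<^sub>R \<mu> \<sigma> - x))"
      unfolding c[OF that(1,2)] X_def sum.reindex[OF inj] by (auto simp: e_def X_def character_value_def intro!: sum.cong)
    also have "\<dots> = (\<Sum>x\<in>Z. e \<sigma> x * snd p (real n *\<^sub>R \<mu> \<sigma> - x))"
      using that by (intro sum.mono_neutral_left) (auto simp: e_def)
    finally show ?thesis .
  qed
  have finX: "finite (X \<sigma>)" if "\<sigma> \<in> C" for \<sigma> using S(1)[OF that] unfolding X_def by simp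
  have XM: "real n *\<^sub>R \<mu> \<sigma> - x \<in> dual_cone \<sigma> \<inter> M" if "\<sigma> \<in> C" "x \<in> X \<sigma>" for \<sigma> x
    using S(2)[OF that(1)] that(2) unfolding X_def by auto
  have same: "e \<sigma> x = e \<sigma>' x" if sg: "\<sigma> \<in> C" "\<sigma>' \<in> C" for \<sigma> \<sigma>' x
  proof (cases "x \<in> X \<sigma> \<union> X \<sigma>'")
    case False then show ?thesis by (simp add: e_def)
  next
    case True
    \<comment> \<open>On the torus the exponential of n \<mu> \<rho> splits off as a factor. The
      quotient of two such factors is the transition function, so the remaining sums agree.\<close>
    have tor: "s (torus_point M y) \<rho> = exp (of_real ((real n *\<^sub>R \<mu> \<rho>) \<bullet> y)) * (\<Sum>x\<in>X \<sigma> \<union> X \<sigma>'. e \<rho> x * exp (of_real ((- x) \<bullet> y)))"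
      if r: "\<rho> \<in> {\<sigma>, \<sigma>'}" for y \<rho>
    proof -
      have "s (torus_point M y) \<rho> = (\<Sum>x\<in>X \<sigma> \<union> X \<sigma>'. e \<rho> x * snd (torus_point M y) (real n *\<^sub>R \<mu> \<rho> - x))"
        using r sg finX by (intro val torus_point_chart) auto
      also have "\<dots> = (\<Sum>x\<in>X \<sigma> \<union> X \<sigma>'. exp (of_real ((real n *\<^sub>R \<mu> \<rho>) \<bullet> y)) * (e \<rho> x * exp (of_real ((- x) \<bullet> y))))"
      proof (rule sum.cong[OF refl])
        fix x
        show "e \<rho> x * snd (torus_point M y) (real n *\<^sub>R \<mu> \<rho> - x) =
           exp (of_real ((real n *\<^sub>R \<mu> \<rho>) \<bullet> y)) * (e \<rho> x * exp (of_real ((- x) \<bullet> y)))"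
        proof (cases "x \<in> X \<rho>")
          case True
          then have "real n *\<^sub>R \<mu> \<rho> - x \<in> M" using XM[of \<rho> x] r sg by auto
          then show ?thesis by (simp add: torus_value inner_diff_left exp_diff exp_minus field_simps)
        qed (simp add: e_def)
      qed
      finally show ?thesis by (simp add: sum_distrib_left)
    qed
    have "(\<Sum>x\<in>X \<sigma> \<union> X \<sigma>'. (e \<sigma> x - e \<sigma>' x) * exp (of_real ((- x) \<bullet> y))) = 0" for y
    proof -
      let ?p = "torus_point M y"
      have ch: "?p \<in> toric_chart M F \<sigma>" "?p \<in> toric_chart M F \<sigma>'" using torus_point_chart sg by auto
      then have "s ?p \<in> bundle_fibre M F C (bundle_power (polytope_bundle \<mu>) n) ?p"
        using s chart_dual_cone(1)[OF ch(1)] unfolding global_sections_def by blast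
      then have "s ?p \<sigma> = bundle_power (polytope_bundle \<mu>) n \<sigma> \<sigma>' ?p * s ?p \<sigma>'"
        using sg ch unfolding bundle_fibre_def by blast
      moreover have "bundle_power (polytope_bundle \<mu>) n \<sigma> \<sigma>' ?p = exp (of_real ((real n *\<^sub>R \<mu> \<sigma>) \<bullet> y)) / exp (of_real ((real n *\<^sub>R \<mu> \<sigma>') \<bullet> y))"
      proof -
        have "\<mu> \<sigma> - \<mu> \<sigma>' \<in> M" using vertex_dual[OF sg ch] by blast
        then show ?thesis unfolding bundle_power_def polytope_bundle_def character_value_def
          by (simp add: torus_value exp_of_nat_mult[symmetric] exp_diff[symmetric] inner_diff_left algebra_simps)
      qed
      ultimately have "(\<Sum>x\<in>X \<sigma> \<union> X \<sigma>'. e \<sigma> x * exp (of_real ((- x) \<bullet> y))) = (\<Sum>x\<in>X \<sigma> \<union> X \<sigma>'. e \<sigma>' x * exp (of_real ((- x) \<bullet> y)))"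
        using tor[of \<sigma> y] tor[of \<sigma>' y] by (simp add: field_simps)
      then show ?thesis by (simp add: left_diff_distrib sum_subtractf)
    qed
    then have "e \<sigma> x - e \<sigma>' x = 0"
      using exp_inner_independent[of "X \<sigma> \<union> X \<sigma>'" "\<lambda>x. - x" "\<lambda>x. e \<sigma> x - e \<sigma>' x" x] finX sg True
      by (auto simp: inj_on_def)
    then show ?thesis by simp
  qed
  obtain \<sigma>0 where s0: "\<sigma>0 \<in> C" using chamber_exists .
  \<comment> \<open>A weight with nonzero coefficient in one chart has it in all, hence its
    characters are regular on all charts and it belongs to \<open>Weights n\<close>.\<close>
  define B where "B = {x\<in>X \<sigma>0. e \<sigma>0 x \<noteq> 0}"
  have BX: "B \<subseteq> X \<sigma>" and Be: "x \<in> X \<sigma> - B \<Longrightarrow> e \<sigma> x = 0" if "\<sigma> \<in> C" for \<sigma> x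
  proof -
    show "B \<subseteq> X \<sigma>"
    proof
      fix x assume "x \<in> B"
      then have "e \<sigma> x \<noteq> 0" using same[OF s0 that] unfolding B_def by auto
      then show "x \<in> X \<sigma>" unfolding e_def by (auto split: if_splits)
    qed
    show "e \<sigma> x = 0" if "x \<in> X \<sigma> - B"
      using that same[OF s0 \<open>\<sigma> \<in> C\<close>, of x] unfolding B_def e_def by (auto split: if_splits)
  qed
  have "finite B" using finX[OF s0] unfolding B_def by simp
  moreover have "B \<subseteq> Weights n" using BX XM unfolding mem_Weights subset_iff by blast
  moreover have "s = (\<lambda>p \<sigma>. \<Sum>x\<in>B. e \<sigma>0 x * sec n x p \<sigma>)"
  proof (intro ext)
    fix p \<sigma>
    show "s p \<sigma> = (\<Sum>x\<in>B. e \<sigma>0 x * sec n x p \<sigma>)"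
    proof (cases "\<sigma> \<in> C \<and> p \<in> toric_chart M F \<sigma>")
      case True
      then have "s p \<sigma> = (\<Sum>x\<in>X \<sigma>. e \<sigma> x * snd p (real n *\<^sub>R \<mu> \<sigma> - x))" using val finX by blast
      also have "\<dots> = (\<Sum>x\<in>B. e \<sigma> x * snd p (real n *\<^sub>R \<mu> \<sigma> - x))"
        using True finX BX Be by (intro sum.mono_neutral_right) auto
      finally have "s p \<sigma> = (\<Sum>x\<in>B. e \<sigma> x * snd p (real n *\<^sub>R \<mu> \<sigma> - x))" .
      moreover have "e \<sigma> = e \<sigma>0" using True same[OF s0] by auto
      ultimately show ?thesis using True by (simp add: weight_section_def)
    next
      case False
      then have "s p \<sigma> = 0"
      proof (cases "p \<in> toric_variety M F")
        case True
        then show ?thesis using s False unfolding global_sections_def bundle_fibre_def by blast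
      next
        case False
        then have "s p = 0" using s unfolding global_sections_def by blast
        then show ?thesis by simp
      qed
      moreover have "sec n x p \<sigma> = 0" for x using False by (auto simp: weight_section_def)
      ultimately show ?thesis by simp
    qed
  qed
  ultimately show ?thesis by blast
qed

lemma scalar_sec:
  "scalar c * monom (sec n x) n = monom (\<lambda>p \<sigma>. c * sec n x p \<sigma>) n"
  unfolding section_scalar_def mult_monom
  by (auto intro!: arg_cong2[where f = monom] simp: fun_eq_iff weight_section_def)

lemma sum_apply2: "(\<Sum>x\<in>B. f x) p \<sigma> = (\<Sum>x\<in>B. (f x p \<sigma> :: complex))"
  by (induction B rule: infinite_finite_induct) auto

lemma sum_scalar_sec:
  "(\<Sum>x\<in>B. scalar (c x) * monom (sec n x) n) = monom (\<lambda>p \<sigma>. \<Sum>x\<in>B. c x * sec n x p \<sigma>) n"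
proof -
  have "(\<Sum>x\<in>B. scalar (c x) * monom (sec n x) n) = monom (\<Sum>x\<in>B. (\<lambda>p \<sigma>. c x * sec n x p \<sigma>)) n"
    unfolding scalar_sec monom_sum ..
  also have "(\<Sum>x\<in>B. (\<lambda>p \<sigma>. c x * sec n x p \<sigma>)) = (\<lambda>p \<sigma>. \<Sum>x\<in>B. c x * sec n x p \<sigma>)"
    by (intro ext) (simp add: sum_apply2)
  finally show ?thesis .
qed

text \<open>Degrees are separated by the coefficients of the ambient polynomial; within one degree,
  evaluation at torus points in a single chart reduces to independence of exponentials.\<close>

lemma sec_independent:
  assumes B: "finite B" "\<And>t. t \<in> B \<Longrightarrow> snd t \<in> Weights (fst t)"
    and z: "(\<Sum>t\<in>B. scalar (c t) * monom (sec (fst t) (snd t)) (fst t)) = 0" and t: "t \<in> B"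
  shows "c t = 0"
proof -
  obtain \<sigma> where s: "\<sigma> \<in> C" using chamber_exists .
  define n where "n = fst t"
  define B' where "B' = {t\<in>B. fst t = n}"
  have "0 = coeff (\<Sum>t\<in>B. scalar (c t) * monom (sec (fst t) (snd t)) (fst t)) n" using z by simp
  also have "\<dots> = (\<Sum>t\<in>B. if fst t = n then (\<lambda>p \<sigma>. c t * sec n (snd t) p \<sigma>) else 0)"
    unfolding scalar_sec coeff_sum by (intro sum.cong) auto
  also have "\<dots> = (\<Sum>t\<in>B'. (\<lambda>p \<sigma>. c t * sec n (snd t) p \<sigma>))"
    unfolding B'_def using B(1) by (simp add: sum.inter_filter)
  finally have zero: "0 = (\<Sum>t\<in>B'. (\<lambda>p \<sigma>. c t * sec n (snd t) p \<sigma>))" .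
  have vanish: "(\<Sum>t\<in>B'. c t * sec n (snd t) p \<sigma>) = 0" for p
  proof -
    have "(\<Sum>t\<in>B'. (\<lambda>p \<sigma>. c t * sec n (snd t) p \<sigma>)) p \<sigma> = 0" unfolding zero[symmetric] by simp
    then show ?thesis unfolding sum_apply2 .
  qed
  have "(\<Sum>t\<in>B'. c t * exp (of_real ((real n *\<^sub>R \<mu> \<sigma> - snd t) \<bullet> y))) = 0" for y
  proof -
    have "(\<Sum>t\<in>B'. c t * exp (of_real ((real n *\<^sub>R \<mu> \<sigma> - snd t) \<bullet> y))) = (\<Sum>t\<in>B'. c t * sec n (snd t) (torus_point M y) \<sigma>)"
    proof (rule sum.cong[OF refl])
      fix t assume "t \<in> B'"
      then have "snd t \<in> Weights n" using B(2) unfolding B'_def by auto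
      then have "real n *\<^sub>R \<mu> \<sigma> - snd t \<in> M" using s unfolding mem_Weights by blast
      then show "c t * exp (of_real ((real n *\<^sub>R \<mu> \<sigma> - snd t) \<bullet> y)) = c t * sec n (snd t) (torus_point M y) \<sigma>"
        using s torus_point_chart[OF s] by (simp add: weight_section_def torus_value)
    qed
    then show ?thesis using vanish by simp
  qed
  moreover have "inj_on (\<lambda>t. real n *\<^sub>R \<mu> \<sigma> - snd t) B'" unfolding B'_def by (auto simp: inj_on_def prod_eq_iff)
  moreover have "t \<in> B'" "finite B'" using t B unfolding B'_def n_def by auto
  ultimately show ?thesis using exp_inner_independent[of B' "\<lambda>t. real n *\<^sub>R \<mu> \<sigma> - snd t" c t] by blast
qed

lemma semigroup_algebra:
  "graded_semigroup_algebra scalar (section_ring M F C (polytope_bundle \<mu>))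
     (bundle_weights \<Phi> (\<lambda>v. \<mu> (chamber \<Phi> v))) (\<lambda>n x. monom (sec n x) n)"
proof
  let ?L = "bundle_weights \<Phi> (\<lambda>v. \<mu> (chamber \<Phi> v))"
  show "scalar (a + b) = scalar a + scalar b" for a b
    unfolding section_scalar_def add_monom by (auto intro!: arg_cong2[where f = monom] simp: fun_eq_iff)
  show "scalar (a * b) = scalar a * scalar b" for a b
    unfolding section_scalar_def mult_monom by (auto intro!: arg_cong2[where f = monom] simp: fun_eq_iff)
  show "section_ring M F C (polytope_bundle \<mu>) n =
    {\<Sum>x\<in>B. scalar (c x) * monom (sec n x) n | B c. finite B \<and> B \<subseteq> fold_sums ?L n}" for n
    unfolding section_ring_def sum_scalar_sec bundle_weights_power[symmetric]
    using global_combination[of _ n] combination_global[of _ n] by blast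
  show "monom (sec n x) n * monom (sec k y) k = monom (sec (n + k) (x + y)) (n + k)"
    if "x \<in> fold_sums ?L n" "y \<in> fold_sums ?L k" for n k x y
  proof -
    have xy: "x \<in> Weights n" "y \<in> Weights k" using that bundle_weights_power by auto
    have "sec n x p \<sigma> * sec k y p \<sigma> = sec (n + k) (x + y) p \<sigma>" for p \<sigma>
    proof (cases "\<sigma> \<in> C \<and> p \<in> toric_chart M F \<sigma>")
      case True
      note pv = chart_dual_cone[OF conjunct2[OF True]]
      have "real n *\<^sub>R \<mu> \<sigma> - x \<in> dual_cone (fst p) \<inter> M" "real k *\<^sub>R \<mu> \<sigma> - y \<in> dual_cone (fst p) \<inter> M"
        using xy pv True unfolding mem_Weights by blast+
      from toric_mult[OF pv(1) this] show ?thesis using True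
        by (simp add: weight_section_def algebra_simps)
    qed (auto simp: weight_section_def)
    then show ?thesis unfolding mult_monom by (auto intro!: arg_cong2[where f = monom] simp: fun_eq_iff)
  qed
  show "monom (sec 0 0) 0 = scalar 1"
  proof -
    \<comment> \<open>A toric point takes the value 1 at the character 0, so this section is 1 on
      the charts and 0 elsewhere, like \<open>scalar 1\<close>.\<close>
    have "sec 0 0 = (\<lambda>p \<sigma>. if \<sigma> \<in> C \<and> p \<in> toric_chart M F \<sigma> then 1 else 0)"
      by (intro ext) (auto simp: weight_section_def dest: chart_dual_cone(1) toric_zero)
    then show ?thesis unfolding section_scalar_def by simp
  qed
  show "scalar 1 * monom (sec n x) n = monom (sec n x) n" for n x unfolding scalar_sec by simp
  show "c t = 0" if "finite B" "\<And>t. t \<in> B \<Longrightarrow> snd t \<in> fold_sums ?L (fst t)"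
    "(\<Sum>t\<in>B. scalar (c t) * monom (sec (fst t) (snd t)) (fst t)) = 0" "t \<in> B" for B c and t :: "nat \<times> 'a"
    using sec_independent[OF that(1) _ that(3,4)] that(2) bundle_weights_power by blast
  show "(pair_swap ?L)\<^sup>*\<^sup>* X Y"
    if "size X = size Y" "sum_mset X = sum_mset Y" "set_mset X \<subseteq> ?L" "set_mset Y \<subseteq> ?L" for X Y
    using bundle_weights_connected that by blast
qed

end

theorem corollary1p6:
  fixes \<Phi> :: "'a::euclidean_space set" and P :: "'a set" and \<mu> :: "'a set \<Rightarrow> 'a"
  assumes "root_system \<Phi>" and "reduced_roots \<Phi>" and "irreducible_roots \<Phi>"
    and "ample_polytope \<Phi> P \<mu>" and "special_polytope \<Phi> \<mu>"
  shows "quadratic_algebra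
           (section_scalar (root_lattice \<Phi>) (weyl_fan \<Phi>) (weyl_chambers \<Phi>))
           (section_ring (root_lattice \<Phi>) (weyl_fan \<Phi>) (weyl_chambers \<Phi>) (polytope_bundle \<mu>))"
proof -
  interpret special_bundle \<Phi> \<mu>
    using special_weights_of_polytope assms unfolding special_bundle_def by blast
  show ?thesis by (rule graded_semigroup_algebra.quadratic[OF semigroup_algebra])
qed

end
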